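(* Let $\mathfrak n,\mathfrak n'$ be nilradicals in $\mathfrak g$. If $\mathfrak n\subset\mathfrak n'$ and $\tilde{\mathfrak n}=\widetilde{\mathfrak n'}$ (i.e., $\mathfrak n$ and $\mathfrak n'$ have the same optimisation), then $\mathcal F(\mathfrak n')\subset\mathcal F(\mathfrak n)\subset\mathfrak n$.
   Context: Everything is over $\mathbb C$. $G$ is a connected simple algebraic group, $\mathfrak g=\mathrm{Lie}\,G=\mathfrak u\oplus\mathfrak t\oplus\mathfrak u^-$ a fixed triangular decomposition, $\mathfrak b=\mathfrak u\oplus\mathfrak t$. $\Delta$ is the root system of $(\mathfrak g,\mathfrak t)$, $\Delta^+$ the set of roots of $\mathfrak u$, $\Pi$ the simple roots, $\theta$ the highest root, $\mathfrak g_\gamma$ the root spaces, $[\gamma:\alpha]$ the coefficient of $\alpha\in\Pi$ in $\gamma$, $\mathrm{supp}(\gamma)=\{\alpha\in\Pi\mid[\gamma:\alpha]\ne0\}$. A nilradical $\mathfrak n$ means the (nonzero) nilradical of a standard parabolic subalgebra $\mathfrak p\supset\mathfrak b$; $\Delta(\mathfrak n)\subset\Delta^+$ is its set of roots. Kostant cascade. For an irreducible root subsystem $\Delta'\subset\Delta$ with highest root $\beta'$, the descendants of $\beta'$ are the highest roots of the irreducible components of $\{\gamma\in\Delta'\mid(\gamma,\beta')=0\}$. The Kostant cascade $\mathcal K=\{\beta_1=\theta,\dots,\beta_m\}\subset\Delta^+$ is obtained from $(\Delta,\theta)$ by iteratively taking descendants. For $\beta_i\in\mathcal K$, $\Delta\langle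 i\rangle$ is the irreducible root system with simple roots $\mathrm{supp}(\beta_i)$ (its highest root is $\beta_i$), $\mathcal H_{\beta_i}=\{\gamma\in\Delta\langle i\rangle\cap\Delta^+\mid(\gamma,\beta_i)\ne0\}$ and $\mathfrak h_i=\bigoplus_{\gamma\in\mathcal H_{\beta_i}}\mathfrak g_\gamma$. The optimisation of $\mathfrak n$ is the nilradical $\tilde{\mathfrak n}=\bigoplus_{\beta_i\in\mathcal K\cap\Delta(\mathfrak n)}\mathfrak h_i\supset\mathfrak n$. Frobenius semiradical. For a Lie algebra $\mathfrak q$, $\mathfrak q^*_{\rm reg}$ is the set of $\xi\in\mathfrak q^*$ whose stabiliser $\mathfrak q^\xi$ (in the coadjoint representation) has minimal dimension, and $\mathcal F(\mathfrak q)=\sum_{\xi\in\mathfrak q^*_{\rm reg}}\mathfrak q^\xi$. *)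

theory Defs
  imports Complex_Main "HOL-Library.Function_Algebras"
begin

text \<open>
  Linear forms on a subspace \<open>W\<close> are total functions \<open>'a \<Rightarrow> complex\<close> that are linear on \<open>W\<close> and
  vanish outside \<open>W\<close>; so equality of functions is equality of forms on \<open>W\<close>, and the
  pointwise operations are those of the dual space.
\<close>

definition fscale :: "complex \<Rightarrow> ('a \<Rightarrow> complex) \<Rightarrow> 'a \<Rightarrow> complex"
  where "fscale c f = (\<lambda>x. c * f x)"

interpretation forms: vector_space fscale
  by unfold_locales (auto simp: fscale_def fun_eq_iff algebra_simps)

locale complex_lie_algebra =
  finite_dimensional_vector_space scale Basis
  for scale :: "complex \<Rightarrow> 'a::ab_group_add \<Rightarrow> 'a" (infixr \<open>*s\<close> 75)
    and Basis :: "'a set" +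
  fixes bracket :: "'a \<Rightarrow> 'a \<Rightarrow> 'a"
  assumes bracket_add_left: "bracket (x + y) z = bracket x z + bracket y z"
    and bracket_add_right: "bracket x (y + z) = bracket x y + bracket x z"
    and bracket_scale_left: "bracket (c *s x) y = c *s bracket x y"
    and bracket_scale_right: "bracket x (c *s y) = c *s bracket x y"
    and bracket_self: "bracket x x = 0"
    and jacobi: "bracket x (bracket y z) + bracket y (bracket z x) + bracket z (bracket x y) = 0"
begin

definition subalgebra :: "'a set \<Rightarrow> bool"
  where "subalgebra q \<longleftrightarrow> subspace q \<and> (\<forall>x\<in>q. \<forall>y\<in>q. bracket x y \<in> q)"

definition ideal_of :: "'a set \<Rightarrow> 'a set \<Rightarrow> bool"
  where "ideal_of I q \<longleftrightarrow> subspace I \<and> I \<subseteq> q \<and> (\<forall>x\<in>q. \<forall>y\<in>I. bracket x y \<in> I)"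

definition simple_lie :: bool
  where "simple_lie \<longleftrightarrow>
    (\<exists>x y. bracket x y \<noteq> 0) \<and> (\<forall>I. ideal_of I UNIV \<longrightarrow> I = {0} \<or> I = UNIV)"

primrec lower_central :: "'a set \<Rightarrow> nat \<Rightarrow> 'a set"
  where
    "lower_central q 0 = q"
  | "lower_central q (Suc k) = span {bracket x y | x y. x \<in> q \<and> y \<in> lower_central q k}"

definition nilpotent :: "'a set \<Rightarrow> bool"
  where "nilpotent q \<longleftrightarrow> (\<exists>k. lower_central q k = {0})"

definition is_nilradical_of :: "'a set \<Rightarrow> 'a set \<Rightarrow> bool"
  where "is_nilradical_of n p \<longleftrightarrow>
    ideal_of n p \<and> nilpotent n \<and> (\<forall>I. ideal_of I p \<and> nilpotent I \<longrightarrow> I \<subseteq> n)"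

definition cartan_subalgebra :: "'a set \<Rightarrow> bool"
  where "cartan_subalgebra t \<longleftrightarrow>
    subalgebra t \<and> nilpotent t \<and> {x. \<forall>h\<in>t. bracket x h \<in> t} = t"

definition dual_space :: "'a set \<Rightarrow> ('a \<Rightarrow> complex) set"
  where "dual_space W = {\<xi>.
    (\<forall>x\<in>W. \<forall>y\<in>W. \<xi> (x + y) = \<xi> x + \<xi> y) \<and>
    (\<forall>c. \<forall>x\<in>W. \<xi> (c *s x) = c * \<xi> x) \<and>
    (\<forall>x. x \<notin> W \<longrightarrow> \<xi> x = 0)}"


subsection \<open>The Frobenius semiradical\<close>

definition coadjoint :: "'a set \<Rightarrow> 'a \<Rightarrow> ('a \<Rightarrow> complex) \<Rightarrow> 'a \<Rightarrow> complex"
  where "coadjoint q x \<xi> = (\<lambda>y. if y \<in> q then - \<xi> (bracket x y) else 0)"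

definition stabiliser :: "'a set \<Rightarrow> ('a \<Rightarrow> complex) \<Rightarrow> 'a set"
  where "stabiliser q \<xi> = {x \<in> q. coadjoint q x \<xi> = 0}"

definition regular_forms :: "'a set \<Rightarrow> ('a \<Rightarrow> complex) set"
  where "regular_forms q = {\<xi> \<in> dual_space q.
    \<forall>\<eta>\<in>dual_space q. dim (stabiliser q \<xi>) \<le> dim (stabiliser q \<eta>)}"

definition frobenius_semiradical :: "'a set \<Rightarrow> 'a set"
  where "frobenius_semiradical q = span (\<Union>\<xi>\<in>regular_forms q. stabiliser q \<xi>)"


subsection \<open>The Killing form\<close>

definition trace_map :: "('a \<Rightarrow> 'a) \<Rightarrow> complex"
  where "trace_map f = (\<Sum>b\<in>Basis. representation Basis (f b) b)"

definition killing :: "'a \<Rightarrow> 'a \<Rightarrow> complex"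
  where "killing x y = trace_map (\<lambda>z. bracket x (bracket y z))"

end


subsection \<open>Roots and triangular decompositions\<close>

locale lie_algebra_triple = complex_lie_algebra +
  fixes u t um :: "'a set"
begin

definition root_space :: "('a \<Rightarrow> complex) \<Rightarrow> 'a set"
  where "root_space \<gamma> = {x. \<forall>h\<in>t. bracket h x = \<gamma> h *s x}"

definition roots :: "('a \<Rightarrow> complex) set"
  where "roots = {\<gamma> \<in> dual_space t. \<gamma> \<noteq> 0 \<and> root_space \<gamma> \<noteq> {0}}"

definition roots_in :: "'a set \<Rightarrow> ('a \<Rightarrow> complex) set"
  where "roots_in n = {\<gamma> \<in> roots. root_space \<gamma> \<subseteq> n}"

definition pos_roots :: "('a \<Rightarrow> complex) set"
  where "pos_roots = roots_in u"

definition simple_roots :: "('a \<Rightarrow> complex) set"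
  where "simple_roots = {\<alpha> \<in> pos_roots. \<not> (\<exists>\<gamma>\<in>pos_roots. \<exists>\<delta>\<in>pos_roots. \<alpha> = \<gamma> + \<delta>)}"

text \<open>The coefficient \<open>[\<gamma>:\<alpha>]\<close>; meaningful because the simple roots are independent below.\<close>

definition coeff :: "('a \<Rightarrow> complex) \<Rightarrow> ('a \<Rightarrow> complex) \<Rightarrow> complex"
  where "coeff \<gamma> \<alpha> = forms.representation simple_roots \<gamma> \<alpha>"

definition supp :: "('a \<Rightarrow> complex) \<Rightarrow> ('a \<Rightarrow> complex) set"
  where "supp \<gamma> = {\<alpha> \<in> simple_roots. coeff \<gamma> \<alpha> \<noteq> 0}"

text \<open>
  The conditions on roots say that \<open>simple_roots\<close> is a base of the root system with
  \<open>pos_roots\<close> as its set of positive roots.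
\<close>

definition triangular_decomposition :: bool
  where "triangular_decomposition \<longleftrightarrow>
    cartan_subalgebra t \<and>
    u = span (\<Union>\<gamma>\<in>pos_roots. root_space \<gamma>) \<and>
    um = span (\<Union>\<gamma>\<in>pos_roots. root_space (- \<gamma>)) \<and>
    (\<forall>x. \<exists>!(a, h, b). a \<in> u \<and> h \<in> t \<and> b \<in> um \<and> x = a + h + b) \<and>
    roots = pos_roots \<union> uminus ` pos_roots \<and>
    forms.independent simple_roots \<and>
    (\<forall>\<gamma>\<in>pos_roots. \<gamma> \<in> forms.span simple_roots \<and> (\<forall>\<alpha>\<in>simple_roots. coeff \<gamma> \<alpha> \<in> \<nat>))"

definition borel :: "'a set"
  where "borel = {a + h | a h. a \<in> u \<and> h \<in> t}"

definition standard_nilradical :: "'a set \<Rightarrow> bool"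
  where "standard_nilradical n \<longleftrightarrow>
    (\<exists>p. subalgebra p \<and> borel \<subseteq> p \<and> is_nilradical_of n p) \<and> n \<noteq> {0}"


subsection \<open>The Kostant cascade and the optimisation\<close>

text \<open>The form on the dual of \<open>t\<close> is the one transported from the Killing form restricted to \<open>t\<close>.\<close>

definition dual_vector :: "('a \<Rightarrow> complex) \<Rightarrow> 'a"
  where "dual_vector \<mu> = (THE h. h \<in> t \<and> (\<forall>h'\<in>t. killing h h' = \<mu> h'))"

definition root_form :: "('a \<Rightarrow> complex) \<Rightarrow> ('a \<Rightarrow> complex) \<Rightarrow> complex"
  where "root_form \<mu> \<nu> = killing (dual_vector \<mu>) (dual_vector \<nu>)"

definition irreducible_roots :: "('a \<Rightarrow> complex) set \<Rightarrow> bool"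
  where "irreducible_roots R \<longleftrightarrow> R \<noteq> {} \<and>
    \<not> (\<exists>A B. A \<noteq> {} \<and> B \<noteq> {} \<and> A \<union> B = R \<and> A \<inter> B = {} \<and>
        (\<forall>\<gamma>\<in>A. \<forall>\<delta>\<in>B. root_form \<gamma> \<delta> = 0))"

definition irreducible_component :: "('a \<Rightarrow> complex) set \<Rightarrow> ('a \<Rightarrow> complex) set \<Rightarrow> bool"
  where "irreducible_component C R \<longleftrightarrow>
    C \<subseteq> R \<and> irreducible_roots C \<and> (\<forall>\<gamma>\<in>C. \<forall>\<delta>\<in>R - C. root_form \<gamma> \<delta> = 0)"

text \<open>
  The positive roots of a subsystem \<open>R\<close> are \<open>R \<inter> pos_roots\<close>; its highest root is the greatest
  element of \<open>R\<close> for the root order that they define.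
\<close>

definition highest_root :: "('a \<Rightarrow> complex) set \<Rightarrow> ('a \<Rightarrow> complex) \<Rightarrow> bool"
  where "highest_root R \<beta> \<longleftrightarrow> \<beta> \<in> R \<and>
    (\<forall>\<gamma>\<in>R. \<exists>c :: ('a \<Rightarrow> complex) \<Rightarrow> nat.
      \<beta> - \<gamma> = (\<Sum>\<delta>\<in>R \<inter> pos_roots. fscale (of_nat (c \<delta>)) \<delta>))"

inductive cascade_pair :: "('a \<Rightarrow> complex) set \<Rightarrow> ('a \<Rightarrow> complex) \<Rightarrow> bool"
  where
    top: "highest_root roots \<theta> \<Longrightarrow> cascade_pair roots \<theta>"
  | descendant: "cascade_pair R \<beta> \<Longrightarrow>
      irreducible_component C {\<gamma> \<in> R. root_form \<gamma> \<beta> = 0} \<Longrightarrow>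
      highest_root C \<beta>' \<Longrightarrow> cascade_pair C \<beta>'"

definition cascade :: "('a \<Rightarrow> complex) set"
  where "cascade = {\<beta>. \<exists>R. cascade_pair R \<beta>}"

definition supp_system :: "('a \<Rightarrow> complex) \<Rightarrow> ('a \<Rightarrow> complex) set"
  where "supp_system \<beta> = {\<gamma> \<in> roots. supp \<gamma> \<subseteq> supp \<beta>}"

definition heisenberg_roots :: "('a \<Rightarrow> complex) \<Rightarrow> ('a \<Rightarrow> complex) set"
  where "heisenberg_roots \<beta> = {\<gamma> \<in> supp_system \<beta> \<inter> pos_roots. root_form \<gamma> \<beta> \<noteq> 0}"

definition heisenberg :: "('a \<Rightarrow> complex) \<Rightarrow> 'a set"
  where "heisenberg \<beta> = span (\<Union>\<gamma>\<in>heisenberg_roots \<beta>. root_space \<gamma>)"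

definition optimisation :: "'a set \<Rightarrow> 'a set"
  where "optimisation n = span (\<Union>\<beta>\<in>cascade \<inter> roots_in n. heisenberg \<beta>)"

end

locale simple_lie_algebra = lie_algebra_triple +
  assumes simple: "simple_lie"
    and triangular: "triangular_decomposition"

end

theory Submission
  imports Defs
begin

text \<open>
  For a subspace \<open>q\<close> and a linear form \<open>f\<close>, \<open>rad f q\<close> is the radical of \<open>(x, y) \<mapsto> f [x, y]\<close> on \<open>q\<close>. If
  \<open>q \<subseteq> r\<close>, restricting the form costs at most \<open>dim r - dim q\<close> in the dimension of the radical; so if
  \<open>dim q + ind q = dim r + ind r\<close>, then the stabiliser of a regular form on \<open>r\<close> lies in the stabiliser of its
  restriction to \<open>q\<close>, which is regular, and \<open>\<F>(r) \<subseteq> \<F>(q)\<close>.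

  It remains to see that \<open>dim n + ind n\<close> depends only on the set \<open>K\<close> of cascade elements in \<open>n\<close>, hence only on
  the optimisation: it is the sum over \<open>K\<close> of \<open>card H + 1\<close>, \<open>H\<close> the Heisenberg set of the cascade element. The form dual to
  \<open>K\<close> gives one inequality. For the other, the Heisenberg parts are split off one by one, starting with the
  largest, by automorphisms \<open>exp (ad x)\<close>; forms vanishing on the cascade element are limits of the others.
\<close>

context complex_lie_algebra
begin

subsection \<open>Linear algebra\<close>

text \<open>The hypotheses give only a simple Lie algebra with a Cartan subalgebra and a base, so
  the root theory is derived from them: integrality of the coefficients makes the Killing form
  nonzero, simplicity makes it nondegenerate, and sl(2)-strings give the rest. The comparison is
  asymmetric: the lower bound is needed for all forms on \<open>n\<close>, the upper bound for one
  form on \<open>n'\<close>, and the latter is inherited from the optimisation, which contains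
  \<open>n'\<close>. The summand card H + 1 arises as follows. Let D be the set of roots of
  \<open>n\<close>. The cascade element \<beta> and the roots \<gamma> of H \<inter> D with \<beta>
  - \<gamma> outside D have no partner in D, and they contribute to the radical. A nilradical
  containing a sum of two positive roots contains one of them, so there are card (H - D) such
  \<gamma>; with the card (H \<inter> D) dimensions of \<open>n\<close> this makes card H + 1. The
  obstacle is that a general form mixes the Heisenberg parts. Adding a root of a smaller or
  orthogonal part to one of a larger H stays in H and avoids \<beta>, which dictates the order of
  splitting. The element x in the exponential requires division by the value of the form at the root
  vector of \<beta>; hence the limit argument.\<close>

lemma bracket_zero_left [simp]: "bracket 0 x = 0"
  using bracket_add_left[of 0 0 x] by simp

lemma bracket_zero_right [simp]: "bracket x 0 = 0"
  using bracket_add_right[of x 0 0] by simp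

lemma bracket_anticommute: "bracket x y = - bracket y x"
proof -
  have "0 = bracket (x + y) (x + y)" by (rule bracket_self[symmetric])
  also have "\<dots> = bracket x y + bracket y x"
    by (simp only: bracket_add_left bracket_add_right) (simp add: bracket_self)
  finally have "bracket x y + bracket y x = 0" by (rule sym)
  then show ?thesis by (simp add: eq_neg_iff_add_eq_0)
qed

lemma bracket_minus_left [simp]: "bracket (- x) y = - bracket x y"
  using bracket_add_left[of x "- x" y] by (simp add: eq_neg_iff_add_eq_0 add.commute)

lemma bracket_minus_right [simp]: "bracket x (- y) = - bracket x y"
  using bracket_add_right[of x y "- y"] by (simp add: eq_neg_iff_add_eq_0 add.commute)

lemma bracket_diff_right: "bracket x (y - z) = bracket x y - bracket x z"
  using bracket_add_right[of x y "- z"] by simp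

lemma bracket_sum_left: "bracket (sum f A) y = (\<Sum>a\<in>A. bracket (f a) y)"
  by (induction A rule: infinite_finite_induct) (auto simp: bracket_add_left)

lemma bracket_leibniz: "bracket x (bracket y z) = bracket (bracket x y) z + bracket y (bracket x z)"
proof -
  have 1: "bracket (bracket x y) z = - bracket z (bracket x y)"
    by (rule bracket_anticommute)
  have 2: "bracket y (bracket x z) = - bracket y (bracket z x)"
    using bracket_anticommute[of x z] by simp
  show ?thesis
    using jacobi[of x y z] unfolding 1 2 by (simp add: algebra_simps eq_neg_iff_add_eq_0)
qed

lemma bracket_span_subset:
  assumes "x \<in> span S" "y \<in> span T" "subspace V"
    and "\<And>a b. a \<in> S \<Longrightarrow> b \<in> T \<Longrightarrow> bracket a b \<in> V"
  shows "bracket x y \<in> V"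
proof -
  have 1: "bracket a y \<in> V" if a: "a \<in> S" for a
    using assms(2)
  proof (induction rule: span_induct)
    case base
    show ?case
      using subspace_add[OF assms(3)] subspace_scale[OF assms(3)] subspace_0[OF assms(3)]
      by (auto intro!: subspaceI simp: bracket_add_right bracket_scale_right)
  next
    case (step b)
    then show ?case using assms(4)[OF a] by simp
  qed
  show ?thesis
    using assms(1)
  proof (induction rule: span_induct)
    case base
    show ?case
      using subspace_add[OF assms(3)] subspace_scale[OF assms(3)] subspace_0[OF assms(3)]
      by (auto intro!: subspaceI simp: bracket_add_left bracket_scale_left)
  next
    case (step a)
    then show ?case using 1 by simp
  qed
qed

text \<open>Forms in \<open>dual_space W\<close> vanish outside \<open>W\<close> and are in general
  not additive on the whole space. Estimates that compare one form on two nested subspaces are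
  therefore made with forms that are linear everywhere.\<close>

definition linear_form :: "('a \<Rightarrow> complex) \<Rightarrow> bool"
  where "linear_form f \<longleftrightarrow> (\<forall>x y. f (x + y) = f x + f y) \<and> (\<forall>c x. f (c *s x) = c * f x)"

lemma linear_form_add: "linear_form f \<Longrightarrow> f (x + y) = f x + f y"
  and linear_form_scale: "linear_form f \<Longrightarrow> f (c *s x) = c * f x"
  by (auto simp: linear_form_def)

lemma linear_form_zero: "linear_form f \<Longrightarrow> f 0 = 0"
  using linear_form_add[of f 0 0] by simp

lemma linear_form_minus: "linear_form f \<Longrightarrow> f (- x) = - f x"
  using linear_form_add[of f x "- x"] by (simp add: linear_form_zero eq_neg_iff_add_eq_0 add.commute)

lemma linear_form_diff: "linear_form f \<Longrightarrow> f (x - y) = f x - f y"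
  using linear_form_add[of f x "- y"] by (simp add: linear_form_minus)

lemma linear_form_sum: "linear_form f \<Longrightarrow> f (sum g A) = (\<Sum>a\<in>A. f (g a))"
  by (induction A rule: infinite_finite_induct) (auto simp: linear_form_add linear_form_zero)

lemma linear_form_eq_0_on_span:
  assumes "linear_form f" "\<And>x. x \<in> S \<Longrightarrow> f x = 0" "x \<in> span S"
  shows "f x = 0"
  using assms(3)
  by (induction rule: span_induct)
    (auto intro!: subspaceI simp: assms linear_form_add linear_form_scale linear_form_zero)

lemma linear_form_bracket_right: "linear_form f \<Longrightarrow> linear_form (\<lambda>y. f (bracket x y))"
  and linear_form_bracket_left: "linear_form f \<Longrightarrow> linear_form (\<lambda>x. f (bracket x y))"
  by (auto simp: linear_form_def bracket_add_right bracket_add_left bracket_scale_right bracket_scale_left)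

lemma linear_form_representation:
  assumes "independent B" "span B = UNIV"
  shows "linear_form (\<lambda>x. representation B x b)"
  using assms by (auto simp: linear_form_def representation_add representation_scale)

text \<open>A basis of \<open>W\<close> is extended to a basis of the whole space, and the new basis
  vectors are sent to 0.\<close>

lemma dual_space_extend:
  assumes "subspace W" "\<xi> \<in> dual_space W"
  obtains f where "linear_form f" "\<And>x. x \<in> W \<Longrightarrow> f x = \<xi> x"
proof -
  obtain B where B: "B \<subseteq> W" "independent B" "W \<subseteq> span B" "card B = dim W"
    using basis_exists by blast
  have BW: "span B = W" using B assms(1) by (simp add: span_subspace)
  obtain D where D: "B \<subseteq> D" "independent D" "UNIV \<subseteq> span D"
    using maximal_independent_subset_extend[OF subset_UNIV B(2)] by metis
  have fin: "finite B" using B(2) finiteI_independent by blast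
  define f where "f x = (\<Sum>b\<in>B. representation D x b * \<xi> b)" for x
  have "linear_form (\<lambda>x. representation D x b)" for b
    using D by (intro linear_form_representation) auto
  then have lf: "linear_form f"
    by (auto simp: linear_form_def f_def sum.distrib distrib_right sum_distrib_left mult.assoc)
  have fB: "f x = \<xi> x" if "x \<in> B" for x
  proof -
    have "representation D x b * \<xi> b = (if b = x then \<xi> x else 0)" for b
      using that D by (auto simp: representation_basis)
    then show ?thesis using that fin by (simp add: f_def)
  qed
  have z: "0 \<in> W" using assms(1) by (rule subspace_0)
  have "\<xi> (0 *s 0) = 0 * \<xi> 0" using assms(2) z unfolding dual_space_def by blast
  then have "\<xi> 0 = 0" by simp
  have "x \<in> W \<and> f x = \<xi> x" if "x \<in> span B" for x
    using that
  proof (induction rule: span_induct)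
    case base
    show ?case
      using assms lf \<open>\<xi> 0 = 0\<close>
      by (auto intro!: subspaceI simp: subspace_0 subspace_add subspace_scale dual_space_def
          linear_form_add linear_form_scale linear_form_zero)
  next
    case (step x)
    then show ?case using fB B(1) by auto
  qed
  then show ?thesis using that lf BW by blast
qed

text \<open>Applied to \<open>N = {0}\<close> this is the independence of weight vectors of distinct weights.\<close>

lemma weight_component_mem:
  assumes "finite F" "subspace N"
    and add: "\<And>h x y. h \<in> H \<Longrightarrow> A h (x + y) = A h x + A h y"
    and scale: "\<And>h c x. h \<in> H \<Longrightarrow> A h (c *s x) = c *s A h x"
    and stable: "\<And>h x. h \<in> H \<Longrightarrow> x \<in> N \<Longrightarrow> A h x \<in> N"
    and "\<And>i h. i \<in> F \<Longrightarrow> h \<in> H \<Longrightarrow> A h (v i) = wt i h *s v i"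
    and "\<And>i j. i \<in> F \<Longrightarrow> j \<in> F \<Longrightarrow> i \<noteq> j \<Longrightarrow> \<exists>h\<in>H. wt i h \<noteq> wt j h"
    and "(\<Sum>i\<in>F. v i) \<in> N" "i \<in> F"
  shows "v i \<in> N"
  using assms(1,6-)
proof (induction F arbitrary: v i rule: finite_induct)
  case empty
  then show ?case by simp
next
  case (insert j F)
  have A0: "A h 0 = 0" if "h \<in> H" for h
    using scale[OF that, of 0 0] by simp
  have Asum: "A h (\<Sum>i\<in>I. w i) = (\<Sum>i\<in>I. A h (w i))" if "h \<in> H" for h w and I :: "'b set"
    by (induction I rule: infinite_finite_induct) (auto simp: add[OF that] A0[OF that])
  have F: "v i \<in> N" if i: "i \<in> F" for i
  proof -
    obtain h where h: "h \<in> H" "wt i h \<noteq> wt j h"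
      using insert.prems(2)[of i j] i insert.hyps(2) by auto
    \<comment> \<open>\<open>A h - wt j h\<close> removes the \<open>j\<close>-th summand and keeps
      the sum in \<open>N\<close>, so the induction hypothesis applies to the rescaled
      vectors.\<close>
    let ?w = "\<lambda>i. (wt i h - wt j h) *s v i"
    have "A h (\<Sum>i\<in>insert j F. v i) = (\<Sum>i\<in>insert j F. wt i h *s v i)"
      by (subst Asum[OF h(1)], rule sum.cong) (auto simp: insert.prems(1)[OF _ h(1)])
    then have "A h (\<Sum>i\<in>insert j F. v i) - wt j h *s (\<Sum>i\<in>insert j F. v i)
        = (\<Sum>i\<in>insert j F. ?w i)"
      by (simp only: scale_left_diff_distrib sum_subtractf scale_sum_right)
    also have "\<dots> = (\<Sum>i\<in>F. ?w i)" using insert.hyps by simp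
    finally have "(\<Sum>i\<in>F. ?w i) \<in> N"
      using stable[OF h(1) insert.prems(3)] insert.prems(3) assms(2)
      by (metis subspace_diff subspace_scale)
    moreover have "A h' (?w i) = wt i h' *s ?w i" if "i \<in> F" "h' \<in> H" for i h'
      using that insert.prems(1)[of i h'] by (simp add: scale mult.commute)
    ultimately have "?w i \<in> N"
      using insert.IH[of ?w i] insert.prems(2) i by simp
    then have "inverse (wt i h - wt j h) *s ?w i \<in> N"
      using assms(2) by (metis subspace_scale)
    then show ?thesis using h by simp
  qed
  have "(\<Sum>i\<in>insert j F. v i) - (\<Sum>i\<in>F. v i) \<in> N"
    using insert.prems(3) F assms(2) by (simp add: subspace_diff subspace_sum)
  then have "v j \<in> N" using insert.hyps by simp
  then show ?case using F insert.prems(4) by auto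
qed


subsection \<open>Radicals of the alternating forms of linear forms\<close>

definition rad :: "('a \<Rightarrow> complex) \<Rightarrow> 'a set \<Rightarrow> 'a set"
  where "rad f W = {x \<in> W. \<forall>y\<in>W. f (bracket x y) = 0}"

lemma subspace_rad: "linear_form f \<Longrightarrow> subspace W \<Longrightarrow> subspace (rad f W)"
  by (auto intro!: subspaceI simp: rad_def subspace_0 subspace_add subspace_scale
      bracket_add_left bracket_scale_left linear_form_add linear_form_scale linear_form_zero)

lemma rad_subset: "rad f W \<subseteq> W"
  by (auto simp: rad_def)

lemma rad_cong:
  assumes "subalgebra W" "\<And>x. x \<in> W \<Longrightarrow> f x = g x"
  shows "rad f W = rad g W"
  using assms by (auto simp: rad_def subalgebra_def)

lemma stabiliser_eq_rad: "stabiliser q \<xi> = rad \<xi> q"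
  by (auto simp: stabiliser_def rad_def coadjoint_def fun_eq_iff)

lemma dim_kernel_inter:
  assumes "linear_form \<phi>" "subspace V"
  shows "dim V \<le> Suc (dim {x \<in> V. \<phi> x = 0})"
proof (cases "\<exists>v\<in>V. \<phi> v \<noteq> 0")
  case False
  then have "{x \<in> V. \<phi> x = 0} = V" by auto
  then show ?thesis by simp
next
  case True
  then obtain v where v: "v \<in> V" "\<phi> v \<noteq> 0" by blast
  let ?K = "{x \<in> V. \<phi> x = 0}"
  have "V \<subseteq> span (insert v ?K)"
  proof
    fix x assume x: "x \<in> V"
    have "x - (\<phi> x / \<phi> v) *s v \<in> span ?K"
      by (rule span_base) (use x v assms in \<open>simp add: subspace_diff subspace_scale linear_form_diff linear_form_scale\<close>)
    then show "x \<in> span (insert v ?K)"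
      unfolding span_breakdown_eq by blast
  qed
  then have "dim V \<le> dim (insert v ?K)" by (rule dim_mono)
  then show ?thesis by (simp add: dim_insert split: if_splits)
qed

lemma dim_common_kernel_inter:
  assumes "finite C" "\<And>c. c \<in> C \<Longrightarrow> linear_form (\<phi> c)" "subspace V"
  shows "dim V \<le> card C + dim {x \<in> V. \<forall>c\<in>C. \<phi> c x = 0}"
  using assms(1,2)
proof (induction C rule: finite_induct)
  case empty
  then show ?case by simp
next
  case (insert c C)
  let ?K = "{x \<in> V. \<forall>c\<in>C. \<phi> c x = 0}"
  have "subspace ?K"
    using assms(3) insert.prems
    by (auto intro!: subspaceI simp: subspace_0 subspace_add subspace_scale
        linear_form_add linear_form_scale linear_form_zero)
  then have "dim ?K \<le> Suc (dim {x \<in> ?K. \<phi> c x = 0})"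
    using insert.prems by (intro dim_kernel_inter) auto
  moreover have "{x \<in> ?K. \<phi> c x = 0} = {x \<in> V. \<forall>c\<in>insert c C. \<phi> c x = 0}" by auto
  ultimately show ?case using insert by simp
qed

text \<open>A basis \<open>B\<close> of \<open>q\<close> is completed to a basis \<open>D\<close> of
  \<open>r\<close>. A vector of \<open>rad f q\<close> that pairs to 0 with the
  \<open>dim r - dim q\<close> vectors of \<open>D - B\<close> pairs to 0 with all of
  \<open>r\<close>, and each of these conditions lowers the dimension by at most one.\<close>

lemma dim_rad_subspace:
  assumes f: "linear_form f" and q: "subspace q" and r: "subspace r" and "q \<subseteq> r"
  shows "dim (rad f q) + dim q \<le> dim r + dim (rad f r \<inter> q)"
proof -
  obtain B where B: "B \<subseteq> q" "independent B" "q \<subseteq> span B" "card B = dim q"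
    using basis_exists by blast
  have "B \<subseteq> r" using B(1) assms(4) by blast
  then obtain D where D: "B \<subseteq> D" "D \<subseteq> r" "independent D" "r \<subseteq> span D"
    using maximal_independent_subset_extend[OF _ B(2)] by metis
  have fin: "finite D" using D finiteI_independent by blast
  have cD: "card D = dim r" using D basis_card_eq_dim by blast
  let ?K = "{x \<in> rad f q. \<forall>c\<in>D - B. f (bracket x c) = 0}"
  have "dim (rad f q) \<le> card (D - B) + dim ?K"
    using fin f q
    by (intro dim_common_kernel_inter) (auto simp: linear_form_bracket_left subspace_rad)
  moreover have "?K \<subseteq> rad f r \<inter> q"
  proof
    fix x assume x: "x \<in> ?K"
    have 1: "f (bracket x c) = 0" if "c \<in> D" for c
      using x that B(1) by (cases "c \<in> B") (auto simp: rad_def)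
    have "f (bracket x y) = 0" if "y \<in> r" for y
      by (rule linear_form_eq_0_on_span[of "\<lambda>y. f (bracket x y)" D])
        (use 1 that D f in \<open>auto simp: linear_form_bracket_right\<close>)
    then show "x \<in> rad f r \<inter> q" using x assms(4) by (auto simp: rad_def)
  qed
  then have "dim ?K \<le> dim (rad f r \<inter> q)" by (rule dim_subset)
  moreover have "card (D - B) = dim r - dim q"
    using D(1) fin B(4) cD by (simp add: card_Diff_subset finite_subset)
  moreover have "dim q \<le> dim r" using assms(4) by (rule dim_subset)
  ultimately show ?thesis by linarith
qed

text \<open>The hypothesis is \<open>dim r + ind r \<le> dim q + ind q\<close>; it turns every estimate of
  \<open>dim_rad_subspace\<close> into an equality.\<close>

lemma frobenius_semiradical_mono:
  assumes q: "subalgebra q" and r: "subalgebra r" and "q \<subseteq> r"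
    and lower: "\<And>f. linear_form f \<Longrightarrow> m \<le> dim (rad f q) + dim q"
    and upper: "linear_form g" "dim (rad g r) + dim r \<le> m"
  shows "frobenius_semiradical r \<subseteq> frobenius_semiradical q"
proof -
  have sq: "subspace q" and sr: "subspace r" using q r by (auto simp: subalgebra_def)
  \<comment> \<open>Truncation turns an everywhere linear form into a member of
    \<open>dual_space W\<close> without changing its radical on a subalgebra.\<close>
  define res where "res W f = (\<lambda>x. if x \<in> W then f x else 0 :: complex)" for W :: "'a set" and f
  have res: "res W f \<in> dual_space W" if "linear_form f" "subspace W" for f W
    using that by (auto simp: res_def dual_space_def linear_form_add linear_form_scale
        subspace_add subspace_scale)
  have rad_res: "rad (res W f) W = rad f W" if "subalgebra W" for W f
    by (rule rad_cong) (use that in \<open>auto simp: res_def\<close>)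
  have main: "stabiliser r \<xi> \<subseteq> frobenius_semiradical q" if \<xi>: "\<xi> \<in> regular_forms r" for \<xi>
  proof -
    have \<xi>d: "\<xi> \<in> dual_space r" using \<xi> by (simp add: regular_forms_def)
    obtain f where f: "linear_form f" "\<And>x. x \<in> r \<Longrightarrow> f x = \<xi> x"
      using dual_space_extend[OF sr \<xi>d] by metis
    have st: "stabiliser r \<xi> = rad f r"
      unfolding stabiliser_eq_rad using f r by (intro rad_cong) auto
    have "dim (stabiliser r \<xi>) \<le> dim (stabiliser r (res r g))"
      using \<xi> res[OF upper(1) sr] by (simp add: regular_forms_def)
    then have 1: "dim (rad f r) + dim r \<le> m"
      using upper(2) unfolding st unfolding stabiliser_eq_rad rad_res[OF r] by linarith
    have 2: "dim (rad f q) + dim q \<le> dim r + dim (rad f r \<inter> q)"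
      by (rule dim_rad_subspace) (use f sq sr assms(3) in auto)
    have 3: "dim (rad f r \<inter> q) \<le> dim (rad f r)" by (rule dim_subset) auto
    have eq: "dim (rad f r \<inter> q) = dim (rad f r)" "dim (rad f q) + dim q = m"
      using 1 2 3 lower[OF f(1)] by auto
    have "rad f r \<inter> q = rad f r"
      using eq f sq sr by (intro subspace_dim_equal) (auto simp: subspace_inter subspace_rad)
    then have sub: "rad f r \<subseteq> rad f q" using assms(3) by (auto simp: rad_def)
    \<comment> \<open>The radical of the restriction has dimension \<open>m - dim q\<close>, the
      smallest value that \<open>lower\<close> allows; hence regularity.\<close>
    have "res q f \<in> regular_forms q"
      unfolding regular_forms_def
    proof (intro CollectI conjI ballI)
      show "res q f \<in> dual_space q" using res f sq by blast
    next
      fix \<eta> assume "\<eta> \<in> dual_space q"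
      then obtain f' where f': "linear_form f'" "\<And>x. x \<in> q \<Longrightarrow> f' x = \<eta> x"
        using dual_space_extend[OF sq] by metis
      have "stabiliser q \<eta> = rad f' q"
        unfolding stabiliser_eq_rad using f' q by (intro rad_cong) auto
      then show "dim (stabiliser q (res q f)) \<le> dim (stabiliser q \<eta>)"
        using lower[OF f'(1)] eq(2) q by (simp add: stabiliser_eq_rad rad_res)
    qed
    moreover have "stabiliser q (res q f) = rad f q"
      using q by (simp add: stabiliser_eq_rad rad_res)
    ultimately show ?thesis
      using sub unfolding st frobenius_semiradical_def by (blast intro: span_base)
  qed
  show ?thesis
    unfolding frobenius_semiradical_def[of r]
    by (rule span_minimal) (use main in \<open>auto simp: frobenius_semiradical_def\<close>)
qed

lemma frobenius_semiradical_subset: "subspace q \<Longrightarrow> frobenius_semiradical q \<subseteq> q"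
  unfolding frobenius_semiradical_def
  by (rule span_minimal) (auto simp: stabiliser_def)

text \<open>On a complement \<open>U\<close> of \<open>rad f W\<close> the map \<open>L f\<close> to the dual space is injective, with a
  left inverse \<open>p\<close>. If \<open>f + s g\<close> had a kernel vector on \<open>U\<close> for every \<open>s \<noteq> 0\<close>, then \<open>p \<circ> L g\<close>
  would have infinitely many eigenvalues \<open>-1/s\<close>.\<close>

lemma rad_semicontinuous:
  assumes f: "linear_form f" and g: "linear_form g" and W: "subspace W"
    and bound: "\<And>s. s \<noteq> 0 \<Longrightarrow> k \<le> dim (rad (\<lambda>x. f x + s * g x) W)"
  shows "k \<le> dim (rad f W)"
proof -
  define L where "L h x = (\<lambda>y. if y \<in> W then h (bracket x y) else 0 :: complex)"
    for h and x
  interpret vp: vector_space_pair scale fscale by unfold_locales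
  have linL: "Vector_Spaces.linear scale fscale (L h)" if "linear_form h" for h
    using that
    by (auto simp: Vector_Spaces.linear_iff vector_space_axioms forms.vector_space_axioms L_def fun_eq_iff
        bracket_add_left bracket_scale_left linear_form_add linear_form_scale fscale_def)
  have kerL: "L h x = 0 \<longleftrightarrow> x \<in> rad h W" if "x \<in> W" for h x
    using that by (auto simp: L_def fun_eq_iff rad_def)
  have sR: "subspace (rad f W)" using f W by (rule subspace_rad)
  obtain B where B: "B \<subseteq> rad f W" "independent B" "rad f W \<subseteq> span B" "card B = dim (rad f W)"
    using basis_exists by blast
  have "B \<subseteq> W" using B(1) rad_subset by blast
  then obtain D where D: "B \<subseteq> D" "D \<subseteq> W" "independent D" "W \<subseteq> span D"
    using maximal_independent_subset_extend[OF _ B(2)] by metis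
  have fin: "finite D" using D finiteI_independent by blast
  have cD: "card D = dim W" using D basis_card_eq_dim by blast
  define U where "U = span (D - B)"
  have UW: "U \<subseteq> W" unfolding U_def using D(2) W by (meson Diff_subset order_trans span_minimal)
  have sU: "subspace U" by (simp add: U_def)
  have dU: "dim U + dim (rad f W) = dim W"
  proof -
    have "dim U = card (D - B)"
      unfolding U_def using D(3) by (meson Diff_subset dim_span_eq_card_independent independent_mono)
    also have "\<dots> = card D - card B"
      using D(1) fin by (simp add: card_Diff_subset finite_subset)
    finally show ?thesis using cD B(4) card_mono[OF fin D(1)] by simp
  qed
  have trans: "x = 0" if x: "x \<in> U" "x \<in> rad f W" for x
  proof -
    have 1: "x \<in> span (D - B)" "x \<in> span B" using x B(3) by (auto simp: U_def)
    have "representation D x = representation (D - B) x"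
      using D(3) 1(1) by (intro representation_extend) auto
    moreover have "representation D x = representation B x"
      using D(1,3) 1(2) by (intro representation_extend) auto
    ultimately have "representation D x b = 0" for b
      using representation_ne_zero[of B x b] representation_ne_zero[of "D - B" x b] by auto
    moreover have "x \<in> span D" using 1(2) D(1) span_mono by blast
    then have "(\<Sum>b | representation D x b \<noteq> 0. representation D x b *s b) = x"
      by (rule sum_nonzero_representation_eq[OF D(3)])
    ultimately show "x = 0" by simp
  qed
  have inj: "inj_on (L f) U"
  proof (rule inj_onI)
    fix x y assume xy: "x \<in> U" "y \<in> U" "L f x = L f y"
    then have xyU: "x - y \<in> U" using sU by (simp add: subspace_diff)
    have "L f (x - y) = L f x - L f y" by (rule vp.linear_diff[OF linL[OF f]])
    then have "x - y \<in> rad f W" using xy kerL[of "x - y" f] xyU UW by auto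
    then have "x - y = 0" using trans xyU by blast
    then show "x = y" by simp
  qed
  obtain p where p: "Vector_Spaces.linear fscale scale p" "\<And>x. x \<in> U \<Longrightarrow> p (L f x) = x"
    using vp.linear_inj_on_left_inverse[OF linL[OF f]] inj unfolding U_def by blast
  interpret p: Vector_Spaces.linear fscale scale p by (rule p(1))
  interpret Lg: Vector_Spaces.linear scale fscale "L g" by (rule linL[OF g])
  have "\<exists>s. s \<noteq> 0 \<and> (\<forall>x\<in>U. x \<in> rad (\<lambda>x. f x + s * g x) W \<longrightarrow> x = 0)"
  proof (rule ccontr)
    assume contra: "\<not> ?thesis"
    have "\<exists>x. x \<in> U \<and> x \<noteq> 0 \<and> p (L g x) = (- inverse s) *s x" if s: "s \<noteq> 0" for s
    proof -
      obtain x where x: "x \<in> U" "x \<in> rad (\<lambda>x. f x + s * g x) W" "x \<noteq> 0"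
        using contra s by blast
      have "L f x = fscale (- s) (L g x)"
        using x(2) by (auto simp: rad_def L_def fscale_def fun_eq_iff eq_neg_iff_add_eq_0)
      then have "x = (- s) *s p (L g x)"
        using p(2)[OF x(1)] p.scale by metis
      then have "(- inverse s) *s x = ((- inverse s) * (- s)) *s p (L g x)"
        by (metis scale_scale)
      then show ?thesis using x s by auto
    qed
    then obtain X where X: "\<And>s. s \<noteq> 0 \<Longrightarrow> X s \<in> U \<and> X s \<noteq> 0 \<and> p (L g (X s)) = (- inverse s) *s X s"
      by metis
    have "infinite (UNIV - {0::complex})" by (simp add: infinite_UNIV_char_0)
    then obtain F where F: "F \<subseteq> UNIV - {0::complex}" "finite F" "card F = Suc dimension"
      using infinite_arbitrarily_large by blast
    have F0: "s \<noteq> 0" if "s \<in> F" for s using F(1) that by auto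
    have coef0: "c i = 0" if "(\<Sum>s\<in>F. c s *s X s) = 0" "i \<in> F" for c i
    proof -
      have "c i *s X i \<in> {0}"
        by (rule weight_component_mem[where F = F and H = UNIV and A = "\<lambda>_::unit. \<lambda>x. p (L g x)"
              and wt = "\<lambda>s _. - inverse s"])
          (use F0 X F(2) that in \<open>auto simp: Lg.add p.add Lg.scale p.scale mult.commute\<close>)
      then show ?thesis using X[of i] F0 that by auto
    qed
    have inj: "inj_on X F"
    proof (rule inj_onI, rule ccontr)
      fix a b assume ab: "a \<in> F" "b \<in> F" "X a = X b" "a \<noteq> b"
      have "(- inverse a) *s X a = (- inverse b) *s X a" using X[of a] X[of b] ab F0 by metis
      then have "(inverse a - inverse b) *s X a = 0" by (simp add: scale_left_diff_distrib)
      then show False using X[of a] ab F0 by auto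
    qed
    have "independent (X ` F)"
    proof (rule independent_if_scalars_zero)
      show "finite (X ` F)" using F by simp
      fix c x assume "(\<Sum>x\<in>X ` F. c x *s x) = 0" "x \<in> X ` F"
      then show "c x = 0"
        using coef0[of "\<lambda>s. c (X s)"] inj by (auto simp: sum.reindex)
    qed
    then have "card (X ` F) \<le> dim (UNIV :: 'a set)" by (intro independent_card_le_dim) auto
    then show False using F card_image[OF inj] by (simp add: dimension_def)
  qed
  then obtain s where s: "s \<noteq> 0" "\<And>x. x \<in> U \<Longrightarrow> x \<in> rad (\<lambda>x. f x + s * g x) W \<Longrightarrow> x = 0" by blast
  let ?R = "rad (\<lambda>x. f x + s * g x) W"
  have fs: "linear_form (\<lambda>x. f x + s * g x)"
    using f g by (auto simp: linear_form_def algebra_simps)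
  obtain E where E: "E \<subseteq> ?R" "independent E" "?R \<subseteq> span E" "card E = dim ?R"
    using basis_exists by blast
  \<comment> \<open>For this \<open>s\<close> the radical meets \<open>U\<close> only in 0, so its
    dimension is at most the codimension of \<open>U\<close> in \<open>W\<close>, which is
    \<open>dim (rad f W)\<close>.\<close>
  have "dim ?R + dim U \<le> dim W"
  proof -
    have "dim {x + y |x y. x \<in> ?R \<and> y \<in> U} + dim (?R \<inter> U) = dim ?R + dim U"
      by (rule dim_sums_Int) (use fs W sU in \<open>auto simp: subspace_rad\<close>)
    moreover have "dim (?R \<inter> U) = 0" using s(2) by (auto simp: dim_eq_0)
    moreover have "dim {x + y |x y. x \<in> ?R \<and> y \<in> U} \<le> dim W"
      by (rule dim_subset) (use UW W in \<open>auto simp: rad_def intro!: subspace_add\<close>)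
    ultimately show ?thesis by simp
  qed
  then show ?thesis using dU bound[OF s(1)] by simp
qed


subsection \<open>Traces and the Killing form\<close>

definition linear_map :: "('a \<Rightarrow> 'a) \<Rightarrow> bool"
  where "linear_map A \<longleftrightarrow> (\<forall>x y. A (x + y) = A x + A y) \<and> (\<forall>c x. A (c *s x) = c *s A x)"

lemma linear_map_bracket: "linear_map (bracket x)"
  by (auto simp: linear_map_def bracket_add_right bracket_scale_right)

lemma linear_map_sum: 
  assumes "linear_map A"
  shows "A (sum f I) = (\<Sum>i\<in>I. A (f i))"
proof -
  have "A (0 *s 0) = 0 *s A 0" using assms unfolding linear_map_def by blast
  then have "A 0 = 0" by simp
  then show ?thesis
    using assms by (induction I rule: infinite_finite_induct) (auto simp: linear_map_def)
qed

lemma representation_linear_map: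
  assumes A: "linear_map A" and S: "independent S" "span S = UNIV" and T: "independent T" "span T = UNIV"
  shows "representation S (A x) s = (\<Sum>t\<in>T. representation T x t * representation S (A t) s)"
proof -
  have fin: "finite T" using T finiteI_independent by blast
  have "x = (\<Sum>t\<in>T. representation T x t *s t)"
    by (rule sum_representation_eq[symmetric]) (use T fin in auto)
  then have "A x = A (\<Sum>t\<in>T. representation T x t *s t)" by (rule arg_cong)
  also have "\<dots> = (\<Sum>t\<in>T. representation T x t *s A t)"
    unfolding linear_map_sum[OF A] using A by (simp add: linear_map_def)
  finally show ?thesis
    by (simp add: linear_form_sum[OF linear_form_representation[OF S]]
        linear_form_scale[OF linear_form_representation[OF S]])
qed

text \<open>Both sides are the same double sum over matrix entries of \<open>A\<close> and
  \<open>B\<close> relative to \<open>S\<close> and \<open>T\<close>. Two bases are allowed so that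
  the identity in place of \<open>B\<close> yields the independence of the trace from the
  basis.\<close>

lemma trace_commute:
  assumes A: "linear_map A" and B: "linear_map B"
    and S: "independent S" "span S = UNIV" and T: "independent T" "span T = UNIV"
  shows "(\<Sum>s\<in>S. representation S (A (B s)) s) = (\<Sum>t\<in>T. representation T (B (A t)) t)"
proof -
  have "(\<Sum>s\<in>S. representation S (A (B s)) s)
      = (\<Sum>s\<in>S. \<Sum>t\<in>T. representation T (B s) t * representation S (A t) s)"
    by (intro sum.cong refl representation_linear_map A S T)
  also have "\<dots> = (\<Sum>t\<in>T. \<Sum>s\<in>S. representation S (A t) s * representation T (B s) t)"
    by (subst sum.swap) (simp add: mult.commute)
  also have "\<dots> = (\<Sum>t\<in>T. representation T (B (A t)) t)"
    by (intro sum.cong refl representation_linear_map[symmetric] B S T)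
  finally show ?thesis .
qed

lemma span_Basis_UNIV: "span Basis = UNIV"
  using span_Basis by simp

lemma trace_map_comp_commute:
  assumes "linear_map A" "linear_map B"
  shows "trace_map (\<lambda>x. A (B x)) = trace_map (\<lambda>x. B (A x))"
  unfolding trace_map_def
  by (intro trace_commute assms independent_Basis span_Basis_UNIV)

lemma trace_map_basis:
  assumes "linear_map A" "independent W" "span W = UNIV"
  shows "trace_map A = (\<Sum>w\<in>W. representation W (A w) w)"
proof -
  have "linear_map (\<lambda>x. x)" by (simp add: linear_map_def)
  then show ?thesis
    unfolding trace_map_def
    using trace_commute[of A "\<lambda>x. x" Basis W] assms independent_Basis span_Basis_UNIV by simp
qed

lemma trace_map_add: "trace_map (\<lambda>x. A x + B x) = trace_map A + trace_map B"
  and trace_map_scale: "trace_map (\<lambda>x. c *s A x) = c * trace_map A"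
  by (simp_all add: trace_map_def representation_add representation_scale independent_Basis
      span_Basis_UNIV sum.distrib sum_distrib_left)

lemma linear_map_ad_comp: "linear_map (\<lambda>z. bracket x (bracket y z))"
  by (auto simp: linear_map_def bracket_add_right bracket_scale_right)

lemma killing_commute: "killing x y = killing y x"
  unfolding killing_def by (intro trace_map_comp_commute linear_map_bracket)

lemma linear_form_killing: "linear_form (killing x)"
  by (simp add: linear_form_def killing_def bracket_add_left bracket_add_right
      bracket_scale_left bracket_scale_right trace_map_add trace_map_scale)

lemma linear_form_killing_left: "linear_form (\<lambda>x. killing x y)"
  using linear_form_killing[of y] by (simp add: killing_commute[of _ y] linear_form_def)

text \<open>The adjoint of \<open>bracket x y\<close> is the commutator of the adjoints. Of the four
  triple products that result on the two sides, two agree and two are cyclic rotations of each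
  other.\<close>

lemma killing_invariant: "killing (bracket x y) z = killing x (bracket y z)"
proof -
  have sub: "trace_map (\<lambda>z. A z - B z) = trace_map A - trace_map B" for A B
    by (simp add: trace_map_def representation_diff independent_Basis span_Basis_UNIV sum_subtractf)
  have 1: "bracket (bracket x y) w = bracket x (bracket y w) - bracket y (bracket x w)" for x y w
    using bracket_leibniz[of x y w] by simp
  have "killing (bracket x y) z
      = trace_map (\<lambda>w. bracket x (bracket y (bracket z w))) - trace_map (\<lambda>w. bracket y (bracket x (bracket z w)))"
    unfolding killing_def by (simp add: 1 sub)
  also have "trace_map (\<lambda>w. bracket y (bracket x (bracket z w))) = trace_map (\<lambda>w. bracket x (bracket z (bracket y w)))"
    by (rule trace_map_comp_commute[OF linear_map_bracket linear_map_ad_comp])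
  also have "trace_map (\<lambda>w. bracket x (bracket y (bracket z w))) - trace_map (\<lambda>w. bracket x (bracket z (bracket y w)))
      = killing x (bracket y z)"
    unfolding killing_def by (simp add: 1 bracket_diff_right sub)
  finally show ?thesis .
qed

lemma killing_weight_basis:
  assumes W: "independent W" "span W = UNIV"
    and "\<And>w. w \<in> W \<Longrightarrow> bracket h w = a w *s w" "\<And>w. w \<in> W \<Longrightarrow> bracket h' w = b w *s w"
  shows "killing h h' = (\<Sum>w\<in>W. a w * b w)"
  unfolding killing_def trace_map_basis[OF linear_map_ad_comp W]
  using assms by (intro sum.cong refl)
    (simp add: bracket_scale_right representation_scale representation_basis span_base)

text \<open>On the kernel of one form the induction hypothesis expresses \<psi> by the remaining
  ones; a vector \<open>v\<close> outside this kernel determines the missing coefficient.\<close>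

lemma linear_form_in_span_if_kernel:
  assumes "finite I" "subspace V" "\<And>i. i \<in> I \<Longrightarrow> linear_form (\<phi> i)" "linear_form \<psi>"
    and "\<And>x. x \<in> V \<Longrightarrow> (\<And>i. i \<in> I \<Longrightarrow> \<phi> i x = 0) \<Longrightarrow> \<psi> x = 0"
  shows "\<exists>c. \<forall>x\<in>V. \<psi> x = (\<Sum>i\<in>I. c i * \<phi> i x)"
  using assms
proof (induction I arbitrary: V rule: finite_induct)
  case empty
  then show ?case by simp
next
  case (insert j I)
  let ?K = "{x \<in> V. \<phi> j x = 0}"
  have lj: "linear_form (\<phi> j)" using insert by simp
  have "subspace ?K"
    using insert.prems(1) lj
    by (auto intro!: subspaceI simp: subspace_0 subspace_add subspace_scale
        linear_form_add linear_form_scale linear_form_zero)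
  then have "\<exists>c. \<forall>x\<in>?K. \<psi> x = (\<Sum>i\<in>I. c i * \<phi> i x)"
    by (rule insert.IH) (use insert.prems in auto)
  then obtain c where c: "\<And>x. x \<in> ?K \<Longrightarrow> \<psi> x = (\<Sum>i\<in>I. c i * \<phi> i x)"
    by metis
  show ?case
  proof (cases "\<exists>v\<in>V. \<phi> j v \<noteq> 0")
    case False
    then have "\<psi> x = (\<Sum>i\<in>insert j I. c i * \<phi> i x)" if "x \<in> V" for x
      using c[of x] that insert.hyps by auto
    then show ?thesis by blast
  next
    case True
    then obtain v where v: "v \<in> V" "\<phi> j v \<noteq> 0" by blast
    let ?d = "(\<psi> v - (\<Sum>i\<in>I. c i * \<phi> i v)) / \<phi> j v"
    have "\<psi> x = (\<Sum>i\<in>insert j I. (c(j := ?d)) i * \<phi> i x)" if x: "x \<in> V" for x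
    proof -
      define r where "r = \<phi> j x / \<phi> j v"
      have "x - r *s v \<in> ?K"
        using x v insert.prems(1) lj
        by (auto simp: r_def subspace_diff subspace_scale linear_form_diff linear_form_scale)
      then have "\<psi> (x - r *s v) = (\<Sum>i\<in>I. c i * \<phi> i (x - r *s v))" by (rule c)
      moreover have "(\<Sum>i\<in>I. c i * \<phi> i (x - r *s v))
          = (\<Sum>i\<in>I. c i * \<phi> i x) - r * (\<Sum>i\<in>I. c i * \<phi> i v)"
        using insert.prems(2)
        by (simp add: linear_form_diff linear_form_scale sum_subtractf[symmetric] sum_distrib_left
            algebra_simps)
      ultimately have "\<psi> x = (\<Sum>i\<in>I. c i * \<phi> i x) + r * (\<psi> v - (\<Sum>i\<in>I. c i * \<phi> i v))"
        using insert.prems(3) by (simp add: linear_form_diff linear_form_scale algebra_simps)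
      moreover have "(\<Sum>i\<in>I. (c(j := ?d)) i * \<phi> i x) = (\<Sum>i\<in>I. c i * \<phi> i x)"
        using insert.hyps by (intro sum.cong) auto
      ultimately show ?thesis using insert.hyps v by (simp add: r_def)
    qed
    then show ?thesis by blast
  qed
qed

end


subsection \<open>The root space decomposition\<close>

context lie_algebra_triple
begin

lemma subspace_root_space: "subspace (root_space \<gamma>)"
  by (rule subspaceI)
    (auto simp: root_space_def bracket_add_right bracket_scale_right scale_right_distrib mult.commute)

lemma root_spaceD: "x \<in> root_space \<gamma> \<Longrightarrow> h \<in> t \<Longrightarrow> bracket h x = \<gamma> h *s x"
  by (simp add: root_space_def)

lemma bracket_root_space:
  assumes "x \<in> root_space \<gamma>" "y \<in> root_space \<delta>"
  shows "bracket x y \<in> root_space (\<gamma> + \<delta>)"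
  using assms
  by (auto simp: root_space_def bracket_leibniz[of _ x y] bracket_scale_left bracket_scale_right
      scale_left_distrib)

lemma root_ne_0: "\<gamma> \<in> roots \<Longrightarrow> \<gamma> \<noteq> 0"
  by (simp add: roots_def)

lemma root_dual: "\<gamma> \<in> roots \<Longrightarrow> \<gamma> \<in> dual_space t"
  by (simp add: roots_def)

lemma root_vector_exists: "\<gamma> \<in> roots \<Longrightarrow> \<exists>x\<in>root_space \<gamma>. x \<noteq> 0"
  using subspace_0[OF subspace_root_space[of \<gamma>]] by (auto simp: roots_def)

lemma dual_space_plus: "\<gamma> \<in> dual_space W \<Longrightarrow> \<delta> \<in> dual_space W \<Longrightarrow> \<gamma> + \<delta> \<in> dual_space W"
  and dual_space_diff: "\<gamma> \<in> dual_space W \<Longrightarrow> \<delta> \<in> dual_space W \<Longrightarrow> \<gamma> - \<delta> \<in> dual_space W"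
  and dual_space_0: "0 \<in> dual_space W"
  by (auto simp: dual_space_def algebra_simps)

lemma dual_space_neq:
  assumes "\<gamma> \<in> dual_space W" "\<delta> \<in> dual_space W" "\<gamma> \<noteq> \<delta>"
  shows "\<exists>h\<in>W. \<gamma> h \<noteq> \<delta> h"
  using assms by (auto simp: dual_space_def fun_eq_iff) metis

lemma root_scale: "\<gamma> \<in> roots \<Longrightarrow> x \<in> t \<Longrightarrow> \<gamma> (c *s x) = c * \<gamma> x"
  and root_add: "\<gamma> \<in> roots \<Longrightarrow> x \<in> t \<Longrightarrow> y \<in> t \<Longrightarrow> \<gamma> (x + y) = \<gamma> x + \<gamma> y"
  by (auto simp: roots_def dual_space_def)

text \<open>Zero is adjoined because \<open>t\<close> is the weight space of weight 0, as
  \<open>root_space_0\<close> shows; sums over \<open>weights\<close> then cover the whole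
  algebra.\<close>

abbreviation weights :: "('a \<Rightarrow> complex) set"
  where "weights \<equiv> insert 0 roots"

lemma weight_dual: "\<gamma> \<in> weights \<Longrightarrow> \<gamma> \<in> dual_space t"
  using root_dual dual_space_0 by auto

lemma weight_mem: "\<gamma> \<in> dual_space t \<Longrightarrow> x \<in> root_space \<gamma> \<Longrightarrow> x \<noteq> 0 \<Longrightarrow> \<gamma> \<in> weights"
  by (auto simp: roots_def)

lemma weight_vector_component:
  assumes "finite F" "F \<subseteq> dual_space t" "subspace N" "\<And>h x. h \<in> t \<Longrightarrow> x \<in> N \<Longrightarrow> bracket h x \<in> N"
    and "\<And>\<gamma>. \<gamma> \<in> F \<Longrightarrow> v \<gamma> \<in> root_space \<gamma>" "(\<Sum>\<gamma>\<in>F. v \<gamma>) \<in> N" "\<gamma> \<in> F"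
  shows "v \<gamma> \<in> N"
  by (rule weight_component_mem[where F = F and H = t and A = bracket and wt = "\<lambda>\<gamma>. \<gamma>"])
    (use assms in \<open>auto simp: bracket_add_right bracket_scale_right root_spaceD
      intro!: dual_space_neq[of _ t]\<close>)

lemma weight_vectors_independent:
  assumes "finite F" "F \<subseteq> dual_space t"
    and "\<And>\<gamma>. \<gamma> \<in> F \<Longrightarrow> v \<gamma> \<in> root_space \<gamma>" "(\<Sum>\<gamma>\<in>F. v \<gamma>) = 0" "\<gamma> \<in> F"
  shows "v \<gamma> = 0"
  using weight_vector_component[of F "{0}" v \<gamma>] assms by auto

text \<open>Root vectors of distinct roots are independent, so the dimension bounds the number of
  roots.\<close>

lemma finite_roots: "finite roots"
proof (rule ccontr)
  assume "infinite roots"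
  then obtain F where F: "F \<subseteq> roots" "finite F" "card F = Suc dimension"
    using infinite_arbitrarily_large by blast
  obtain v where v: "\<And>\<gamma>. \<gamma> \<in> roots \<Longrightarrow> v \<gamma> \<in> root_space \<gamma> \<and> v \<gamma> \<noteq> 0"
    using root_vector_exists by metis
  have Fd: "F \<subseteq> dual_space t" using F root_dual by blast
  have coef: "c \<gamma> = 0" if "(\<Sum>\<gamma>\<in>F. c \<gamma> *s v \<gamma>) = 0" "\<gamma> \<in> F" for c \<gamma>
  proof -
    have "c \<gamma> *s v \<gamma> = 0"
      by (rule weight_vectors_independent[OF F(2) Fd _ that])
        (use F v in \<open>auto intro!: subspace_scale[OF subspace_root_space]\<close>)
    then show ?thesis using v F that by auto
  qed
  have inj: "inj_on v F"
  proof (rule inj_onI, rule ccontr)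
    fix a b assume ab: "a \<in> F" "b \<in> F" "v a = v b" "a \<noteq> b"
    then obtain h where "h \<in> t" "a h \<noteq> b h" using dual_space_neq Fd by blast
    then have "(a h - b h) *s v a = 0"
      using ab v[of a] v[of b] F root_spaceD[of "v a" a h] root_spaceD[of "v b" b h]
      by (auto simp: scale_left_diff_distrib subset_iff)
    then show False using \<open>a h \<noteq> b h\<close> v[of a] F ab by auto
  qed
  have "independent (v ` F)"
  proof (rule independent_if_scalars_zero)
    show "finite (v ` F)" using F by simp
    fix c x assume "(\<Sum>x\<in>v ` F. c x *s x) = 0" "x \<in> v ` F"
    then show "c x = 0"
      using coef[of "\<lambda>s. c (v s)"] inj by (auto simp: sum.reindex)
  qed
  then have "card (v ` F) \<le> dim (UNIV :: 'a set)" by (intro independent_card_le_dim) auto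
  then show False using F card_image[OF inj] by (simp add: dimension_def)
qed

end

context simple_lie_algebra
begin

lemma subalgebra_t: "subalgebra t" and nilpotent_t: "nilpotent t"
  using triangular by (auto simp: triangular_decomposition_def cartan_subalgebra_def)

lemma subspace_t: "subspace t"
  using subalgebra_t by (simp add: subalgebra_def)

lemma roots_eq: "roots = pos_roots \<union> uminus ` pos_roots"
  using triangular by (simp add: triangular_decomposition_def)

lemma pos_root: "\<gamma> \<in> pos_roots \<Longrightarrow> \<gamma> \<in> roots"
  by (simp add: roots_eq)

lemma uminus_root: "\<gamma> \<in> roots \<Longrightarrow> - \<gamma> \<in> roots"
  by (auto simp: roots_eq)

lemma uminus_root_iff [simp]: "- \<gamma> \<in> roots \<longleftrightarrow> \<gamma> \<in> roots"
  using uminus_root[of \<gamma>] uminus_root[of "- \<gamma>"] by auto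

lemma u_eq: "u = span (\<Union>\<gamma>\<in>pos_roots. root_space \<gamma>)"
  using triangular by (simp add: triangular_decomposition_def)

lemma simple_ideal: "ideal_of I UNIV \<Longrightarrow> I = {0} \<or> I = UNIV"
  using simple by (simp add: simple_lie_def)

lemma span_t_roots: "span (t \<union> (\<Union>\<gamma>\<in>roots. root_space \<gamma>)) = UNIV"
proof -
  let ?S = "t \<union> (\<Union>\<gamma>\<in>roots. root_space \<gamma>)"
  have um: "um = span (\<Union>\<gamma>\<in>pos_roots. root_space (- \<gamma>))"
    using triangular by (simp add: triangular_decomposition_def)
  have "x \<in> span ?S" for x
  proof -
    have "\<exists>!(a, h, b). a \<in> u \<and> h \<in> t \<and> b \<in> um \<and> x = a + h + b"
      using triangular unfolding triangular_decomposition_def by (elim conjE) (erule spec)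
    then obtain a h b where x: "a \<in> u" "h \<in> t" "b \<in> um" "x = a + h + b"
      by (auto dest!: ex1_implies_ex)
    have "u \<subseteq> span ?S"
      by (rule ord_eq_le_trans[OF u_eq], rule span_mono) (use pos_root in blast)
    moreover have "um \<subseteq> span ?S"
      unfolding um by (rule span_mono) (use pos_root uminus_root in blast)
    moreover have "h \<in> span ?S" using x by (simp add: span_base)
    ultimately show ?thesis using x by (auto intro!: span_add)
  qed
  then show ?thesis by blast
qed

text \<open>At this stage \<open>t\<close> is only known to be nilpotent. On a root vector
  \<open>h\<close> and \<open>h'\<close> act by scalars, so their bracket acts by 0.\<close>

lemma root_bracket_t:
  assumes "\<gamma> \<in> roots" "h \<in> t" "h' \<in> t"
  shows "\<gamma> (bracket h h') = 0"
proof -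
  obtain x where x: "x \<in> root_space \<gamma>" "x \<noteq> 0" using root_vector_exists[OF assms(1)] by blast
  have "bracket h h' \<in> t" using subalgebra_t assms by (simp add: subalgebra_def)
  then have "\<gamma> (bracket h h') *s x = bracket (bracket h h') x" using x root_spaceD by simp
  also have "\<dots> = bracket h (bracket h' x) - bracket h' (bracket h x)"
    using bracket_leibniz[of h h' x] by simp
  also have "\<dots> = 0"
    using x assms by (simp add: root_spaceD bracket_scale_right mult.commute)
  finally show ?thesis using x by simp
qed

text \<open>The common kernel of the roots in \<open>t\<close> is an ideal: its elements commute
  with root vectors, and brackets in \<open>t\<close> are killed by all roots. It is not everything,
  since otherwise the algebra would equal the nilpotent \<open>t\<close>, whereas a simple algebra
  is perfect.\<close>

lemma roots_separate:
  assumes "h \<in> t" "\<And>\<gamma>. \<gamma> \<in> roots \<Longrightarrow> \<gamma> h = 0"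
  shows "h = 0"
proof -
  let ?I = "{h \<in> t. \<forall>\<gamma>\<in>roots. \<gamma> h = 0}"
  have sI: "subspace ?I"
  proof (rule subspaceI)
    show "0 \<in> ?I"
      using subspace_0[OF subspace_t] root_scale[of _ 0 0] by simp
  qed (auto simp: subspace_add subspace_scale subspace_t root_add root_scale)
  have "bracket x y \<in> ?I" if y: "y \<in> ?I" for x y
  proof (rule bracket_span_subset[of x "t \<union> (\<Union>\<gamma>\<in>roots. root_space \<gamma>)" y "{y}"])
    show "x \<in> span (t \<union> (\<Union>\<gamma>\<in>roots. root_space \<gamma>))" using span_t_roots by simp
    fix a b assume a: "a \<in> t \<union> (\<Union>\<gamma>\<in>roots. root_space \<gamma>)" and b: "b \<in> {y}"
    show "bracket a b \<in> ?I"
      using a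
    proof
      assume "a \<in> t"
      then show ?thesis using b y root_bracket_t subalgebra_t by (auto simp: subalgebra_def)
    next
      assume "a \<in> (\<Union>\<gamma>\<in>roots. root_space \<gamma>)"
      then obtain \<gamma> where "\<gamma> \<in> roots" "a \<in> root_space \<gamma>" by blast
      then have "bracket a b = 0"
        using b y bracket_anticommute[of a b] by (simp add: root_spaceD)
      then show ?thesis using subspace_0[OF sI] by simp
    qed
  qed (use sI span_base in auto)
  then have "ideal_of ?I UNIV" using sI by (simp add: ideal_of_def)
  then have "?I = {0} \<or> ?I = UNIV" by (rule simple_ideal)
  moreover have False if eq: "?I = UNIV"
  proof -
    have t: "t = UNIV" using eq by blast
    obtain a b where ab: "bracket a b \<noteq> 0" using simple by (auto simp: simple_lie_def)
    have "ideal_of (span {bracket x y |x y. x \<in> UNIV \<and> y \<in> UNIV}) UNIV"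
      by (auto simp: ideal_of_def intro!: span_base)
    moreover have "bracket a b \<in> span {bracket x y |x y. x \<in> UNIV \<and> y \<in> UNIV}"
      by (auto intro!: span_base)
    ultimately have der: "span {bracket x y |x y. x \<in> UNIV \<and> y \<in> UNIV} = UNIV"
      using simple_ideal ab by blast
    have "lower_central UNIV k = UNIV" for k
      by (induction k) (use der in auto)
    then have "(UNIV :: 'a set) = {0}" using nilpotent_t by (simp add: nilpotent_def t)
    then show False using ab by blast
  qed
  ultimately show ?thesis using assms by blast
qed

lemma t_abelian: "h \<in> t \<Longrightarrow> h' \<in> t \<Longrightarrow> bracket h h' = 0"
  using subalgebra_t by (intro roots_separate) (auto simp: root_bracket_t subalgebra_def)

text \<open>The clause \<open>v 0 \<in> t\<close> does not yet follow from membership in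
  \<open>root_space 0\<close>; it is what identifies \<open>root_space 0\<close> with
  \<open>t\<close> afterwards.\<close>

lemma weight_decomposition:
  "\<exists>v. (\<forall>\<gamma>\<in>weights. v \<gamma> \<in> root_space \<gamma>) \<and> v 0 \<in> t \<and> x = (\<Sum>\<gamma>\<in>weights. v \<gamma>)"
proof -
  let ?P = "\<lambda>x v. (\<forall>\<gamma>\<in>weights. v \<gamma> \<in> root_space \<gamma>) \<and> v 0 \<in> t \<and> x = (\<Sum>\<gamma>\<in>weights. v \<gamma>)"
  have t0: "h \<in> root_space 0" if "h \<in> t" for h
    using that t_abelian by (simp add: root_space_def)
  have "x \<in> span (t \<union> (\<Union>\<gamma>\<in>roots. root_space \<gamma>))" using span_t_roots by simp
  then show ?thesis
  proof (induction rule: span_induct)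
    case base
    show ?case
    proof (rule subspaceI)
      show "0 \<in> {x. \<exists>v. ?P x v}"
        using subspace_0[OF subspace_root_space] subspace_0[OF subspace_t]
        by (auto intro!: exI[of _ "\<lambda>_. 0"])
    next
      fix x y assume "x \<in> {x. \<exists>v. ?P x v}" "y \<in> {x. \<exists>v. ?P x v}"
      then obtain v w where vw: "?P x v" "?P y w" by blast
      have "?P (x + y) (\<lambda>\<gamma>. v \<gamma> + w \<gamma>)"
        using vw by (simp only: sum.distrib) (auto simp: subspace_add subspace_root_space subspace_t)
      then show "x + y \<in> {x. \<exists>v. ?P x v}" by (intro CollectI exI)
    next
      fix c x assume "x \<in> {x. \<exists>v. ?P x v}"
      then obtain v where v: "?P x v" by blast
      have "?P (c *s x) (\<lambda>\<gamma>. c *s v \<gamma>)"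
        using v by (simp only: scale_sum_right) (auto simp: subspace_scale subspace_root_space subspace_t)
      then show "c *s x \<in> {x. \<exists>v. ?P x v}" by (intro CollectI exI)
    qed
  next
    case (step x)
    then obtain \<delta> where d: "\<delta> \<in> weights" "x \<in> root_space \<delta>" "\<delta> = 0 \<longrightarrow> x \<in> t"
      using t0 root_ne_0 by blast
    have 1: "?P x (\<lambda>\<gamma>. if \<gamma> = \<delta> then x else 0)"
      using d finite_roots subspace_0[OF subspace_root_space] subspace_0[OF subspace_t]
      by (auto simp del: sum.insert simp: sum.delta)
    show ?case by (rule exI, rule 1)
  qed
qed

lemma finite_weights: "finite weights" and weights_dual: "weights \<subseteq> dual_space t"
  using finite_roots weight_dual by auto

lemma root_space_0: "root_space 0 = t"
proof
  show "t \<subseteq> root_space 0" using t_abelian by (auto simp: root_space_def)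
next
  show "root_space 0 \<subseteq> t"
  proof
    fix x assume x: "x \<in> root_space 0"
    obtain v where v: "\<And>\<gamma>. \<gamma> \<in> weights \<Longrightarrow> v \<gamma> \<in> root_space \<gamma>" "v 0 \<in> t" "x = (\<Sum>\<gamma>\<in>weights. v \<gamma>)"
      using weight_decomposition[of x] by blast
    have x0: "x = v 0 + (\<Sum>\<gamma>\<in>roots. v \<gamma>)"
      using v(3) finite_roots root_ne_0 by (subst (asm) sum.insert) auto
    \<comment> \<open>Replacing the component of weight 0 by \<open>v 0 - x\<close> gives weight
      vectors with sum 0, which forces \<open>x = v 0\<close>.\<close>
    define w where "w = v(0 := v 0 - x)"
    have "(\<Sum>\<gamma>\<in>roots. w \<gamma>) = (\<Sum>\<gamma>\<in>roots. v \<gamma>)"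
      by (rule sum.cong) (auto simp: w_def roots_def)
    then have "(\<Sum>\<gamma>\<in>weights. w \<gamma>) = 0"
      using x0 finite_roots root_ne_0 by (subst sum.insert) (auto simp: w_def algebra_simps)
    moreover have "w \<gamma> \<in> root_space \<gamma>" if "\<gamma> \<in> weights" for \<gamma>
      using v(1)[OF that] x
      by (cases "\<gamma> = 0") (auto simp: w_def intro!: subspace_diff[OF subspace_root_space])
    ultimately have "w 0 = 0"
      using weight_vectors_independent[OF finite_weights weights_dual] by blast
    then have "v 0 - x = 0" by (simp only: w_def fun_upd_same)
    then show "x \<in> t" using v(2) by (metis right_minus_eq)
  qed
qed

text \<open>Such a basis diagonalises \<open>bracket h\<close> for all \<open>h\<close> in
  \<open>t\<close>, so that the Killing form on \<open>t\<close> becomes a sum over it. The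
  prescribed vector serves to exhibit a nonzero summand.\<close>

lemma weight_basis:
  assumes "\<gamma> \<in> weights" "x \<in> root_space \<gamma>" "x \<noteq> 0"
  obtains W wt where "independent W" "span W = UNIV" "x \<in> W" "finite W"
    "\<And>w. w \<in> W \<Longrightarrow> wt w \<in> weights \<and> w \<in> root_space (wt w)" "wt x = \<gamma>"
proof -
  let ?S = "\<Union>\<gamma>\<in>weights. root_space \<gamma>"
  have S: "span ?S = UNIV" using span_t_roots by (simp add: root_space_0)
  have x: "{x} \<subseteq> ?S" "independent {x}" using assms by (auto simp: dependent_single)
  obtain W where W: "{x} \<subseteq> W" "W \<subseteq> ?S" "independent W" "?S \<subseteq> span W"
    using maximal_independent_subset_extend[OF x] by metis
  have sW: "span W = UNIV"
    using W(4) S by (metis span_minimal subspace_span top.extremum_uniqueI)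
  have "\<forall>w\<in>W. \<exists>\<delta>. \<delta> \<in> weights \<and> w \<in> root_space \<delta>" using W(2) by blast
  then obtain wt where wt: "\<And>w. w \<in> W \<Longrightarrow> wt w \<in> weights \<and> w \<in> root_space (wt w)" by metis
  show ?thesis
    by (rule that[of W "wt(x := \<gamma>)"])
      (use W sW wt assms finiteI_independent in auto)
qed

lemma killing_t:
  assumes "\<And>w. w \<in> W \<Longrightarrow> w \<in> root_space (wt w)" "independent W" "span W = UNIV" "h \<in> t" "h' \<in> t"
  shows "killing h h' = (\<Sum>w\<in>W. wt w h * wt w h')"
  using assms by (intro killing_weight_basis) (auto simp: root_spaceD)

end


subsection \<open>Nondegeneracy of the Killing form\<close>

lemma sum_fun_apply: "(\<Sum>i\<in>I. f i) x = (\<Sum>i\<in>I. f i x)"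
  by (induction I rule: infinite_finite_induct) auto

context simple_lie_algebra
begin

section \<open>The base of simple roots and the kernel of the Killing form\<close>

lemma independent_simple_roots: "forms.independent simple_roots"
  using triangular by (simp add: triangular_decomposition_def)

lemma simple_pos: "\<alpha> \<in> simple_roots \<Longrightarrow> \<alpha> \<in> pos_roots"
  by (simp add: simple_roots_def)

lemma simple_root: "\<alpha> \<in> simple_roots \<Longrightarrow> \<alpha> \<in> roots"
  by (simp add: simple_pos pos_root)

lemma finite_simple_roots: "finite simple_roots"
  using finite_roots simple_root by (meson finite_subset subsetI)

lemma pos_root_span: "\<gamma> \<in> pos_roots \<Longrightarrow> \<gamma> \<in> forms.span simple_roots"
  using triangular by (simp add: triangular_decomposition_def)

lemma root_span: "\<gamma> \<in> roots \<Longrightarrow> \<gamma> \<in> forms.span simple_roots"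
  using pos_root_span forms.span_neg by (auto simp: roots_eq)

lemma pos_coeff_Nats: "\<gamma> \<in> pos_roots \<Longrightarrow> coeff \<gamma> \<alpha> \<in> \<nat>"
proof (cases "\<alpha> \<in> simple_roots")
  case False
  then have "coeff \<gamma> \<alpha> = 0" unfolding coeff_def using forms.representation_ne_zero by blast
  then show ?thesis by simp
qed (use triangular in \<open>simp add: triangular_decomposition_def\<close>)

lemma coeff_uminus:
  assumes "\<gamma> \<in> forms.span simple_roots"
  shows "coeff (- \<gamma>) \<alpha> = - coeff \<gamma> \<alpha>"
  using forms.representation_neg[OF independent_simple_roots assms] by (simp add: coeff_def)

lemma coeff_add:
  assumes "\<gamma> \<in> forms.span simple_roots" "\<delta> \<in> forms.span simple_roots"
  shows "coeff (\<gamma> + \<delta>) \<alpha> = coeff \<gamma> \<alpha> + coeff \<delta> \<alpha>"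
  using forms.representation_add[OF independent_simple_roots assms(2) assms(1)]
  by (simp add: coeff_def)

lemma coeff_0 [simp]: "coeff 0 \<alpha> = 0"
  by (simp add: coeff_def forms.representation_zero)

lemma coeff_simple:
  assumes "\<beta> \<in> simple_roots"
  shows "coeff \<beta> \<alpha> = (if \<alpha> = \<beta> then 1 else 0)"
  by (simp add: coeff_def forms.representation_basis[OF independent_simple_roots assms])

lemma weight_coeff_Ints:
  assumes "\<gamma> \<in> weights"
  shows "coeff \<gamma> \<alpha> \<in> \<int>"
proof (cases "\<gamma> = 0")
  case False
  then consider "\<gamma> \<in> pos_roots" | \<delta> where "\<delta> \<in> pos_roots" "\<gamma> = - \<delta>"
    using assms by (auto simp: roots_eq)
  then show ?thesis
  proof cases
    case 1
    then show ?thesis using pos_coeff_Nats Nats_subset_Ints by blast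
  next
    case 2
    then show ?thesis
      using pos_coeff_Nats[of \<delta> \<alpha>] Nats_subset_Ints by (auto simp: coeff_uminus pos_root_span)
  qed
qed simp

lemma span_expand:
  assumes "\<gamma> \<in> forms.span simple_roots"
  shows "\<gamma> x = (\<Sum>\<alpha>\<in>simple_roots. coeff \<gamma> \<alpha> * \<alpha> x)"
proof -
  have "(\<Sum>\<alpha>\<in>simple_roots. fscale (coeff \<gamma> \<alpha>) \<alpha>) = \<gamma>"
    unfolding coeff_def
    by (rule forms.sum_representation_eq[OF independent_simple_roots assms finite_simple_roots order_refl])
  from fun_cong[OF this, of x] show ?thesis
    by (simp add: fscale_def sum_fun_apply)
qed

lemma roots_nonempty: "roots \<noteq> {}"
proof
  assume "roots = {}"
  then have "span t = UNIV" using span_t_roots by simp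
  then have "t = UNIV" using subspace_t span_eq_iff by blast
  then show False using t_abelian simple by (auto simp: simple_lie_def)
qed

lemma simple_roots_nonempty: "simple_roots \<noteq> {}"
proof
  assume "simple_roots = {}"
  then have "\<gamma> = 0" if "\<gamma> \<in> roots" for \<gamma> using root_span[OF that] by simp
  then show False using roots_nonempty root_ne_0 by blast
qed

text \<open>If every vector of \<open>t\<close> killed by the other simple roots were also killed by
  \<alpha>, then \<alpha> would be a combination of them. So some vector is killed by the others
  only, and it is rescaled.\<close>

lemma dual_basis_vector:
  assumes a: "\<alpha> \<in> simple_roots"
  shows "\<exists>h\<in>t. \<forall>\<beta>\<in>simple_roots. \<beta> h = (if \<beta> = \<alpha> then 1 else 0)"
proof -
  have "\<forall>\<beta>\<in>simple_roots. \<exists>f. linear_form f \<and> (\<forall>x\<in>t. f x = \<beta> x)"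
    using dual_space_extend[OF subspace_t] root_dual simple_root by metis
  then obtain \<phi> where \<phi>: "\<And>\<beta>. \<beta> \<in> simple_roots \<Longrightarrow> linear_form (\<phi> \<beta>)"
      "\<And>\<beta> x. \<beta> \<in> simple_roots \<Longrightarrow> x \<in> t \<Longrightarrow> \<phi> \<beta> x = \<beta> x"
    by metis
  have "\<exists>h\<in>t. (\<forall>\<beta>\<in>simple_roots - {\<alpha>}. \<beta> h = 0) \<and> \<alpha> h \<noteq> 0"
  proof (rule ccontr)
    assume "\<not> ?thesis"
    then have 1: "\<phi> \<alpha> x = 0" if "x \<in> t" "\<And>\<beta>. \<beta> \<in> simple_roots - {\<alpha>} \<Longrightarrow> \<phi> \<beta> x = 0" for x
      using that \<phi>(2) a by auto
    have "\<exists>c. \<forall>x\<in>t. \<phi> \<alpha> x = (\<Sum>\<beta>\<in>simple_roots - {\<alpha>}. c \<beta> * \<phi> \<beta> x)"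
      by (rule linear_form_in_span_if_kernel)
        (use finite_simple_roots subspace_t \<phi>(1) a 1 in auto)
    then obtain c where c: "\<And>x. x \<in> t \<Longrightarrow> \<phi> \<alpha> x = (\<Sum>\<beta>\<in>simple_roots - {\<alpha>}. c \<beta> * \<phi> \<beta> x)"
      by metis
    \<comment> \<open>Roots are total functions that vanish outside \<open>t\<close>; the relation
      has to hold there too before it contradicts the independence of functions.\<close>
    have ev: "\<alpha> x = (\<Sum>\<beta>\<in>simple_roots - {\<alpha>}. c \<beta> * \<beta> x)" for x
    proof (cases "x \<in> t")
      case True
      then show ?thesis using c[OF True] \<phi>(2) a by simp
    next
      case False
      then have 0: "\<beta> x = 0" if "\<beta> \<in> simple_roots" for \<beta>
        using root_dual[OF simple_root[OF that]] by (simp add: dual_space_def)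
      have "c \<beta> * \<beta> x = 0" if "\<beta> \<in> simple_roots - {\<alpha>}" for \<beta>
        using 0[of \<beta>] that by simp
      then have "(\<Sum>\<beta>\<in>simple_roots - {\<alpha>}. c \<beta> * \<beta> x) = 0"
        by (intro sum.neutral ballI)
      then show ?thesis using 0[OF a] by simp
    qed
    have "\<alpha> = (\<Sum>\<beta>\<in>simple_roots - {\<alpha>}. fscale (c \<beta>) \<beta>)"
      by (rule ext) (unfold sum_fun_apply fscale_def, rule ev)
    also have "\<dots> \<in> forms.span (simple_roots - {\<alpha>})"
      by (intro forms.span_sum forms.span_scale forms.span_base)
    finally show False using independent_simple_roots a by (auto simp: forms.dependent_def)
  qed
  then obtain h where h: "h \<in> t" "\<And>\<beta>. \<beta> \<in> simple_roots - {\<alpha>} \<Longrightarrow> \<beta> h = 0" "\<alpha> h \<noteq> 0" by blast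
  show ?thesis
    by (rule bexI[of _ "inverse (\<alpha> h) *s h"])
      (use h a in \<open>auto simp: root_scale simple_root subspace_scale subspace_t\<close>)
qed

text \<open>If \<open>h\<close> is dual to the simple root \<open>\<alpha>\<close>, then \<open>killing h h\<close> is the sum of the squares of
  the coefficients of \<open>\<alpha>\<close> in the roots.\<close>

lemma killing_nonzero: "\<exists>h h'. killing h h' \<noteq> 0"
proof -
  obtain \<alpha> where a: "\<alpha> \<in> simple_roots" using simple_roots_nonempty by blast
  obtain x where x: "x \<in> root_space \<alpha>" "x \<noteq> 0" using root_vector_exists[OF simple_root[OF a]] by blast
  obtain h where h: "h \<in> t" "\<forall>\<beta>\<in>simple_roots. \<beta> h = (if \<beta> = \<alpha> then 1 else 0)"
    using dual_basis_vector[OF a] by blast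
  have "\<alpha> \<in> weights" using simple_root[OF a] by simp
  then obtain W wt where W: "independent W" "span W = UNIV" "x \<in> W" "finite W"
    "\<And>w. w \<in> W \<Longrightarrow> wt w \<in> weights \<and> w \<in> root_space (wt w)" "wt x = \<alpha>"
    using weight_basis[OF _ x] by metis
  have ev: "\<gamma> h = coeff \<gamma> \<alpha>" if "\<gamma> \<in> weights" for \<gamma>
  proof -
    have "\<gamma> \<in> forms.span simple_roots" using that root_span forms.span_zero by blast
    then have "\<gamma> h = (\<Sum>\<beta>\<in>simple_roots. coeff \<gamma> \<beta> * (if \<beta> = \<alpha> then 1 else 0))"
      using h(2) by (simp add: span_expand[of \<gamma> h])
    also have "\<dots> = (\<Sum>\<beta>\<in>simple_roots. if \<beta> = \<alpha> then coeff \<gamma> \<beta> else 0)"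
      by (rule sum.cong) auto
    finally show ?thesis using a finite_simple_roots by simp
  qed
  have "\<forall>w\<in>W. \<exists>n::int. wt w h = of_int n"
    using W(5) ev weight_coeff_Ints by (metis Ints_cases)
  then obtain n where n: "\<And>w. w \<in> W \<Longrightarrow> wt w h = of_int (n w)" by metis
  have "of_int (n x) = (1 :: complex)" using n[OF W(3)] W(6) h(2) a by auto
  then have nx: "n x = 1" by (metis of_int_eq_1_iff)
  have "killing h h = (\<Sum>w\<in>W. wt w h * wt w h)"
    using W h by (intro killing_t) auto
  also have "\<dots> = of_int (\<Sum>w\<in>W. n w * n w)" using n by simp
  finally have "killing h h = of_int (\<Sum>w\<in>W. n w * n w)" .
  moreover have "(\<Sum>w\<in>W. n w * n w) > 0"
    using W(3,4) nx by (intro sum_pos2[of _ x]) auto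
  ultimately show ?thesis by (metis of_int_eq_0_iff less_irrefl)
qed

text \<open>The kernel is an ideal by invariance, and it is not the whole algebra because the form
  is not zero.\<close>

lemma killing_nondegenerate:
  assumes "\<And>y. killing x y = 0"
  shows "x = 0"
proof -
  let ?I = "{x. \<forall>y. killing x y = 0}"
  have "subspace ?I"
    by (rule subspaceI)
      (auto simp: linear_form_add[OF linear_form_killing_left] linear_form_scale[OF linear_form_killing_left]
        linear_form_zero[OF linear_form_killing_left])
  moreover have "bracket x y \<in> ?I" if "y \<in> ?I" for x y
  proof -
    have "killing (bracket x y) z = - killing y (bracket x z)" for z
      using killing_invariant[of y x z] bracket_anticommute[of x y]
        linear_form_minus[OF linear_form_killing_left, of "bracket y x" z] by simp
    then show ?thesis using that by simp
  qed
  ultimately have "?I = {0} \<or> ?I = UNIV" by (intro simple_ideal) (simp add: ideal_of_def)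
  then show ?thesis using killing_nonzero assms by blast
qed

section \<open>Pairing of opposite root spaces and the vectors dual to roots\<close>

lemma killing_root_spaces:
  assumes "x \<in> root_space \<gamma>" "y \<in> root_space \<delta>" "\<gamma> \<in> dual_space t" "\<delta> \<in> dual_space t" "\<gamma> + \<delta> \<noteq> 0"
  shows "killing x y = 0"
proof -
  obtain h where h: "h \<in> t" "(\<gamma> + \<delta>) h \<noteq> 0"
    using dual_space_neq[OF dual_space_plus[OF assms(3,4)] dual_space_0 assms(5)] by auto
  have "\<gamma> h * killing x y = killing (bracket h x) y"
    using assms(1) h(1) by (simp add: root_spaceD linear_form_scale[OF linear_form_killing_left])
  also have "\<dots> = - killing (bracket x h) y"
    using bracket_anticommute[of h x] by (simp add: linear_form_minus[OF linear_form_killing_left])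
  also have "\<dots> = - (\<delta> h * killing x y)"
    using assms(2) h(1)
    by (simp add: killing_invariant root_spaceD linear_form_scale[OF linear_form_killing])
  finally have "(\<gamma> h + \<delta> h) * killing x y = 0" by (simp add: distrib_right)
  then show ?thesis using h(2) by simp
qed

text \<open>\<open>x\<close> is orthogonal to all weight spaces except possibly that of
  \<open>- \<gamma>\<close>; orthogonality to this one as well would put it in the kernel of the
  form.\<close>

lemma killing_root_space_pairing:
  assumes "\<gamma> \<in> weights" "x \<in> root_space \<gamma>" "x \<noteq> 0"
  shows "\<exists>y\<in>root_space (- \<gamma>). killing x y \<noteq> 0"
proof (rule ccontr)
  assume contra: "\<not> ?thesis"
  have "killing x y = 0" for y
  proof -
    obtain v where v: "\<forall>\<delta>\<in>weights. v \<delta> \<in> root_space \<delta>" "y = (\<Sum>\<delta>\<in>weights. v \<delta>)"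
      using weight_decomposition[of y] by blast
    have "killing x (v \<delta>) = 0" if d: "\<delta> \<in> weights" for \<delta>
    proof (cases "\<gamma> + \<delta> = 0")
      case True
      then have "\<delta> = - \<gamma>" by (simp add: eq_neg_iff_add_eq_0 add.commute)
      then show ?thesis using contra v(1) d by auto
    next
      case False
      then show ?thesis
        using killing_root_spaces[of x \<gamma> "v \<delta>" \<delta>] assms v(1) d weight_dual by blast
    qed
    then show ?thesis
      unfolding v(2) linear_form_sum[OF linear_form_killing] by (intro sum.neutral) blast
  qed
  then show False using killing_nondegenerate assms(3) by blast
qed

lemma bracket_opposite_mem_t: "x \<in> root_space \<gamma> \<Longrightarrow> y \<in> root_space (- \<gamma>) \<Longrightarrow> bracket x y \<in> t"
  using bracket_root_space[of x \<gamma> y "- \<gamma>"] by (simp add: root_space_0)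

lemma killing_bracket_opposite:
  assumes "x \<in> root_space \<gamma>" "y \<in> root_space (- \<gamma>)" "h \<in> t"
  shows "killing (bracket x y) h = killing x y * \<gamma> h"
proof -
  have "bracket y h = \<gamma> h *s y"
    using assms bracket_anticommute[of y h] by (simp add: root_spaceD)
  then show ?thesis
    by (simp add: killing_invariant linear_form_scale[OF linear_form_killing])
qed

text \<open>This is the nondegeneracy of the Killing form on \<open>t\<close>: weight 0 is its own
  opposite.\<close>

lemma t_eqI:
  assumes "h \<in> t" "h' \<in> t" "\<And>k. k \<in> t \<Longrightarrow> killing h k = killing h' k"
  shows "h = h'"
proof (rule ccontr)
  assume "h \<noteq> h'"
  then obtain y where "y \<in> root_space (- 0)" "killing (h - h') y \<noteq> 0"
    using killing_root_space_pairing[of 0 "h - h'"] assms(1,2)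
    by (auto simp: root_space_0 subspace_diff subspace_t)
  then show False
    using assms(3) by (simp add: root_space_0 linear_form_diff[OF linear_form_killing_left])
qed

text \<open>A bracket of root vectors for \<gamma> and \<open>- \<gamma>\<close>, divided by their
  Killing product, represents \<gamma> on \<open>t\<close>. This makes the definite description
  behind \<open>dual_vector\<close> meaningful for roots.\<close>

lemma dual_vector:
  assumes g: "\<gamma> \<in> roots"
  shows "dual_vector \<gamma> \<in> t" "\<And>h. h \<in> t \<Longrightarrow> killing (dual_vector \<gamma>) h = \<gamma> h"
proof -
  obtain x where x: "x \<in> root_space \<gamma>" "x \<noteq> 0" using root_vector_exists[OF g] by blast
  obtain y where y: "y \<in> root_space (- \<gamma>)" "killing x y \<noteq> 0"
    using killing_root_space_pairing[OF _ x] g by blast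
  let ?h = "inverse (killing x y) *s bracket x y"
  have 1: "?h \<in> t" using bracket_opposite_mem_t[OF x(1) y(1)] subspace_scale[OF subspace_t] by blast
  have 2: "killing ?h h = \<gamma> h" if "h \<in> t" for h
    using that x y by (simp add: linear_form_scale[OF linear_form_killing_left] killing_bracket_opposite)
  have "dual_vector \<gamma> \<in> t \<and> (\<forall>h\<in>t. killing (dual_vector \<gamma>) h = \<gamma> h)"
    unfolding dual_vector_def
    by (rule theI[of _ ?h]) (use 1 2 in \<open>auto intro!: t_eqI\<close>)
  then show "dual_vector \<gamma> \<in> t" "\<And>h. h \<in> t \<Longrightarrow> killing (dual_vector \<gamma>) h = \<gamma> h" by auto
qed

lemma bracket_opposite:
  assumes "\<gamma> \<in> roots" "x \<in> root_space \<gamma>" "y \<in> root_space (- \<gamma>)"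
  shows "bracket x y = killing x y *s dual_vector \<gamma>"
  by (rule t_eqI)
    (use assms dual_vector[OF assms(1)] in \<open>auto simp: bracket_opposite_mem_t killing_bracket_opposite
      subspace_scale subspace_t linear_form_scale[OF linear_form_killing_left]\<close>)

lemma dual_vector_nonzero: "\<gamma> \<in> roots \<Longrightarrow> dual_vector \<gamma> \<noteq> 0"
proof
  assume g: "\<gamma> \<in> roots" "dual_vector \<gamma> = 0"
  then have "\<forall>h\<in>t. \<gamma> h = 0"
    using dual_vector(2)[OF g(1)] linear_form_zero[OF linear_form_killing_left] by metis
  then show False
    using dual_space_neq[OF root_dual[OF g(1)] dual_space_0 root_ne_0[OF g(1)]] by simp
qed

lemma dual_vector_uminus:
  assumes "\<gamma> \<in> roots"
  shows "dual_vector (- \<gamma>) = - dual_vector \<gamma>"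
  by (rule t_eqI)
    (use assms dual_vector[of \<gamma>] dual_vector[of "- \<gamma>"] in
      \<open>auto simp: linear_form_minus[OF linear_form_killing_left] subspace_neg subspace_t\<close>)

lemma root_form_eval:
  "\<gamma> \<in> roots \<Longrightarrow> \<delta> \<in> roots \<Longrightarrow> root_form \<gamma> \<delta> = \<gamma> (dual_vector \<delta>)"
  unfolding root_form_def by (simp add: dual_vector)

lemma root_form_commute: "root_form \<gamma> \<delta> = root_form \<delta> \<gamma>"
  unfolding root_form_def by (rule killing_commute)


subsection \<open>Representations of \<open>sl\<^sub>2\<close> on root strings\<close>

lemma ad_power_mem:
  assumes "x \<in> root_space \<gamma>" "v \<in> root_space \<mu>"
  shows "(bracket x ^^ k) v \<in> root_space (\<mu> + fscale (of_nat k) \<gamma>)"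
proof (induction k)
  case 0
  have "\<mu> + fscale (of_nat 0) \<gamma> = \<mu>" by (auto simp: fscale_def)
  then show ?case using assms by simp
next
  case (Suc k)
  have "\<mu> + fscale (of_nat (Suc k)) \<gamma> = \<gamma> + (\<mu> + fscale (of_nat k) \<gamma>)"
    by (auto simp: fscale_def fun_eq_iff algebra_simps)
  then show ?case using bracket_root_space[OF assms(1) Suc.IH] by (simp only: funpow.simps o_apply)
qed

lemma string_dual: "\<gamma> \<in> roots \<Longrightarrow> \<mu> \<in> dual_space t \<Longrightarrow> \<mu> + fscale c \<gamma> \<in> dual_space t"
  using root_dual[of \<gamma>] by (auto simp: dual_space_def fscale_def algebra_simps)

lemma ad_power_last:
  assumes g: "\<gamma> \<in> roots" and x: "x \<in> root_space \<gamma>"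
    and v: "\<mu> \<in> dual_space t" "v \<in> root_space \<mu>" "v \<noteq> 0"
  shows "\<exists>k. (\<forall>j\<le>k. (bracket x ^^ j) v \<noteq> 0) \<and> (bracket x ^^ Suc k) v = 0"
proof -
  have "\<exists>k. (bracket x ^^ k) v = 0"
  proof (rule ccontr)
    assume contra: "\<not> ?thesis"
    let ?w = "\<lambda>k::nat. \<mu> + fscale (of_nat k) \<gamma>"
    have "range ?w \<subseteq> weights"
      using contra weight_mem[OF string_dual[OF g v(1)] ad_power_mem[OF x v(2)]] by blast
    then have "finite (range ?w)" using finite_weights finite_subset by blast
    moreover obtain h where "\<gamma> h \<noteq> 0" using root_ne_0[OF g] by (auto simp: fun_eq_iff)
    then have "inj ?w" by (auto simp: inj_def fscale_def fun_eq_iff)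
    ultimately show False using finite_imageD infinite_UNIV_nat by blast
  qed
  then obtain k where k: "(bracket x ^^ k) v = 0" "\<And>j. j < k \<Longrightarrow> (bracket x ^^ j) v \<noteq> 0"
    using exists_least_iff[of "\<lambda>k. (bracket x ^^ k) v = 0"] by blast
  then obtain k' where "k = Suc k'" using v(3) by (cases k) auto
  then show ?thesis using k by (intro exI[of _ k']) auto
qed

text \<open>The usual sl(2) identity assumes that \<gamma> takes the value 2 on
  \<open>bracket e f\<close>. Here nothing is normalised, because the identity serves in the proof
  that \<open>\<gamma> (dual_vector \<gamma>)\<close> is nonzero.\<close>

lemma bracket_lowering_power:
  assumes e: "e \<in> root_space \<gamma>" and f: "f \<in> root_space (- \<gamma>)"
    and v: "v \<in> root_space \<mu>" "bracket e v = 0"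
  shows "bracket e ((bracket f ^^ Suc j) v)
    = (of_nat (Suc j) * (\<mu> (bracket e f) - of_nat j / 2 * \<gamma> (bracket e f))) *s (bracket f ^^ j) v"
proof -
  let ?h = "bracket e f"
  have h: "?h \<in> t" using bracket_opposite_mem_t[OF e f] .
  have hv: "bracket ?h ((bracket f ^^ j) v) = (\<mu> ?h - of_nat j * \<gamma> ?h) *s (bracket f ^^ j) v" for j
    using root_spaceD[OF ad_power_mem[OF f v(1)] h, of j] by (simp add: fscale_def)
  show ?thesis
  proof (induction j)
    case 0
    show ?case using bracket_leibniz[of e f v] v(2) hv[of 0] by simp
  next
    case (Suc j)
    have "bracket e ((bracket f ^^ Suc (Suc j)) v)
        = bracket ?h ((bracket f ^^ Suc j) v) + bracket f (bracket e ((bracket f ^^ Suc j) v))"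
      using bracket_leibniz[of e f "(bracket f ^^ Suc j) v"] by simp
    also have "\<dots> = (\<mu> ?h - of_nat (Suc j) * \<gamma> ?h) *s (bracket f ^^ Suc j) v
        + (of_nat (Suc j) * (\<mu> ?h - of_nat j / 2 * \<gamma> ?h)) *s (bracket f ^^ Suc j) v"
      unfolding Suc.IH hv[of "Suc j"] bracket_scale_right by simp
    also have "\<dots> = ((\<mu> ?h - of_nat (Suc j) * \<gamma> ?h) + of_nat (Suc j) * (\<mu> ?h - of_nat j / 2 * \<gamma> ?h))
        *s (bracket f ^^ Suc j) v"
      by (simp only: scale_left_distrib)
    also have "(\<mu> ?h - of_nat (Suc j) * \<gamma> ?h) + of_nat (Suc j) * (\<mu> ?h - of_nat j / 2 * \<gamma> ?h)
        = of_nat (Suc (Suc j)) * (\<mu> ?h - of_nat (Suc j) / 2 * \<gamma> ?h)"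
      by (simp add: field_simps)
    finally show ?case .
  qed
qed

text \<open>Applying \<open>e\<close> to the first vanishing power of \<open>f\<close> forces the
  coefficient at the last nonvanishing one to be 0.\<close>

lemma highest_weight:
  assumes g: "\<gamma> \<in> roots" and e: "e \<in> root_space \<gamma>" and f: "f \<in> root_space (- \<gamma>)"
    and v: "\<mu> \<in> dual_space t" "v \<in> root_space \<mu>" "v \<noteq> 0" "bracket e v = 0"
  obtains m where "2 * \<mu> (bracket e f) = of_nat m * \<gamma> (bracket e f)"
    "\<And>j. j \<le> m \<Longrightarrow> (bracket f ^^ j) v \<noteq> 0" "(bracket f ^^ Suc m) v = 0"
proof -
  obtain m where m: "\<And>j. j \<le> m \<Longrightarrow> (bracket f ^^ j) v \<noteq> 0" "(bracket f ^^ Suc m) v = 0"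
    using ad_power_last[OF uminus_root[OF g] f v(1-3)] by blast
  have "of_nat (Suc m) * (\<mu> (bracket e f) - of_nat m / 2 * \<gamma> (bracket e f)) = 0"
    using bracket_lowering_power[OF e f v(2,4), of m] m by simp
  then have "\<mu> (bracket e f) - of_nat m / 2 * \<gamma> (bracket e f) = 0"
    by (metis mult_eq_0_iff of_nat_neq_0)
  then have "2 * \<mu> (bracket e f) = of_nat m * \<gamma> (bracket e f)" by (simp add: field_simps)
  then show ?thesis using m by (rule that)
qed

text \<open>If the norm were 0, then \<gamma> would vanish on \<open>bracket e f\<close>. The top
  vector of the string of \<open>e\<close> through a root \<delta> then has a weight that vanishes
  there too, and this weight differs from \<delta> by a multiple of \<gamma>. So all roots vanish on
  the nonzero element \<open>bracket e f\<close> of \<open>t\<close>, which is impossible.\<close>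

lemma root_norm_nonzero:
  assumes g: "\<gamma> \<in> roots"
  shows "\<gamma> (dual_vector \<gamma>) \<noteq> 0"
proof
  assume 0: "\<gamma> (dual_vector \<gamma>) = 0"
  obtain e where e: "e \<in> root_space \<gamma>" "e \<noteq> 0" using root_vector_exists[OF g] by blast
  obtain f where f: "f \<in> root_space (- \<gamma>)" "killing e f \<noteq> 0"
    using killing_root_space_pairing[OF _ e] g by blast
  let ?h = "bracket e f"
  have h: "?h = killing e f *s dual_vector \<gamma>" by (rule bracket_opposite[OF g e(1) f(1)])
  have g0: "\<gamma> ?h = 0" using 0 root_scale[OF g dual_vector(1)[OF g]] by (simp add: h)
  have "\<delta> ?h = 0" if d: "\<delta> \<in> roots" for \<delta>
  proof -
    obtain w where w: "w \<in> root_space \<delta>" "w \<noteq> 0" using root_vector_exists[OF d] by blast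
    obtain k where k: "(bracket e ^^ k) w \<noteq> 0" "(bracket e ^^ Suc k) w = 0"
      using ad_power_last[OF g e(1) root_dual[OF d] w] by blast
    obtain m where "2 * (\<delta> + fscale (of_nat k) \<gamma>) ?h = of_nat m * \<gamma> ?h"
      using highest_weight[OF g e(1) f(1) string_dual[OF g root_dual[OF d]] ad_power_mem[OF e(1) w(1)] k(1)]
        k(2) by auto
    then show ?thesis using g0 by (simp add: fscale_def)
  qed
  then have "?h = 0" using roots_separate bracket_opposite_mem_t[OF e(1) f(1)] by blast
  then show False using h f(2) dual_vector_nonzero[OF g] by simp
qed

section \<open>Coroots, integrality and one-dimensional root spaces\<close>

definition coroot :: "('a \<Rightarrow> complex) \<Rightarrow> 'a"
  where "coroot \<gamma> = (2 / \<gamma> (dual_vector \<gamma>)) *s dual_vector \<gamma>"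

lemma coroot_eval:
  "\<gamma> \<in> roots \<Longrightarrow> \<delta> \<in> roots \<Longrightarrow> \<delta> (coroot \<gamma>) = 2 * root_form \<delta> \<gamma> / root_form \<gamma> \<gamma>"
  by (simp add: coroot_def root_scale dual_vector root_form_eval)

lemma coroot_self: "\<gamma> \<in> roots \<Longrightarrow> \<gamma> (coroot \<gamma>) = 2"
  by (simp add: coroot_def root_scale dual_vector root_norm_nonzero)

lemma coroot_mem_t: "\<gamma> \<in> roots \<Longrightarrow> coroot \<gamma> \<in> t"
  by (simp add: coroot_def subspace_scale subspace_t dual_vector)

lemma coroot_uminus:
  assumes "\<gamma> \<in> roots"
  shows "coroot (- \<gamma>) = - coroot \<gamma>"
proof -
  have "\<gamma> (- dual_vector \<gamma>) = - \<gamma> (dual_vector \<gamma>)"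
    using root_scale[OF assms dual_vector(1)[OF assms], of "-1"] by simp
  then show ?thesis by (simp add: coroot_def dual_vector_uminus assms)
qed

lemma eval_minus_t: "\<gamma> \<in> roots \<Longrightarrow> h \<in> t \<Longrightarrow> \<gamma> (- h) = - \<gamma> h"
  using root_scale[of \<gamma> h "-1"] by simp

lemma sl2_triple:
  assumes g: "\<gamma> \<in> roots" and e: "e \<in> root_space \<gamma>" "e \<noteq> 0"
  obtains f where "f \<in> root_space (- \<gamma>)" "bracket e f = coroot \<gamma>"
proof -
  obtain y where y: "y \<in> root_space (- \<gamma>)" "killing e y \<noteq> 0"
    using killing_root_space_pairing[OF _ e] g by blast
  show ?thesis
    by (rule that[of "(2 / \<gamma> (dual_vector \<gamma>) / killing e y) *s y"])
      (use y g e in \<open>auto simp: subspace_scale subspace_root_space bracket_scale_right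
        bracket_opposite coroot_def\<close>)
qed

lemma highest_weight_coroot:
  assumes g: "\<gamma> \<in> roots" and e: "e \<in> root_space \<gamma>" and f: "f \<in> root_space (- \<gamma>)"
    and ef: "bracket e f = coroot \<gamma>"
    and v: "\<mu> \<in> dual_space t" "v \<in> root_space \<mu>" "v \<noteq> 0" "bracket e v = 0"
  obtains m where "\<mu> (coroot \<gamma>) = of_nat m"
    "\<And>j. j \<le> m \<Longrightarrow> (bracket f ^^ j) v \<noteq> 0" "(bracket f ^^ Suc m) v = 0"
    "\<And>j. bracket e ((bracket f ^^ Suc j) v) = (of_nat (Suc j) * (of_nat m - of_nat j)) *s (bracket f ^^ j) v"
proof -
  obtain m where m: "2 * \<mu> (bracket e f) = of_nat m * \<gamma> (bracket e f)"
    "\<And>j. j \<le> m \<Longrightarrow> (bracket f ^^ j) v \<noteq> 0" "(bracket f ^^ Suc m) v = 0"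
    using highest_weight[OF g e f v] by metis
  have \<mu>: "\<mu> (coroot \<gamma>) = of_nat m" using m(1) coroot_self[OF g] by (simp add: ef)
  show ?thesis
    by (rule that[OF \<mu> m(2,3)])
      (use bracket_lowering_power[OF e f v(2,4)] in \<open>simp_all add: ef \<mu> coroot_self[OF g]\<close>)
qed

text \<open>The top of the string through \<delta> lies \<open>k\<close> steps above it and has a
  natural coroot value; each step contributes 2.\<close>

lemma coroot_eval_Ints:
  assumes g: "\<gamma> \<in> roots" and d: "\<delta> \<in> roots"
  shows "\<delta> (coroot \<gamma>) \<in> \<int>"
proof -
  obtain e where e: "e \<in> root_space \<gamma>" "e \<noteq> 0" using root_vector_exists[OF g] by blast
  obtain f where f: "f \<in> root_space (- \<gamma>)" "bracket e f = coroot \<gamma>" using sl2_triple[OF g e] .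
  obtain w where w: "w \<in> root_space \<delta>" "w \<noteq> 0" using root_vector_exists[OF d] by blast
  obtain k where k: "(bracket e ^^ k) w \<noteq> 0" "(bracket e ^^ Suc k) w = 0"
    using ad_power_last[OF g e(1) root_dual[OF d] w] by blast
  have "bracket e ((bracket e ^^ k) w) = 0" using k(2) by simp
  then obtain m where "(\<delta> + fscale (of_nat k) \<gamma>) (coroot \<gamma>) = of_nat m"
    using highest_weight_coroot[OF g e(1) f string_dual[OF g root_dual[OF d]] ad_power_mem[OF e(1) w(1)] k(1)]
    by blast
  then have "\<delta> (coroot \<gamma>) = of_int (int m - 2 * int k)"
    using coroot_self[OF g] by (simp add: fscale_def algebra_simps eq_diff_eq)
  then show ?thesis by (metis Ints_of_int)
qed

text \<open>A nonzero weight vector killed by \<open>e\<close> is a highest weight vector, and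
  highest weights take natural values on the coroot.\<close>

lemma raising_nonzero:
  assumes g: "\<gamma> \<in> roots" and e: "e \<in> root_space \<gamma>" "e \<noteq> 0"
    and v: "\<mu> \<in> dual_space t" "v \<in> root_space \<mu>" "v \<noteq> 0" and "\<mu> (coroot \<gamma>) \<notin> \<nat>"
  shows "bracket e v \<noteq> 0"
proof
  assume 0: "bracket e v = 0"
  obtain f where f: "f \<in> root_space (- \<gamma>)" "bracket e f = coroot \<gamma>" using sl2_triple[OF g e] .
  obtain m where "\<mu> (coroot \<gamma>) = of_nat m"
    using highest_weight_coroot[OF g e(1) f v 0] by blast
  then show False using assms(7) by simp
qed

text \<open>A multiple of \<open>x\<close> is subtracted from \<open>y\<close> to obtain a
  \<open>z\<close> orthogonal to an \<open>f\<close> of opposite weight, so that \<open>z\<close>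
  and \<open>f\<close> commute. For the root \<open>- \<gamma>\<close>, however, the vector
  \<open>f\<close> is the raising one and the coroot value of \<gamma> is -2, so \<open>f\<close>
  cannot kill a nonzero \<open>z\<close>.\<close>

lemma root_space_proportional:
  assumes g: "\<gamma> \<in> roots" and x: "x \<in> root_space \<gamma>" "x \<noteq> 0" and y: "y \<in> root_space \<gamma>"
  shows "\<exists>c. y = c *s x"
proof -
  obtain f where f: "f \<in> root_space (- \<gamma>)" "killing x f \<noteq> 0"
    using killing_root_space_pairing[OF _ x] g by blast
  have "f \<noteq> 0" using f(2) linear_form_zero[OF linear_form_killing] by auto
  define z where "z = y - (killing y f / killing x f) *s x"
  have z: "z \<in> root_space \<gamma>"
    unfolding z_def using x y by (intro subspace_diff subspace_scale subspace_root_space)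
  have "killing z f = 0"
    using f by (simp add: z_def linear_form_diff[OF linear_form_killing_left]
        linear_form_scale[OF linear_form_killing_left])
  then have "bracket z f = 0" using bracket_opposite[OF g z f(1)] by simp
  then have zf: "bracket f z = 0" using bracket_anticommute[of f z] by simp
  have "z = 0"
  proof (rule ccontr)
    assume "z \<noteq> 0"
    have "\<gamma> (coroot (- \<gamma>)) = - 2"
      using g by (simp add: coroot_uminus eval_minus_t coroot_mem_t coroot_self)
    moreover have "(- 2 :: complex) \<notin> \<nat>"
    proof
      assume "(- 2 :: complex) \<in> \<nat>"
      then obtain n where "(- 2 :: complex) = of_nat n" by (rule Nats_cases)
      then have "Re (- 2) = Re (of_nat n)" by (rule arg_cong)
      then show False by simp
    qed
    ultimately show False
      using raising_nonzero[OF uminus_root[OF g] f(1) \<open>f \<noteq> 0\<close> root_dual[OF g] z \<open>z \<noteq> 0\<close>] zf by simp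
  qed
  then show ?thesis by (auto simp: z_def)
qed

text \<open>If the coroot value is natural, \<open>v\<close> is reached from above: since root
  spaces are lines, the top vector \<open>y\<close> of the string through
  \<open>\<gamma> + \<delta>\<close>, lowered \<open>k + 1\<close> times, is a multiple of
  \<open>v\<close>, and the coefficient with which \<open>e\<close> raises it again is
  nonzero.\<close>

lemma bracket_root_vectors_nonzero:
  assumes g: "\<gamma> \<in> roots" and d: "\<delta> \<in> roots" and gd: "\<gamma> + \<delta> \<in> roots"
    and e: "e \<in> root_space \<gamma>" "e \<noteq> 0" and v: "v \<in> root_space \<delta>" "v \<noteq> 0"
  shows "bracket e v \<noteq> 0"
proof (cases "\<delta> (coroot \<gamma>) \<in> \<nat>")
  case False
  then show ?thesis using raising_nonzero[OF g e root_dual[OF d] v] by blast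
next
  case True
  then obtain p where p: "\<delta> (coroot \<gamma>) = of_nat p" by (rule Nats_cases)
  obtain f where f: "f \<in> root_space (- \<gamma>)" "bracket e f = coroot \<gamma>" using sl2_triple[OF g e] .
  obtain w where w: "w \<in> root_space (\<gamma> + \<delta>)" "w \<noteq> 0" using root_vector_exists[OF gd] by blast
  obtain k where k: "(bracket e ^^ k) w \<noteq> 0" "(bracket e ^^ Suc k) w = 0"
    using ad_power_last[OF g e(1) root_dual[OF gd] w] by blast
  define y where "y = (bracket e ^^ k) w"
  let ?\<mu> = "\<gamma> + \<delta> + fscale (of_nat k) \<gamma>"
  have y: "y \<in> root_space ?\<mu>" "y \<noteq> 0" "bracket e y = 0"
    using ad_power_mem[OF e(1) w(1)] k by (simp_all add: y_def)
  obtain m where m: "?\<mu> (coroot \<gamma>) = of_nat m" "\<And>j. j \<le> m \<Longrightarrow> (bracket f ^^ j) y \<noteq> 0"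
    "\<And>j. bracket e ((bracket f ^^ Suc j) y) = (of_nat (Suc j) * (of_nat m - of_nat j)) *s (bracket f ^^ j) y"
    using highest_weight_coroot[OF g e(1) f string_dual[OF g root_dual[OF gd]] y] by metis
  \<comment> \<open>The value on the coroot is \<open>p\<close> for \<delta>, 2 for \<gamma>, and
    \<open>2 * k\<close> for the \<open>k\<close> further steps up the string.\<close>
  have "(of_nat m :: complex) = of_nat (2 + p + 2 * k)"
    using m(1) p coroot_self[OF g] by (simp add: fscale_def algebra_simps)
  then have mk: "m = 2 + p + 2 * k" by (metis of_nat_eq_iff)
  have "?\<mu> + fscale (of_nat (Suc k)) (- \<gamma>) = \<delta>"
    by (auto simp: fscale_def fun_eq_iff algebra_simps)
  then have "(bracket f ^^ Suc k) y \<in> root_space \<delta>"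
    using ad_power_mem[OF f(1) y(1), of "Suc k"] by (simp only:)
  then obtain c where c: "(bracket f ^^ Suc k) y = c *s v"
    using root_space_proportional[OF d v] by blast
  \<comment> \<open>The scalar is \<open>(k + 1) * (m - k)\<close>, nonzero because
    \<open>k < m\<close>.\<close>
  have "bracket e ((bracket f ^^ Suc k) y) \<noteq> 0"
    unfolding m(3)[of k] using m(2)[of k] mk
    by (simp del: of_nat_Suc of_nat_add add: of_nat_diff[symmetric])
  then show ?thesis unfolding c bracket_scale_right by auto
qed


subsection \<open>Positivity and root strings\<close>

text \<open>The values of \<open>root_form\<close> on roots turn out to be real, which makes signs
  available. Defined by evaluation, \<open>ip\<close> is additive in the first argument for
  arbitrary functions and not only for roots.\<close>

definition ip :: "('a \<Rightarrow> complex) \<Rightarrow> ('a \<Rightarrow> complex) \<Rightarrow> real"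
  where "ip \<mu> \<delta> = Re (\<mu> (dual_vector \<delta>))"

text \<open>With \<open>a\<close> the norm of \<open>\<gamma>\<close> and \<open>n\<close> the values of the weights on its coroot, the trace formula
  for the Killing form reads \<open>a = a\<^sup>2 / 4 * (\<Sum>w. (n w)\<^sup>2)\<close>.\<close>

lemma root_form_self_pos:
  assumes g: "\<gamma> \<in> roots"
  obtains r :: real where "r > 0" "root_form \<gamma> \<gamma> = of_real r"
proof -
  define a where "a = root_form \<gamma> \<gamma>"
  let ?t = "dual_vector \<gamma>"
  have t: "?t \<in> t" by (rule dual_vector(1)[OF g])
  have a: "a = \<gamma> ?t" by (simp add: a_def root_form_eval g)
  have a0: "a \<noteq> 0" using root_norm_nonzero[OF g] by (simp add: a)
  obtain x where x: "x \<in> root_space \<gamma>" "x \<noteq> 0" using root_vector_exists[OF g] by blast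
  obtain W wt where W: "independent W" "span W = UNIV" "finite W"
    "\<And>w. w \<in> W \<Longrightarrow> wt w \<in> weights \<and> w \<in> root_space (wt w)"
    using weight_basis[OF insertI2[OF g] x] by metis
  have "\<exists>n::int. wt w ?t = of_int n * a / 2" if w: "w \<in> W" for w
  proof (cases "wt w = 0")
    case True
    then show ?thesis by (intro exI[of _ 0]) simp
  next
    case False
    then have d: "wt w \<in> roots" using W(4)[OF w] by simp
    obtain n where "wt w (coroot \<gamma>) = of_int n" using coroot_eval_Ints[OF g d] by (rule Ints_cases)
    moreover have "wt w (coroot \<gamma>) = 2 / a * wt w ?t"
      by (simp add: coroot_def root_scale[OF d t] a)
    ultimately show ?thesis using a0 by (intro exI[of _ n]) (simp add: field_simps)
  qed
  then obtain n where n: "\<And>w. w \<in> W \<Longrightarrow> wt w ?t = of_int (n w) * a / 2" by metis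
  have "a = killing ?t ?t" by (simp add: a_def root_form_def)
  also have "\<dots> = (\<Sum>w\<in>W. wt w ?t * wt w ?t)"
    using W t by (intro killing_t) auto
  also have "\<dots> = (\<Sum>w\<in>W. (a * a / 4) * of_int (n w * n w))"
    by (rule sum.cong) (simp_all add: n)
  also have "\<dots> = (a * a / 4) * of_int (\<Sum>w\<in>W. n w * n w)"
    by (simp only: sum_distrib_left of_int_sum)
  finally have 1: "a * (1 - a * of_int (\<Sum>w\<in>W. n w * n w) / 4) = 0" by (simp add: field_simps)
  define N where "N = (\<Sum>w\<in>W. n w * n w)"
  have aN: "a * of_int N = 4" using 1 a0 unfolding N_def[symmetric] by simp
  then have "N \<noteq> 0" by auto
  moreover have "N \<ge> 0" unfolding N_def by (rule sum_nonneg) simp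
  ultimately have "N > 0" by simp
  moreover have "a = of_real (4 / of_int N)" using aN \<open>N \<noteq> 0\<close> by (simp add: field_simps)
  ultimately show ?thesis using that[of "4 / of_int N"] by (simp add: a_def)
qed

lemma root_form_real:
  assumes "\<gamma> \<in> roots" "\<delta> \<in> roots"
  shows "root_form \<gamma> \<delta> = of_real (ip \<gamma> \<delta>)"
proof -
  obtain r where r: "root_form \<delta> \<delta> = of_real r" "r > 0"
    using root_form_self_pos[OF assms(2)] by metis
  obtain n where "\<gamma> (coroot \<delta>) = of_int n" using coroot_eval_Ints[OF assms(2,1)] by (rule Ints_cases)
  then have "root_form \<gamma> \<delta> = of_real (of_int n * r / 2)"
    using r coroot_eval[OF assms(2,1)] by (simp add: field_simps)
  then have "root_form \<gamma> \<delta> = of_real (Re (root_form \<gamma> \<delta>))" by (simp only: Re_complex_of_real)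
  then show ?thesis using assms by (simp only: ip_def root_form_eval)
qed

lemma root_form_eq_0: "\<gamma> \<in> roots \<Longrightarrow> \<delta> \<in> roots \<Longrightarrow> root_form \<gamma> \<delta> = 0 \<longleftrightarrow> ip \<gamma> \<delta> = 0"
  by (simp add: root_form_real)

lemma ip_commute: "\<gamma> \<in> roots \<Longrightarrow> \<delta> \<in> roots \<Longrightarrow> ip \<gamma> \<delta> = ip \<delta> \<gamma>"
  using root_form_commute[of \<gamma> \<delta>] by (simp add: root_form_real)

lemma ip_self_pos: "\<gamma> \<in> roots \<Longrightarrow> ip \<gamma> \<gamma> > 0"
  using root_form_self_pos[of \<gamma>] by (metis of_real_eq_iff root_form_real)

lemma ip_add: "ip (\<mu> + \<nu>) \<delta> = ip \<mu> \<delta> + ip \<nu> \<delta>"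
  and ip_diff: "ip (\<mu> - \<nu>) \<delta> = ip \<mu> \<delta> - ip \<nu> \<delta>"
  and ip_uminus: "ip (- \<mu>) \<delta> = - ip \<mu> \<delta>"
  and ip_zero [simp]: "ip 0 \<delta> = 0"
  by (simp_all add: ip_def)

lemma ip_uminus_right: "\<gamma> \<in> roots \<Longrightarrow> \<delta> \<in> roots \<Longrightarrow> ip \<gamma> (- \<delta>) = - ip \<gamma> \<delta>"
  using ip_commute[of \<gamma> "- \<delta>"] ip_commute[of \<gamma> \<delta>] by (simp add: ip_uminus)

lemma ip_coroot:
  assumes "\<gamma> \<in> roots" "\<delta> \<in> roots"
  shows "\<gamma> (coroot \<delta>) = of_real (2 * ip \<gamma> \<delta> / ip \<delta> \<delta>)"
  using assms by (simp add: coroot_eval root_form_real)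

lemma ip_integral:
  assumes "\<gamma> \<in> roots" "\<delta> \<in> roots"
  obtains n :: int where "2 * ip \<gamma> \<delta> = of_int n * ip \<delta> \<delta>"
proof -
  obtain n where "\<gamma> (coroot \<delta>) = of_int n" using coroot_eval_Ints[OF assms(2,1)] by (rule Ints_cases)
  then have "of_real (2 * ip \<gamma> \<delta> / ip \<delta> \<delta>) = (of_real (of_int n) :: complex)"
    using ip_coroot[OF assms] by simp
  then have "2 * ip \<gamma> \<delta> / ip \<delta> \<delta> = of_int n" by (metis of_real_eq_iff)
  then show ?thesis using ip_self_pos[OF assms(2)] that by (simp add: field_simps)
qed

text \<open>A negative coroot value is not natural, so raising a root vector for \<delta> gives a
  nonzero vector of weight \<open>\<gamma> + \<delta>\<close>.\<close>

lemma add_root_if_ip_neg: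
  assumes g: "\<gamma> \<in> roots" and d: "\<delta> \<in> roots" and neg: "ip \<gamma> \<delta> < 0" and "\<gamma> + \<delta> \<noteq> 0"
  shows "\<gamma> + \<delta> \<in> roots"
proof -
  obtain e where e: "e \<in> root_space \<gamma>" "e \<noteq> 0" using root_vector_exists[OF g] by blast
  obtain v where v: "v \<in> root_space \<delta>" "v \<noteq> 0" using root_vector_exists[OF d] by blast
  have "\<delta> (coroot \<gamma>) \<notin> \<nat>"
  proof
    assume "\<delta> (coroot \<gamma>) \<in> \<nat>"
    then obtain n where "\<delta> (coroot \<gamma>) = of_nat n" by (rule Nats_cases)
    then have "Re (\<delta> (coroot \<gamma>)) = real n" by simp
    moreover have "Re (\<delta> (coroot \<gamma>)) < 0"
      unfolding ip_coroot[OF d g] using neg ip_commute[OF g d] ip_self_pos[OF g]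
      by (simp add: divide_neg_pos)
    ultimately show False by simp
  qed
  then have "bracket e v \<noteq> 0" by (rule raising_nonzero[OF g e root_dual[OF d] v])
  then show ?thesis
    using weight_mem[OF dual_space_plus[OF root_dual[OF g] root_dual[OF d]] bracket_root_space[OF e(1) v(1)]]
      assms(4) by simp
qed

lemma diff_root_if_ip_pos:
  assumes "\<gamma> \<in> roots" "\<delta> \<in> roots" "ip \<gamma> \<delta> > 0" "\<gamma> \<noteq> \<delta>"
  shows "\<gamma> - \<delta> \<in> roots"
  using add_root_if_ip_neg[of \<gamma> "- \<delta>"] assms by (simp add: ip_uminus_right)

text \<open>The \<delta>-string through an orthogonal \<gamma> is symmetric. Were
  \<open>\<gamma> - \<delta>\<close> not a root, a root vector for \<gamma> would be a highest
  weight vector of value 0 for the triple of \<open>- \<delta>\<close>; so \<open>f\<close>, of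
  weight \<delta>, would kill it, although \<open>\<gamma> + \<delta>\<close> is a root.\<close>

lemma diff_root_if_orthogonal:
  assumes g: "\<gamma> \<in> roots" and d: "\<delta> \<in> roots" and orth: "ip \<gamma> \<delta> = 0" and sum: "\<gamma> + \<delta> \<in> roots"
  shows "\<gamma> - \<delta> \<in> roots"
proof (rule ccontr)
  assume no: "\<gamma> - \<delta> \<notin> roots"
  have ne: "\<gamma> - \<delta> \<noteq> 0" using orth ip_self_pos[OF g] by auto
  have d': "- \<delta> \<in> roots" using d by simp
  obtain e where e: "e \<in> root_space (- \<delta>)" "e \<noteq> 0" using root_vector_exists[OF d'] by blast
  obtain f where f: "f \<in> root_space (- (- \<delta>))" "bracket e f = coroot (- \<delta>)" using sl2_triple[OF d' e] .
  obtain v where v: "v \<in> root_space \<gamma>" "v \<noteq> 0" using root_vector_exists[OF g] by blast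
  have "bracket e v \<in> root_space (\<gamma> - \<delta>)" using bracket_root_space[OF e(1) v(1)] by simp
  then have ev: "bracket e v = 0"
    using no ne weight_mem[OF dual_space_diff[OF root_dual[OF g] root_dual[OF d]]] by auto
  obtain m where m: "\<gamma> (coroot (- \<delta>)) = of_nat m" "(bracket f ^^ Suc m) v = 0"
    using highest_weight_coroot[OF d' e(1) f root_dual[OF g] v ev] by metis
  have "\<gamma> (coroot (- \<delta>)) = 0" using orth by (simp add: ip_coroot g d ip_uminus_right)
  then have "m = 0" using m(1) by simp
  then have "bracket f v = 0" using m(2) by simp
  moreover have "f \<noteq> 0" using f(2) coroot_self[OF d'] eval_minus_t[OF d' subspace_0[OF subspace_t]] by auto
  ultimately show False
    using bracket_root_vectors_nonzero[OF d g _ _ _ v, of f] sum f(1) by (simp add: add.commute)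
qed


subsection \<open>Coefficients and heights\<close>

definition cf :: "('a \<Rightarrow> complex) \<Rightarrow> ('a \<Rightarrow> complex) \<Rightarrow> real"
  where "cf \<mu> \<alpha> = Re (coeff \<mu> \<alpha>)"

lemma coeff_cf: "\<gamma> \<in> roots \<Longrightarrow> coeff \<gamma> \<alpha> = of_real (cf \<gamma> \<alpha>)"
  using weight_coeff_Ints[of \<gamma> \<alpha>] by (auto simp: cf_def elim!: Ints_cases)

lemma cf_add: "\<mu> \<in> forms.span simple_roots \<Longrightarrow> \<nu> \<in> forms.span simple_roots \<Longrightarrow> cf (\<mu> + \<nu>) \<alpha> = cf \<mu> \<alpha> + cf \<nu> \<alpha>"
  by (simp add: cf_def coeff_add)

lemma cf_uminus: "\<mu> \<in> forms.span simple_roots \<Longrightarrow> cf (- \<mu>) \<alpha> = - cf \<mu> \<alpha>"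
  by (simp add: cf_def coeff_uminus)

lemma cf_diff:
  assumes "\<mu> \<in> forms.span simple_roots" "\<nu> \<in> forms.span simple_roots"
  shows "cf (\<mu> - \<nu>) \<alpha> = cf \<mu> \<alpha> - cf \<nu> \<alpha>"
  using cf_add[OF assms(1) forms.span_neg[OF assms(2)], of \<alpha>] assms(2) by (simp add: cf_uminus)

lemma cf_simple: "\<beta> \<in> simple_roots \<Longrightarrow> cf \<beta> \<alpha> = (if \<alpha> = \<beta> then 1 else 0)"
  by (simp add: cf_def coeff_simple)

lemma cf_nonsimple: "\<alpha> \<notin> simple_roots \<Longrightarrow> cf \<mu> \<alpha> = 0"
  unfolding cf_def coeff_def by (metis forms.representation_ne_zero zero_complex.sel(1))

lemma cf_nonneg: "\<gamma> \<in> pos_roots \<Longrightarrow> cf \<gamma> \<alpha> \<ge> 0"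
  using pos_coeff_Nats[of \<gamma> \<alpha>] by (auto simp: cf_def elim!: Nats_cases)

lemma cf_int: "\<gamma> \<in> roots \<Longrightarrow> cf \<gamma> \<alpha> \<in> \<int>"
  using weight_coeff_Ints[of \<gamma> \<alpha>] by (auto simp: cf_def elim!: Ints_cases)

lemma supp_cf: "\<gamma> \<in> roots \<Longrightarrow> supp \<gamma> = {\<alpha> \<in> simple_roots. cf \<gamma> \<alpha> \<noteq> 0}"
  by (auto simp: supp_def coeff_cf)

lemma root_eq_sum: "\<gamma> \<in> roots \<Longrightarrow> \<gamma> x = (\<Sum>\<alpha>\<in>simple_roots. of_real (cf \<gamma> \<alpha>) * \<alpha> x)"
  by (simp add: span_expand root_span coeff_cf)

lemma ip_eq_sum:
  assumes "\<gamma> \<in> roots"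
  shows "ip \<gamma> \<delta> = (\<Sum>\<alpha>\<in>simple_roots. cf \<gamma> \<alpha> * ip \<alpha> \<delta>)"
  unfolding ip_def root_eq_sum[OF assms, of "dual_vector \<delta>"] by simp

lemma cf_eq_imp_eq:
  assumes "\<gamma> \<in> roots" "\<delta> \<in> roots" "\<And>\<alpha>. \<alpha> \<in> simple_roots \<Longrightarrow> cf \<gamma> \<alpha> = cf \<delta> \<alpha>"
  shows "\<gamma> = \<delta>"
proof
  fix x show "\<gamma> x = \<delta> x"
    unfolding root_eq_sum[OF assms(1), of x] root_eq_sum[OF assms(2), of x] using assms(3) by simp
qed

lemma supp_nonempty: "\<gamma> \<in> roots \<Longrightarrow> supp \<gamma> \<noteq> {}"
proof
  assume g: "\<gamma> \<in> roots" "supp \<gamma> = {}"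
  then have "\<gamma> x = 0" for x unfolding root_eq_sum[OF g(1), of x] by (auto simp: supp_cf)
  then show False using root_ne_0[OF g(1)] by (auto simp: fun_eq_iff)
qed

lemma pos_if_cf_pos:
  assumes "\<gamma> \<in> roots" "cf \<gamma> \<alpha> > 0"
  shows "\<gamma> \<in> pos_roots"
proof (rule ccontr)
  assume "\<gamma> \<notin> pos_roots"
  then obtain \<delta> where "\<delta> \<in> pos_roots" "\<gamma> = - \<delta>" using assms(1) by (auto simp: roots_eq)
  then show False using assms(2) cf_nonneg[of \<delta> \<alpha>] by (simp add: cf_uminus pos_root_span)
qed

lemma pos_cf_pos: "\<gamma> \<in> pos_roots \<Longrightarrow> \<exists>\<alpha>\<in>simple_roots. cf \<gamma> \<alpha> > 0"
proof -
  assume g: "\<gamma> \<in> pos_roots"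
  obtain \<alpha> where a: "\<alpha> \<in> supp \<gamma>" using supp_nonempty[OF pos_root[OF g]] by blast
  then have "\<alpha> \<in> simple_roots" "cf \<gamma> \<alpha> \<noteq> 0" by (auto simp: supp_cf[OF pos_root[OF g]])
  then show ?thesis using cf_nonneg[OF g, of \<alpha>] by (intro bexI[of _ \<alpha>]) auto
qed

lemma pos_if_cf_nonneg:
  assumes "\<gamma> \<in> roots" "\<And>\<alpha>. cf \<gamma> \<alpha> \<ge> 0"
  shows "\<gamma> \<in> pos_roots"
proof -
  obtain \<alpha> where "\<alpha> \<in> supp \<gamma>" using supp_nonempty[OF assms(1)] by blast
  then have "cf \<gamma> \<alpha> \<noteq> 0" by (simp add: supp_cf[OF assms(1)])
  then have "cf \<gamma> \<alpha> > 0" using assms(2)[of \<alpha>] by simp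
  then show ?thesis by (rule pos_if_cf_pos[OF assms(1)])
qed

lemma uminus_not_pos: "\<gamma> \<in> pos_roots \<Longrightarrow> - \<gamma> \<notin> pos_roots"
proof
  assume g: "\<gamma> \<in> pos_roots" "- \<gamma> \<in> pos_roots"
  obtain \<alpha> where "cf \<gamma> \<alpha> > 0" using pos_cf_pos[OF g(1)] by blast
  then show False using cf_nonneg[OF g(2), of \<alpha>] g(1) by (simp add: cf_uminus pos_root_span)
qed

lemma pos_or_neg: "\<gamma> \<in> roots \<Longrightarrow> \<gamma> \<in> pos_roots \<or> - \<gamma> \<in> pos_roots"
  by (auto simp: roots_eq)

lemma pos_add: "\<gamma> \<in> pos_roots \<Longrightarrow> \<delta> \<in> pos_roots \<Longrightarrow> \<gamma> + \<delta> \<in> roots \<Longrightarrow> \<gamma> + \<delta> \<in> pos_roots"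
  by (rule pos_if_cf_nonneg) (simp_all add: cf_add pos_root_span cf_nonneg)

lemma pos_ne_uminus: "\<gamma> \<in> pos_roots \<Longrightarrow> \<delta> \<in> pos_roots \<Longrightarrow> \<gamma> + \<delta> \<noteq> 0"
  using uminus_not_pos[of \<gamma>] by (auto simp: add_eq_0_iff)

definition ht :: "('a \<Rightarrow> complex) \<Rightarrow> nat"
  where "ht \<gamma> = nat \<lfloor>\<Sum>\<alpha>\<in>simple_roots. cf \<gamma> \<alpha>\<rfloor>"

lemma ht_real:
  assumes "\<gamma> \<in> pos_roots"
  shows "real (ht \<gamma>) = (\<Sum>\<alpha>\<in>simple_roots. cf \<gamma> \<alpha>)"
proof -
  have "(\<Sum>\<alpha>\<in>simple_roots. cf \<gamma> \<alpha>) \<in> \<int>" using cf_int[OF pos_root[OF assms]] by (rule Ints_sum)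
  moreover have "(\<Sum>\<alpha>\<in>simple_roots. cf \<gamma> \<alpha>) \<ge> 0" using cf_nonneg[OF assms] by (rule sum_nonneg)
  ultimately show ?thesis unfolding ht_def by (auto elim!: Ints_cases)
qed

lemma ht_add:
  assumes "\<gamma> \<in> pos_roots" "\<delta> \<in> pos_roots" "\<gamma> + \<delta> \<in> pos_roots"
  shows "ht (\<gamma> + \<delta>) = ht \<gamma> + ht \<delta>"
proof -
  have "real (ht (\<gamma> + \<delta>)) = real (ht \<gamma> + ht \<delta>)"
    using assms by (simp add: ht_real cf_add pos_root_span sum.distrib)
  then show ?thesis by (metis of_nat_eq_iff)
qed

lemma ht_pos:
  assumes "\<gamma> \<in> pos_roots"
  shows "ht \<gamma> > 0"
proof -
  obtain \<alpha> where "\<alpha> \<in> simple_roots" "cf \<gamma> \<alpha> > 0" using pos_cf_pos[OF assms] by blast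
  then have "(\<Sum>\<alpha>\<in>simple_roots. cf \<gamma> \<alpha>) > 0"
    using cf_nonneg[OF assms] by (intro sum_pos2[OF finite_simple_roots]) auto
  then show ?thesis unfolding ht_real[OF assms, symmetric] by simp
qed

text \<open>As \<open>ip \<gamma> \<gamma>\<close> is positive, some simple root with positive
  coefficient has a positive product with \<gamma>. Subtracting it leaves a root, and integrality
  keeps the coefficients nonnegative.\<close>

lemma pos_descend:
  assumes g: "\<gamma> \<in> pos_roots" "\<gamma> \<notin> simple_roots"
  obtains \<alpha> where "\<alpha> \<in> simple_roots" "cf \<gamma> \<alpha> > 0" "\<gamma> - \<alpha> \<in> pos_roots" "ht (\<gamma> - \<alpha>) < ht \<gamma>"
proof -
  have "\<exists>\<alpha>\<in>simple_roots. cf \<gamma> \<alpha> * ip \<alpha> \<gamma> > 0"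
  proof (rule ccontr)
    assume "\<not> ?thesis"
    then have "ip \<gamma> \<gamma> \<le> 0"
      unfolding ip_eq_sum[OF pos_root[OF g(1)], of \<gamma>] by (intro sum_nonpos) (auto simp: not_less)
    then show False using ip_self_pos[OF pos_root[OF g(1)]] by simp
  qed
  then obtain \<alpha> where a: "\<alpha> \<in> simple_roots" "cf \<gamma> \<alpha> * ip \<alpha> \<gamma> > 0" by blast
  then have c: "cf \<gamma> \<alpha> > 0" "ip \<alpha> \<gamma> > 0"
    using cf_nonneg[OF g(1), of \<alpha>] by (auto simp: zero_less_mult_iff)
  have ne: "\<gamma> \<noteq> \<alpha>" using a(1) g(2) by blast
  have r: "\<gamma> - \<alpha> \<in> roots"
    using c(2) a(1) g(1) ne by (intro diff_root_if_ip_pos) (auto simp: simple_root pos_root ip_commute)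
  have "cf \<gamma> \<alpha> \<ge> 1"
    using cf_int[OF pos_root[OF g(1)], of \<alpha>] c(1) by (auto elim!: Ints_cases)
  then have p: "\<gamma> - \<alpha> \<in> pos_roots"
    using r g(1) a(1) cf_nonneg[OF g(1)]
    by (intro pos_if_cf_nonneg) (auto simp: cf_diff pos_root_span simple_pos cf_simple)
  have "ht \<gamma> = ht (\<gamma> - \<alpha>) + ht \<alpha>"
    using ht_add[OF p simple_pos[OF a(1)]] g(1) by simp
  then show ?thesis using that a(1) c(1) p ht_pos[OF simple_pos[OF a(1)]] by simp
qed

text \<open>Otherwise the difference would be a root with coefficients 1 and -1.\<close>

lemma simple_ip_nonpos:
  assumes "\<alpha> \<in> simple_roots" "\<beta> \<in> simple_roots" "\<alpha> \<noteq> \<beta>"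
  shows "ip \<alpha> \<beta> \<le> 0"
proof (rule ccontr)
  assume "\<not> ?thesis"
  then have r: "\<alpha> - \<beta> \<in> roots" using assms by (intro diff_root_if_ip_pos) (auto simp: simple_root)
  have "cf (\<alpha> - \<beta>) \<alpha> = 1" "cf (\<alpha> - \<beta>) \<beta> = -1"
    using assms by (simp_all add: cf_diff cf_simple pos_root_span simple_pos)
  then show False using pos_if_cf_pos[OF r, of \<alpha>] cf_nonneg[of "\<alpha> - \<beta>" \<beta>] by simp
qed

section \<open>Supports of roots and their connectedness\<close>

lemma supp_simple: "\<alpha> \<in> simple_roots \<Longrightarrow> supp \<alpha> = {\<alpha>}"
  by (auto simp: supp_def coeff_simple)

lemma supp_uminus: "\<gamma> \<in> roots \<Longrightarrow> supp (- \<gamma>) = supp \<gamma>"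
  by (auto simp: supp_def coeff_uminus root_span)

lemma supp_sub: "supp \<gamma> \<subseteq> simple_roots"
  by (auto simp: supp_def)

lemma finite_supp: "finite (supp \<gamma>)"
  using supp_sub finite_simple_roots by (rule finite_subset)

lemma ip_eq_sum_supp:
  assumes "\<gamma> \<in> roots"
  shows "ip \<gamma> \<delta> = (\<Sum>\<alpha>\<in>supp \<gamma>. cf \<gamma> \<alpha> * ip \<alpha> \<delta>)"
  unfolding ip_eq_sum[OF assms, of \<delta>]
  by (rule sum.mono_neutral_right) (auto simp: finite_simple_roots supp_cf[OF assms])

text \<open>Induction on the height, with a simple \<alpha> removed from \<gamma>. If \<alpha> is on
  the other side from the support of \<open>\<gamma> - \<alpha>\<close>, it is orthogonal to that
  root, so \<open>\<gamma> - \<alpha> - \<alpha>\<close> is a root as well; but its coefficients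
  have both signs.\<close>

lemma supp_connected:
  assumes "\<gamma> \<in> pos_roots" "supp \<gamma> \<subseteq> X \<union> Y" "X \<inter> Y = {}"
    and "\<And>\<alpha> \<beta>. \<alpha> \<in> X \<Longrightarrow> \<beta> \<in> Y \<Longrightarrow> \<alpha> \<in> simple_roots \<Longrightarrow> \<beta> \<in> simple_roots \<Longrightarrow> ip \<alpha> \<beta> = 0"
  shows "supp \<gamma> \<subseteq> X \<or> supp \<gamma> \<subseteq> Y"
  using assms(1,2)
proof (induction "ht \<gamma>" arbitrary: \<gamma> rule: less_induct)
  case less
  show ?case
  proof (cases "\<gamma> \<in> simple_roots")
    case True
    then show ?thesis using less.prems by (simp add: supp_simple)
  next
    case False
    obtain \<alpha> where a: "\<alpha> \<in> simple_roots" "cf \<gamma> \<alpha> > 0" "\<gamma> - \<alpha> \<in> pos_roots" "ht (\<gamma> - \<alpha>) < ht \<gamma>"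
      using pos_descend[OF less.prems(1) False] .
    have cfd: "cf (\<gamma> - \<alpha>) \<beta> = cf \<gamma> \<beta> - (if \<beta> = \<alpha> then 1 else 0)" for \<beta>
      using a(1) less.prems(1) by (simp add: cf_diff cf_simple pos_root_span simple_pos)
    have s: "supp \<gamma> = insert \<alpha> (supp (\<gamma> - \<alpha>))"
      using a(1,2) by (auto simp: supp_cf pos_root less.prems(1) a(3) cfd split: if_splits)
    have step: "supp \<gamma> \<subseteq> A" if A: "supp (\<gamma> - \<alpha>) \<subseteq> A"
      and orth: "\<And>\<beta>. \<beta> \<in> A \<Longrightarrow> \<beta> \<in> simple_roots \<Longrightarrow> \<alpha> \<notin> A \<Longrightarrow> ip \<beta> \<alpha> = 0" for A
    proof (rule ccontr)
      assume "\<not> supp \<gamma> \<subseteq> A"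
      then have aA: "\<alpha> \<notin> A" using A unfolding s by simp
      have "ip (\<gamma> - \<alpha>) \<alpha> = 0"
        unfolding ip_eq_sum_supp[OF pos_root[OF a(3)], of \<alpha>]
        using A orth aA supp_sub by (intro sum.neutral) auto
      then have r: "\<gamma> - \<alpha> - \<alpha> \<in> roots"
        using diff_root_if_orthogonal[OF pos_root[OF a(3)] simple_root[OF a(1)]] pos_root[OF less.prems(1)]
        by simp
      have cfd2: "cf (\<gamma> - \<alpha> - \<alpha>) \<beta> = cf (\<gamma> - \<alpha>) \<beta> - (if \<beta> = \<alpha> then 1 else 0)" for \<beta>
        using a(1,3) by (subst cf_diff) (simp_all add: cf_simple pos_root_span simple_pos)
      obtain \<beta> where b: "\<beta> \<in> simple_roots" "cf (\<gamma> - \<alpha>) \<beta> > 0" using pos_cf_pos[OF a(3)] by blast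
      have "\<beta> \<in> A" using b A by (auto simp: supp_cf[OF pos_root[OF a(3)]])
      then have "cf (\<gamma> - \<alpha> - \<alpha>) \<beta> > 0" using b aA unfolding cfd2 by auto
      then have "\<gamma> - \<alpha> - \<alpha> \<in> pos_roots" by (rule pos_if_cf_pos[OF r])
      moreover have "cf (\<gamma> - \<alpha>) \<alpha> = 0"
        using aA A a(1) by (auto simp: supp_cf[OF pos_root[OF a(3)]])
      then have "cf (\<gamma> - \<alpha> - \<alpha>) \<alpha> < 0" unfolding cfd2 by simp
      ultimately show False using cf_nonneg[of "\<gamma> - \<alpha> - \<alpha>" \<alpha>] by simp
    qed
    have aXY: "\<alpha> \<in> X \<union> Y" using less.prems(2) unfolding s by simp
    have "supp (\<gamma> - \<alpha>) \<subseteq> X \<union> Y" using less.prems(2) unfolding s by simp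
    then have "supp (\<gamma> - \<alpha>) \<subseteq> X \<or> supp (\<gamma> - \<alpha>) \<subseteq> Y"
      by (rule less.hyps[OF a(4,3)])
    then show ?thesis
    proof
      assume X: "supp (\<gamma> - \<alpha>) \<subseteq> X"
      have "supp \<gamma> \<subseteq> X"
      proof (rule step[OF X])
        fix \<beta> assume "\<beta> \<in> X" "\<beta> \<in> simple_roots" "\<alpha> \<notin> X"
        then show "ip \<beta> \<alpha> = 0" using assms(4)[of \<beta> \<alpha>] aXY a(1) by simp
      qed
      then show ?thesis by (rule disjI1)
    next
      assume Y: "supp (\<gamma> - \<alpha>) \<subseteq> Y"
      have "supp \<gamma> \<subseteq> Y"
      proof (rule step[OF Y])
        fix \<beta> assume "\<beta> \<in> Y" "\<beta> \<in> simple_roots" "\<alpha> \<notin> Y"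
        then show "ip \<beta> \<alpha> = 0"
          using assms(4)[of \<alpha> \<beta>] aXY a(1) by (simp add: ip_commute[of \<beta> \<alpha>] simple_root)
      qed
      then show ?thesis by (rule disjI2)
    qed
  qed
qed


subsection \<open>Highest roots\<close>

text \<open>The invariant carried through the cascade. The last clause ties \<open>R\<close> to the
  fixed base, which later identifies \<open>R\<close> with the system on the support of its highest
  root.\<close>

definition standard_system :: "('a \<Rightarrow> complex) set \<Rightarrow> bool"
  where "standard_system R \<longleftrightarrow> R \<subseteq> roots \<and> irreducible_roots R \<and> (\<forall>\<gamma>\<in>R. - \<gamma> \<in> R) \<and>
    (\<forall>\<gamma>\<in>R. \<forall>\<delta>\<in>R. \<gamma> + \<delta> \<in> roots \<longrightarrow> \<gamma> + \<delta> \<in> R) \<and> (\<forall>\<gamma>\<in>R \<inter> pos_roots. supp \<gamma> \<subseteq> R)"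

lemma standard_systemD:
  assumes "standard_system R"
  shows "R \<subseteq> roots" "irreducible_roots R" "\<gamma> \<in> R \<Longrightarrow> - \<gamma> \<in> R"
    "\<gamma> \<in> R \<Longrightarrow> \<delta> \<in> R \<Longrightarrow> \<gamma> + \<delta> \<in> roots \<Longrightarrow> \<gamma> + \<delta> \<in> R"
    "\<gamma> \<in> R \<Longrightarrow> \<gamma> \<in> pos_roots \<Longrightarrow> supp \<gamma> \<subseteq> R" "R \<noteq> {}"
  using assms by (auto simp: standard_system_def irreducible_roots_def)

lemma standard_system_supp:
  assumes R: "standard_system R" and g: "\<gamma> \<in> R"
  shows "supp \<gamma> \<subseteq> R"
proof -
  have r: "\<gamma> \<in> roots" using standard_systemD(1)[OF R] g by blast
  show ?thesis
  proof (cases "\<gamma> \<in> pos_roots")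
    case True
    then show ?thesis using standard_systemD(5)[OF R g] by blast
  next
    case False
    then have "- \<gamma> \<in> pos_roots" using pos_or_neg[OF r] by blast
    then have "supp (- \<gamma>) \<subseteq> R" using standard_systemD(5)[OF R standard_systemD(3)[OF R g]] by blast
    then show ?thesis using supp_uminus[OF r] by simp
  qed
qed

lemma irreducible_rootsD:
  assumes "irreducible_roots R" "R \<subseteq> A \<union> B" "A \<inter> B \<inter> R = {}"
    and "\<And>\<gamma> \<delta>. \<gamma> \<in> A \<inter> R \<Longrightarrow> \<delta> \<in> B \<inter> R \<Longrightarrow> root_form \<gamma> \<delta> = 0"
  shows "R \<subseteq> A \<or> R \<subseteq> B"
proof (rule ccontr)
  assume "\<not> ?thesis"
  then have "A \<inter> R \<noteq> {}" "B \<inter> R \<noteq> {}" using assms(2) by auto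
  moreover have "(A \<inter> R) \<union> (B \<inter> R) = R" "(A \<inter> R) \<inter> (B \<inter> R) = {}" using assms(2,3) by auto
  moreover have "\<forall>\<gamma>\<in>A \<inter> R. \<forall>\<delta>\<in>B \<inter> R. root_form \<gamma> \<delta> = 0" using assms(4) by blast
  ultimately show False using assms(1) unfolding irreducible_roots_def by metis
qed

lemma ip_eq_0_if_supp:
  assumes g: "\<gamma> \<in> roots" and d: "\<delta> \<in> roots"
    and "\<And>\<alpha> \<beta>. \<alpha> \<in> supp \<gamma> \<Longrightarrow> \<beta> \<in> supp \<delta> \<Longrightarrow> ip \<alpha> \<beta> = 0"
  shows "ip \<gamma> \<delta> = 0"
proof -
  have "ip \<alpha> \<delta> = 0" if a: "\<alpha> \<in> supp \<gamma>" for \<alpha>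
  proof -
    have ar: "\<alpha> \<in> roots" using a supp_sub simple_root by blast
    have "ip \<beta> \<alpha> = 0" if b: "\<beta> \<in> supp \<delta>" for \<beta>
    proof -
      have "\<beta> \<in> roots" using b supp_sub simple_root by blast
      then show ?thesis using assms(3)[OF a b] ip_commute[of \<beta> \<alpha>] ar by simp
    qed
    then have "ip \<delta> \<alpha> = 0" unfolding ip_eq_sum_supp[OF d, of \<alpha>] by (simp add: sum.neutral)
    then show ?thesis using ip_commute[OF ar d] by simp
  qed
  then show ?thesis unfolding ip_eq_sum_supp[OF g, of \<delta>] by (simp add: sum.neutral)
qed

definition root_cone :: "('a \<Rightarrow> complex) set \<Rightarrow> ('a \<Rightarrow> complex) set"
  where "root_cone R = {\<mu>. \<exists>c :: ('a \<Rightarrow> complex) \<Rightarrow> nat.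
    \<mu> = (\<Sum>\<delta>\<in>R \<inter> pos_roots. fscale (of_nat (c \<delta>)) \<delta>)}"

lemma highest_root_iff: "highest_root R \<beta> \<longleftrightarrow> \<beta> \<in> R \<and> (\<forall>\<gamma>\<in>R. \<beta> - \<gamma> \<in> root_cone R)"
  by (simp add: highest_root_def root_cone_def)

lemma root_cone_0: "0 \<in> root_cone R"
  unfolding root_cone_def
  by (intro CollectI exI[of _ "\<lambda>_. 0"]) (simp add: fscale_def zero_fun_def[symmetric])

lemma root_cone_add:
  assumes "\<mu> \<in> root_cone R" "\<nu> \<in> root_cone R"
  shows "\<mu> + \<nu> \<in> root_cone R"
proof -
  obtain c d where "\<mu> = (\<Sum>\<delta>\<in>R \<inter> pos_roots. fscale (of_nat (c \<delta>)) \<delta>)"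
    "\<nu> = (\<Sum>\<delta>\<in>R \<inter> pos_roots. fscale (of_nat (d \<delta>)) \<delta>)"
    using assms by (auto simp: root_cone_def)
  then have "\<mu> + \<nu> = (\<Sum>\<delta>\<in>R \<inter> pos_roots. fscale (of_nat (c \<delta> + d \<delta>)) \<delta>)"
    by (simp add: sum.distrib forms.scale_left_distrib)
  then show ?thesis unfolding root_cone_def by (intro CollectI exI)
qed

lemma root_cone_base:
  assumes "\<gamma> \<in> R" "\<gamma> \<in> pos_roots"
  shows "\<gamma> \<in> root_cone R"
proof -
  have fin: "finite (R \<inter> pos_roots)"
    using finite_roots pos_root by (meson finite_subset inf_le2 subsetI order_trans)
  have "(\<Sum>\<delta>\<in>R \<inter> pos_roots. fscale (of_nat (if \<delta> = \<gamma> then 1 else 0)) \<delta>)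
      = (\<Sum>\<delta>\<in>R \<inter> pos_roots. if \<delta> = \<gamma> then \<gamma> else 0)"
    by (rule sum.cong) (auto simp: fscale_def fun_eq_iff)
  also have "\<dots> = \<gamma>" using fin assms by simp
  finally show ?thesis unfolding root_cone_def by (intro CollectI exI) (rule sym)
qed

lemma root_cone_cf:
  assumes "\<mu> \<in> root_cone R"
  shows "cf \<mu> \<alpha> \<ge> 0"
proof -
  have sc: "cf (fscale (of_nat n) \<delta>) \<alpha> = of_nat n * cf \<delta> \<alpha>" if "\<delta> \<in> pos_roots" for n \<delta>
    using forms.representation_scale[OF independent_simple_roots pos_root_span[OF that]]
    by (simp add: cf_def coeff_def)
  have "(\<Sum>\<delta>\<in>F. fscale (of_nat (c \<delta>)) \<delta>) \<in> forms.span simple_roots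
      \<and> cf (\<Sum>\<delta>\<in>F. fscale (of_nat (c \<delta>)) \<delta>) \<alpha> \<ge> 0" if "F \<subseteq> pos_roots" for F and c :: "_ \<Rightarrow> nat"
    using that
  proof (induction F rule: infinite_finite_induct)
    case (insert \<delta> F)
    have d: "fscale (of_nat (c \<delta>)) \<delta> \<in> forms.span simple_roots"
      using insert.prems pos_root_span by (intro forms.span_scale) auto
    have d2: "cf (fscale (of_nat (c \<delta>)) \<delta>) \<alpha> \<ge> 0"
      using insert.prems cf_nonneg sc by auto
    have eq: "(\<Sum>\<delta>\<in>insert \<delta> F. fscale (of_nat (c \<delta>)) \<delta>)
        = fscale (of_nat (c \<delta>)) \<delta> + (\<Sum>\<delta>\<in>F. fscale (of_nat (c \<delta>)) \<delta>)"
      by (rule sum.insert[OF insert.hyps])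
    have IH: "(\<Sum>\<delta>\<in>F. fscale (of_nat (c \<delta>)) \<delta>) \<in> forms.span simple_roots"
      "cf (\<Sum>\<delta>\<in>F. fscale (of_nat (c \<delta>)) \<delta>) \<alpha> \<ge> 0"
      using insert.IH insert.prems by auto
    show ?case
      unfolding eq cf_add[OF d IH(1)] using forms.span_add[OF d IH(1)] add_nonneg_nonneg[OF d2 IH(2)]
      by (rule conjI)
  qed (auto simp: forms.span_zero cf_def)
  then show ?thesis using assms by (auto simp: root_cone_def)
qed

text \<open>Comparison of \<beta> with \<open>- \<beta>\<close> puts twice \<beta> into the cone, so
  no coefficient is negative.\<close>

lemma highest_root_pos:
  assumes R: "standard_system R" and b: "highest_root R \<beta>"
  shows "\<beta> \<in> pos_roots"
proof -
  have bR: "\<beta> \<in> R" and br: "\<beta> \<in> roots"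
    using b standard_systemD(1)[OF R] by (auto simp: highest_root_iff)
  have "\<beta> - (- \<beta>) \<in> root_cone R"
    using b standard_systemD(3)[OF R bR] unfolding highest_root_iff by blast
  then have "cf (\<beta> - - \<beta>) \<alpha> \<ge> 0" for \<alpha> by (rule root_cone_cf)
  then have "cf \<beta> \<alpha> \<ge> 0" for \<alpha>
    by (simp only: cf_diff root_span br uminus_root cf_uminus) simp
  then show ?thesis by (rule pos_if_cf_nonneg[OF br])
qed

text \<open>A root \<open>\<beta> + \<gamma>\<close> would lie in \<open>R\<close>, and its
  comparison with \<beta> would put \<open>- \<gamma>\<close> into the cone.\<close>

lemma highest_root_add:
  assumes R: "standard_system R" and b: "highest_root R \<beta>" and g: "\<gamma> \<in> R" "\<gamma> \<in> pos_roots"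
  shows "\<beta> + \<gamma> \<notin> roots"
proof
  assume "\<beta> + \<gamma> \<in> roots"
  then have "\<beta> + \<gamma> \<in> R" using b g standard_systemD(4)[OF R] by (simp add: highest_root_iff)
  then have "\<beta> - (\<beta> + \<gamma>) \<in> root_cone R" using b unfolding highest_root_iff by blast
  then have 1: "cf (- \<gamma>) \<alpha> \<ge> 0" for \<alpha> using root_cone_cf by simp
  obtain \<alpha> where "cf \<gamma> \<alpha> > 0" using pos_cf_pos[OF g(2)] by blast
  then show False using 1[of \<alpha>] by (simp add: cf_uminus pos_root_span g(2))
qed

lemma highest_root_ip:
  assumes R: "standard_system R" and b: "highest_root R \<beta>" and g: "\<gamma> \<in> R" "\<gamma> \<in> pos_roots"
  shows "ip \<gamma> \<beta> \<ge> 0"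
proof (rule ccontr)
  assume "\<not> ?thesis"
  moreover have "\<beta> \<in> pos_roots" by (rule highest_root_pos[OF R b])
  ultimately have "\<beta> + \<gamma> \<in> roots"
    using g(2) by (intro add_root_if_ip_neg) (auto simp: pos_root ip_commute pos_ne_uminus)
  then show False using highest_root_add[OF assms] by blast
qed

text \<open>For a simple \<alpha> in \<open>R\<close> the difference
  \<open>\<beta> - \<alpha>\<close> has nonnegative coefficients, so that of \<alpha> in \<beta> is
  at least 1.\<close>

lemma highest_root_supp:
  assumes R: "standard_system R" and b: "highest_root R \<beta>"
  shows "supp \<beta> = R \<inter> simple_roots"
proof
  have bR: "\<beta> \<in> R" using b by (simp add: highest_root_iff)
  have bp: "\<beta> \<in> pos_roots" by (rule highest_root_pos[OF R b])
  show "supp \<beta> \<subseteq> R \<inter> simple_roots" using standard_system_supp[OF R bR] supp_sub by blast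
  show "R \<inter> simple_roots \<subseteq> supp \<beta>"
  proof
    fix \<alpha> assume a: "\<alpha> \<in> R \<inter> simple_roots"
    then have "\<beta> - \<alpha> \<in> root_cone R" using b unfolding highest_root_iff by blast
    then have "cf (\<beta> - \<alpha>) \<alpha> \<ge> 0" by (rule root_cone_cf)
    then have "cf \<beta> \<alpha> \<ge> 1" using a bp by (simp add: cf_diff cf_simple pos_root_span simple_pos)
    then show "\<alpha> \<in> supp \<beta>" using a by (simp add: supp_cf pos_root bp)
  qed
qed

lemma highest_root_unique:
  assumes R: "standard_system R" and b: "highest_root R \<beta>" "highest_root R \<beta>'"
  shows "\<beta> = \<beta>'"
proof -
  have bR: "\<beta> \<in> R" "\<beta>' \<in> R" using b by (simp_all add: highest_root_iff)
  then have r: "\<beta> \<in> roots" "\<beta>' \<in> roots" using standard_systemD(1)[OF R] by auto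
  have "\<beta> - \<beta>' \<in> root_cone R" "\<beta>' - \<beta> \<in> root_cone R" using b bR unfolding highest_root_iff by auto
  then have "cf (\<beta> - \<beta>') \<alpha> \<ge> 0" "cf (\<beta>' - \<beta>) \<alpha> \<ge> 0" for \<alpha> using root_cone_cf by auto
  then have "cf \<beta> \<alpha> = cf \<beta>' \<alpha>" for \<alpha>
    by (simp add: cf_diff root_span r antisym)
  then show ?thesis by (rule cf_eq_imp_eq[OF r])
qed

text \<open>By connectedness of supports, a splitting of the simple roots of \<open>R\<close> into
  orthogonal parts would split all roots of \<open>R\<close> accordingly.\<close>

lemma standard_system_simple_irreducible:
  assumes R: "standard_system R" and X: "X \<noteq> {}" "X \<subseteq> R \<inter> simple_roots"
    and orth: "\<And>\<alpha> \<beta>. \<alpha> \<in> X \<Longrightarrow> \<beta> \<in> R \<inter> simple_roots - X \<Longrightarrow> ip \<alpha> \<beta> = 0"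
  shows "X = R \<inter> simple_roots"
proof -
  let ?Y = "R \<inter> simple_roots - X"
  have split: "supp \<gamma> \<subseteq> X \<or> supp \<gamma> \<subseteq> ?Y" if g: "\<gamma> \<in> R" for \<gamma>
  proof -
    have r: "\<gamma> \<in> roots" using standard_systemD(1)[OF R] g by blast
    have s: "supp \<gamma> \<subseteq> X \<union> ?Y" using standard_system_supp[OF R g] supp_sub by blast
    have conn: "supp \<delta> \<subseteq> X \<or> supp \<delta> \<subseteq> ?Y" if "\<delta> \<in> pos_roots" "supp \<delta> \<subseteq> X \<union> ?Y" for \<delta>
      by (rule supp_connected[OF that]) (use orth in auto)
    show ?thesis
    proof (cases "\<gamma> \<in> pos_roots")
      case True
      then show ?thesis using conn s by blast
    next
      case False
      then have "- \<gamma> \<in> pos_roots" using pos_or_neg[OF r] by blast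
      then show ?thesis using conn[of "- \<gamma>"] s supp_uminus[OF r] by simp
    qed
  qed
  have nonempty: "supp \<gamma> \<noteq> {}" if "\<gamma> \<in> R" for \<gamma>
    using supp_nonempty standard_systemD(1)[OF R] that by blast
  have "R \<subseteq> {\<gamma>. supp \<gamma> \<subseteq> X} \<or> R \<subseteq> {\<gamma>. supp \<gamma> \<subseteq> ?Y}"
  proof (rule irreducible_rootsD[OF standard_systemD(2)[OF R]])
    show "R \<subseteq> {\<gamma>. supp \<gamma> \<subseteq> X} \<union> {\<gamma>. supp \<gamma> \<subseteq> ?Y}" using split by blast
    show "{\<gamma>. supp \<gamma> \<subseteq> X} \<inter> {\<gamma>. supp \<gamma> \<subseteq> ?Y} \<inter> R = {}" using nonempty by blast
  next
    fix \<gamma> \<delta> assume gd: "\<gamma> \<in> {\<gamma>. supp \<gamma> \<subseteq> X} \<inter> R" "\<delta> \<in> {\<gamma>. supp \<gamma> \<subseteq> ?Y} \<inter> R"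
    then have r: "\<gamma> \<in> roots" "\<delta> \<in> roots" using standard_systemD(1)[OF R] by auto
    have "ip \<gamma> \<delta> = 0" by (rule ip_eq_0_if_supp[OF r]) (use gd orth in auto)
    then show "root_form \<gamma> \<delta> = 0" using root_form_eq_0[OF r] by simp
  qed
  then show ?thesis
  proof
    assume *: "R \<subseteq> {\<gamma>. supp \<gamma> \<subseteq> X}"
    have "\<alpha> \<in> X" if "\<alpha> \<in> R \<inter> simple_roots" for \<alpha> using * that supp_simple[of \<alpha>] by auto
    then show ?thesis using X by blast
  next
    assume *: "R \<subseteq> {\<gamma>. supp \<gamma> \<subseteq> ?Y}"
    obtain \<alpha> where "\<alpha> \<in> X" using X by blast
    then show ?thesis using * X(2) supp_simple[of \<alpha>] by auto
  qed
qed

text \<open>Every positive root of \<open>R\<close> lies below a maximal one, so uniqueness of the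
  maximal ones suffices. These have nonnegative products with the positive roots, hence full
  support; two different ones would then have a positive product, so their difference would be a
  root and one of them would not be maximal.\<close>

lemma highest_root_exists:
  assumes R: "standard_system R"
  shows "\<exists>\<beta>. highest_root R \<beta>"
proof -
  define M where "M = {\<beta> \<in> R \<inter> pos_roots. \<forall>\<delta>\<in>R \<inter> pos_roots. \<beta> + \<delta> \<notin> roots}"
  have fin: "finite pos_roots" using finite_roots pos_root by (meson finite_subset subsetI)
  have Rr: "\<gamma> \<in> roots" if "\<gamma> \<in> R" for \<gamma> using standard_systemD(1)[OF R] that by blast
  \<comment> \<open>Adding positive roots must stop, because heights are bounded by their maximum
    over \<open>pos_roots\<close>.\<close>
  have below: "\<exists>\<beta>\<in>M. \<beta> - \<gamma> \<in> root_cone R" if "\<gamma> \<in> R \<inter> pos_roots" for \<gamma>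
    using that
  proof (induction "Max (ht ` pos_roots) - ht \<gamma>" arbitrary: \<gamma> rule: less_induct)
    case less
    show ?case
    proof (cases "\<gamma> \<in> M")
      case True
      have "\<gamma> - \<gamma> \<in> root_cone R" using root_cone_0 by simp
      then show ?thesis using True by blast
    next
      case False
      then obtain \<delta> where d: "\<delta> \<in> R \<inter> pos_roots" "\<gamma> + \<delta> \<in> roots" using less.prems unfolding M_def by blast
      then have gd: "\<gamma> + \<delta> \<in> R \<inter> pos_roots"
        using less.prems standard_systemD(4)[OF R] pos_add by blast
      have "ht (\<gamma> + \<delta>) = ht \<gamma> + ht \<delta>" using less.prems d(1) gd by (intro ht_add) auto
      moreover have "ht \<delta> > 0" using d(1) ht_pos by blast
      moreover have "ht (\<gamma> + \<delta>) \<le> Max (ht ` pos_roots)" using gd fin by (intro Max_ge) auto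
      ultimately have "Max (ht ` pos_roots) - ht (\<gamma> + \<delta>) < Max (ht ` pos_roots) - ht \<gamma>" by linarith
      then obtain \<beta> where b: "\<beta> \<in> M" "\<beta> - (\<gamma> + \<delta>) \<in> root_cone R" using less.hyps[OF _ gd] by blast
      have "(\<beta> - (\<gamma> + \<delta>)) + \<delta> \<in> root_cone R"
        using d(1) by (intro root_cone_add[OF b(2) root_cone_base]) auto
      moreover have "(\<beta> - (\<gamma> + \<delta>)) + \<delta> = \<beta> - \<gamma>" by simp
      ultimately show ?thesis using b(1) by metis
    qed
  qed
  have Mip: "ip \<beta> \<delta> \<ge> 0" if "\<beta> \<in> M" "\<delta> \<in> R \<inter> pos_roots" for \<beta> \<delta>
  proof (rule ccontr)
    assume "\<not> ?thesis"
    then have "\<beta> + \<delta> \<in> roots"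
      using that by (intro add_root_if_ip_neg) (auto simp: M_def Rr pos_ne_uminus)
    then show False using that by (auto simp: M_def)
  qed
  have Msupp: "supp \<beta> = R \<inter> simple_roots" if b: "\<beta> \<in> M" for \<beta>
  proof (rule standard_system_simple_irreducible[OF R])
    have bR: "\<beta> \<in> R" "\<beta> \<in> pos_roots" using b by (auto simp: M_def)
    show "supp \<beta> \<noteq> {}" using supp_nonempty Rr bR by blast
    show "supp \<beta> \<subseteq> R \<inter> simple_roots" using standard_system_supp[OF R bR(1)] supp_sub by blast
    fix \<alpha> \<alpha>' assume a: "\<alpha> \<in> supp \<beta>" "\<alpha>' \<in> R \<inter> simple_roots - supp \<beta>"
    have as: "\<alpha> \<in> simple_roots" "\<alpha>' \<in> simple_roots" using a supp_sub by auto
    \<comment> \<open>Each product of \<open>\<alpha>'\<close> with a root of the support is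
      nonpositive, while their weighted sum \<open>ip \<beta> \<alpha>'\<close> is nonnegative; so
      all of them vanish.\<close>
    have le: "cf \<beta> \<epsilon> * ip \<epsilon> \<alpha>' \<le> 0" if "\<epsilon> \<in> supp \<beta>" for \<epsilon>
      using that a as supp_sub cf_nonneg[OF bR(2), of \<epsilon>] simple_ip_nonpos[of \<epsilon> \<alpha>']
      by (intro mult_nonneg_nonpos) auto
    have "(\<Sum>\<epsilon>\<in>supp \<beta>. cf \<beta> \<epsilon> * ip \<epsilon> \<alpha>') \<ge> 0"
      using Mip[OF b, of \<alpha>'] a(2) as unfolding ip_eq_sum_supp[OF Rr[OF bR(1)], of \<alpha>'] by (simp add: simple_pos)
    moreover have "(\<Sum>\<epsilon>\<in>supp \<beta>. cf \<beta> \<epsilon> * ip \<epsilon> \<alpha>') \<le> 0" using le by (rule sum_nonpos)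
    ultimately have "(\<Sum>\<epsilon>\<in>supp \<beta>. - (cf \<beta> \<epsilon> * ip \<epsilon> \<alpha>')) = 0" by (simp add: sum_negf)
    then have "- (cf \<beta> \<alpha> * ip \<alpha> \<alpha>') = 0"
      using sum_nonneg_0[OF finite_supp _ _ a(1), of "\<lambda>\<epsilon>. - (cf \<beta> \<epsilon> * ip \<epsilon> \<alpha>')"] le by simp
    then show "ip \<alpha> \<alpha>' = 0" using a(1) supp_cf[OF Rr[OF bR(1)]] by auto
  qed
  have Muniq: "\<beta> = \<beta>'" if b: "\<beta> \<in> M" "\<beta>' \<in> M" for \<beta> \<beta>'
  proof (rule ccontr)
    assume ne: "\<beta> \<noteq> \<beta>'"
    have bR: "\<beta> \<in> R" "\<beta> \<in> pos_roots" "\<beta>' \<in> R" "\<beta>' \<in> pos_roots" using b by (auto simp: M_def)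
    have nn: "ip \<alpha> \<beta>' \<ge> 0" if "\<alpha> \<in> R \<inter> simple_roots" for \<alpha>
      using Mip[OF b(2), of \<alpha>] that ip_commute[of \<alpha> \<beta>'] bR Rr by (simp add: simple_pos)
    have "ip \<beta> \<beta>' \<noteq> 0"
    proof
      assume "ip \<beta> \<beta>' = 0"
      then have s0: "(\<Sum>\<alpha>\<in>supp \<beta>. cf \<beta> \<alpha> * ip \<alpha> \<beta>') = 0" using ip_eq_sum_supp[OF Rr[OF bR(1)]] by simp
      have "ip \<alpha> \<beta>' = 0" if a: "\<alpha> \<in> supp \<beta>" for \<alpha>
      proof -
        have "cf \<beta> \<alpha> * ip \<alpha> \<beta>' = 0"
          by (rule sum_nonneg_0[OF finite_supp _ s0 a])
            (use nn Msupp[OF b(1)] cf_nonneg[OF bR(2)] in auto)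
        then show ?thesis using a supp_cf[OF Rr[OF bR(1)]] by auto
      qed
      then have "ip \<beta>' \<beta>' = 0"
        unfolding ip_eq_sum_supp[OF Rr[OF bR(3)], of \<beta>'] Msupp[OF b(2)] Msupp[OF b(1)]
        by (simp add: sum.neutral)
      then show False using ip_self_pos[OF Rr[OF bR(3)]] by simp
    qed
    moreover have "ip \<beta> \<beta>' \<ge> 0" using Mip[OF b(1)] bR by simp
    ultimately have d: "\<beta> - \<beta>' \<in> roots" using ne bR Rr by (intro diff_root_if_ip_pos) auto
    then have "\<beta> + (- \<beta>') \<in> R" using standard_systemD(4)[OF R bR(1) standard_systemD(3)[OF R bR(3)]] by simp
    then have dR: "\<beta> - \<beta>' \<in> R" "- (\<beta> - \<beta>') \<in> R" using standard_systemD(3)[OF R] by fastforce+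
    from pos_or_neg[OF d] show False
    proof
      assume "\<beta> - \<beta>' \<in> pos_roots"
      then have "\<beta>' + (\<beta> - \<beta>') \<notin> roots" using b(2) dR(1) unfolding M_def by blast
      then show False using Rr[OF bR(1)] by simp
    next
      assume "- (\<beta> - \<beta>') \<in> pos_roots"
      then have "\<beta> + - (\<beta> - \<beta>') \<notin> roots" using b(1) dR(2) unfolding M_def by blast
      then show False using Rr[OF bR(3)] by simp
    qed
  qed
  obtain \<gamma> where g: "\<gamma> \<in> R" using standard_systemD(6)[OF R] by blast
  then have "\<exists>\<delta>. \<delta> \<in> R \<inter> pos_roots" using pos_or_neg[OF Rr[OF g]] standard_systemD(3)[OF R g] by blast
  then obtain \<beta> where b: "\<beta> \<in> M" using below by blast
  have bR: "\<beta> \<in> R" "\<beta> \<in> pos_roots" using b by (auto simp: M_def)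
  have "\<beta> - \<gamma> \<in> root_cone R" if gR: "\<gamma> \<in> R" for \<gamma>
  proof (cases "\<gamma> \<in> pos_roots")
    case True
    then obtain \<beta>' where "\<beta>' \<in> M" "\<beta>' - \<gamma> \<in> root_cone R"
      using below gR by blast
    then show ?thesis using Muniq[OF b] by simp
  next
    case False
    then have "- \<gamma> \<in> R" "- \<gamma> \<in> pos_roots"
      using pos_or_neg[OF Rr[OF gR]] standard_systemD(3)[OF R gR] by auto
    then have "\<beta> + - \<gamma> \<in> root_cone R"
      by (intro root_cone_add[OF root_cone_base[OF bR] root_cone_base])
    then show ?thesis by simp
  qed
  then show ?thesis using bR(1) unfolding highest_root_iff by blast
qed

text \<open>A positive root supported in \<open>R\<close> is built up by adding simple roots one at
  a time, and closedness keeps every stage in \<open>R\<close>. Consequently the system of a cascade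
  pair is determined by its highest root.\<close>

lemma standard_system_eq_supp_system:
  assumes R: "standard_system R" and b: "highest_root R \<beta>"
  shows "R = supp_system \<beta>"
proof -
  have supp: "supp \<beta> = R \<inter> simple_roots" by (rule highest_root_supp[OF R b])
  have pos: "\<gamma> \<in> R" if "\<gamma> \<in> pos_roots" "supp \<gamma> \<subseteq> R" for \<gamma>
    using that
  proof (induction "ht \<gamma>" arbitrary: \<gamma> rule: less_induct)
    case less
    show ?case
    proof (cases "\<gamma> \<in> simple_roots")
      case True
      then show ?thesis using less.prems supp_simple by simp
    next
      case False
      obtain \<alpha> where a: "\<alpha> \<in> simple_roots" "cf \<gamma> \<alpha> > 0" "\<gamma> - \<alpha> \<in> pos_roots" "ht (\<gamma> - \<alpha>) < ht \<gamma>"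
        using pos_descend[OF less.prems(1) False] .
      have "\<alpha> \<in> supp \<gamma>" using a by (simp add: supp_cf pos_root less.prems(1))
      then have aR: "\<alpha> \<in> R" using less.prems(2) by blast
      have "supp (\<gamma> - \<alpha>) \<subseteq> insert \<alpha> (supp \<gamma>)"
        using a less.prems(1)
        by (auto simp: supp_cf pos_root cf_diff pos_root_span simple_pos cf_simple split: if_splits)
      then have "\<gamma> - \<alpha> \<in> R" using less.hyps[OF a(4,3)] less.prems(2) aR by blast
      then have "\<gamma> - \<alpha> + \<alpha> \<in> R"
        using standard_systemD(4)[OF R _ aR, of "\<gamma> - \<alpha>"] pos_root[OF less.prems(1)] by simp
      then show ?thesis by simp
    qed
  qed
  show ?thesis
  proof
    show "R \<subseteq> supp_system \<beta>"
      using standard_systemD(1)[OF R] standard_system_supp[OF R] supp_sub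
      unfolding supp_system_def supp by blast
    show "supp_system \<beta> \<subseteq> R"
    proof
      fix \<gamma> assume "\<gamma> \<in> supp_system \<beta>"
      then have g: "\<gamma> \<in> roots" "supp \<gamma> \<subseteq> R" by (auto simp: supp_system_def supp)
      show "\<gamma> \<in> R"
      proof (cases "\<gamma> \<in> pos_roots")
        case True
        then show ?thesis using pos g by blast
      next
        case False
        then have "- \<gamma> \<in> pos_roots" using pos_or_neg[OF g(1)] by blast
        then have "- \<gamma> \<in> R" using pos[of "- \<gamma>"] g supp_uminus by simp
        then show ?thesis using standard_systemD(3)[OF R, of "- \<gamma>"] by simp
      qed
    qed
  qed
qed

text \<open>A positive \<open>ip \<gamma> \<beta>\<close> makes the difference a root. The
  difference is not orthogonal to \<beta> either, since otherwise
  \<open>\<beta> + (\<beta> - \<gamma>)\<close> would be a root. As both members of the pair have a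
  positive product with \<beta>, the integer \<open>n\<close> lies strictly between 0 and 2.\<close>

lemma highest_root_complement:
  assumes R: "standard_system R" and b: "highest_root R \<beta>"
    and g: "\<gamma> \<in> R" "\<gamma> \<in> pos_roots" "\<gamma> \<noteq> \<beta>" "ip \<gamma> \<beta> \<noteq> 0"
  shows "\<beta> - \<gamma> \<in> R" "\<beta> - \<gamma> \<in> pos_roots" "2 * ip \<gamma> \<beta> = ip \<beta> \<beta>"
proof -
  have bR: "\<beta> \<in> R" using b by (simp add: highest_root_iff)
  have bp: "\<beta> \<in> pos_roots" by (rule highest_root_pos[OF R b])
  have br: "\<beta> \<in> roots" "\<gamma> \<in> roots" using bp g by (auto simp: pos_root)
  have gpos: "ip \<gamma> \<beta> > 0" using highest_root_ip[OF R b g(1,2)] g(4) by simp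
  then have d: "\<beta> - \<gamma> \<in> roots"
    using g br by (intro diff_root_if_ip_pos) (auto simp: ip_commute)
  then show dR: "\<beta> - \<gamma> \<in> R"
    using standard_systemD(4)[OF R bR standard_systemD(3)[OF R g(1)]] by simp
  have "\<beta> - \<gamma> \<in> root_cone R" using b g(1) unfolding highest_root_iff by blast
  then show dp: "\<beta> - \<gamma> \<in> pos_roots" using root_cone_cf d by (intro pos_if_cf_nonneg) auto
  have "ip (\<beta> - \<gamma>) \<beta> \<noteq> 0"
  proof
    assume 0: "ip (\<beta> - \<gamma>) \<beta> = 0"
    have "\<beta> - (\<beta> - \<gamma>) \<in> roots" using br by simp
    moreover have "ip \<beta> (- (\<beta> - \<gamma>)) = 0"
      using 0 ip_commute[OF br(1) d] by (simp only: ip_uminus_right[OF br(1) d] neg_equal_0_iff_equal)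
    ultimately have "\<beta> - (- (\<beta> - \<gamma>)) \<in> roots"
      using diff_root_if_orthogonal[OF br(1) uminus_root[OF d]] by simp
    then have "\<beta> + (\<beta> - \<gamma>) \<in> roots" by simp
    then show False using highest_root_add[OF R b dR dp] by blast
  qed
  then have dpos: "ip (\<beta> - \<gamma>) \<beta> > 0" using highest_root_ip[OF R b dR dp] by simp
  obtain n :: int where n: "2 * ip \<gamma> \<beta> = of_int n * ip \<beta> \<beta>" using ip_integral[OF br(2,1)] .
  have bb: "ip \<beta> \<beta> > 0" using ip_self_pos[OF br(1)] .
  have "of_int n * ip \<beta> \<beta> > 0" using n gpos by linarith
  then have "n > 0" using bb by (simp add: zero_less_mult_iff)
  moreover have "of_int n * ip \<beta> \<beta> < 2 * ip \<beta> \<beta>" using n dpos by (simp add: ip_diff)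
  then have "of_int n < (2 :: real)" using bb mult_less_cancel_right_pos by blast
  then have "n < 2" by simp
  ultimately have "n = 1" by simp
  then show "2 * ip \<gamma> \<beta> = ip \<beta> \<beta>" using n by simp
qed


subsection \<open>The Kostant cascade\<close>

text \<open>A decomposition of the root system into orthogonal parts \<open>A\<close> and \<open>B\<close> makes the span of the root
  spaces and dual vectors of \<open>A\<close> a proper ideal.\<close>

lemma irreducible_roots_roots: "irreducible_roots roots"
proof -
  have False if AB: "A \<noteq> {}" "B \<noteq> {}" "A \<union> B = roots" "A \<inter> B = {}"
    and orth: "\<forall>\<gamma>\<in>A. \<forall>\<delta>\<in>B. root_form \<gamma> \<delta> = 0" for A B
  proof -
    have r: "\<gamma> \<in> roots" if "\<gamma> \<in> A \<or> \<gamma> \<in> B" for \<gamma> using that AB by blast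
    have ip0: "ip \<gamma> \<delta> = 0" "ip \<delta> \<gamma> = 0" if "\<gamma> \<in> A" "\<delta> \<in> B" for \<gamma> \<delta>
      using that orth root_form_eq_0[of \<gamma> \<delta>] ip_commute[of \<gamma> \<delta>] r by auto
    \<comment> \<open>In each case the sum would be orthogonal to one of its summands, against
      positivity.\<close>
    have cross: "\<gamma> + \<delta> \<notin> weights" if gd: "\<gamma> \<in> A" "\<delta> \<in> B" for \<gamma> \<delta>
    proof
      assume "\<gamma> + \<delta> \<in> weights"
      then consider "\<gamma> + \<delta> = 0" | "\<gamma> + \<delta> \<in> A" | "\<gamma> + \<delta> \<in> B" using AB(3) by blast
      then show False
      proof cases
        case 1
        then have "ip (\<gamma> + \<delta>) \<gamma> = 0" by simp
        then show False using ip0[OF gd] ip_self_pos[of \<gamma>] r gd by (simp add: ip_add)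
      next
        case 2
        then have "ip (\<gamma> + \<delta>) \<delta> = 0" using ip0 gd by blast
        then show False using ip0[OF gd] ip_self_pos[of \<delta>] r gd by (simp add: ip_add)
      next
        case 3
        then have "ip (\<gamma> + \<delta>) \<gamma> = 0" using ip0 gd by blast
        then show False using ip0[OF gd] ip_self_pos[of \<gamma>] r gd by (simp add: ip_add)
      qed
    qed
    have uA: "- \<gamma> \<in> A" if g: "\<gamma> \<in> A" for \<gamma>
    proof (rule ccontr)
      assume "- \<gamma> \<notin> A"
      then have "- \<gamma> \<in> B" using AB(3) r[of \<gamma>] g uminus_root by blast
      then show False using cross[OF g, of "- \<gamma>"] by simp
    qed
    have br0: "bracket x y = 0"
      if "x \<in> root_space \<gamma>" "y \<in> root_space \<delta>" "\<gamma> \<in> roots" "\<delta> \<in> roots" "\<gamma> + \<delta> \<notin> weights" for x y \<gamma> \<delta>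
      using weight_mem[OF dual_space_plus[OF root_dual root_dual] bracket_root_space] that by blast
    define S where "S = (\<Union>\<gamma>\<in>A. root_space \<gamma>) \<union> dual_vector ` A"
    define I where "I = span S"
    have sI: "subspace I" by (simp add: I_def)
    have gen: "root_space \<gamma> \<subseteq> I" "dual_vector \<gamma> \<in> I" if "\<gamma> \<in> A" for \<gamma>
      using that by (auto simp: I_def S_def intro: span_base)
    have AA: "bracket a b \<in> I" if a: "a \<in> root_space \<epsilon>" and b: "b \<in> root_space \<gamma>"
      and e: "\<epsilon> \<in> A" and g: "\<gamma> \<in> A" for a b \<epsilon> \<gamma>
    proof -
      consider "\<epsilon> + \<gamma> = 0" | "\<epsilon> + \<gamma> \<in> A" | "\<epsilon> + \<gamma> \<in> B" | "\<epsilon> + \<gamma> \<notin> weights" using AB(3) by blast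
      then show ?thesis
      proof cases
        case 1
        then have "\<gamma> = - \<epsilon>" by (simp add: eq_neg_iff_add_eq_0 add.commute)
        then have "bracket a b = killing a b *s dual_vector \<epsilon>"
          using a b r e by (intro bracket_opposite) auto
        then show ?thesis using gen(2)[OF e] sI by (simp add: subspace_scale)
      next
        case 2
        then show ?thesis using gen(1) bracket_root_space[OF a b] by blast
      next
        case 3
        \<comment> \<open>The sum of \<open>- \<epsilon>\<close> from \<open>A\<close> and
          \<open>\<epsilon> + \<gamma>\<close> from \<open>B\<close> is the root \<gamma>, contrary
          to \<open>cross\<close>.\<close>
        then have "- \<epsilon> + (\<epsilon> + \<gamma>) \<notin> weights" by (rule cross[OF uA[OF e]])
        then show ?thesis using r g by simp
      next
        case 4
        then show ?thesis using br0[OF a b] r e g subspace_0[OF sI] by simp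
      qed
    qed
    have BA: "bracket a b = 0" if a: "a \<in> root_space \<epsilon>" and e: "\<epsilon> \<in> B" and b: "b \<in> S" for a b \<epsilon>
    proof -
      consider \<gamma> where "\<gamma> \<in> A" "b \<in> root_space \<gamma>" | \<gamma> where "\<gamma> \<in> A" "b = dual_vector \<gamma>"
        using b by (auto simp: S_def)
      then show ?thesis
      proof cases
        case 1
        then show ?thesis
          using br0[OF a 1(2)] cross[OF 1(1) e] r e by (simp add: add.commute)
      next
        case 2
        have "bracket a b = - (\<epsilon> b *s a)"
          using root_spaceD[OF a] dual_vector(1)[of \<gamma>] r 2 bracket_anticommute[of a b] by simp
        moreover have "\<epsilon> b = 0"
          using 2 e r orth root_form_eval[of \<epsilon> \<gamma>] root_form_commute[of \<epsilon> \<gamma>] by auto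
        ultimately show ?thesis by simp
      qed
    qed
    have "bracket x y \<in> I" if y: "y \<in> I" for x y
    proof (rule bracket_span_subset[of x "t \<union> (\<Union>\<gamma>\<in>roots. root_space \<gamma>)" y S, OF _ _ sI])
      show "x \<in> span (t \<union> (\<Union>\<gamma>\<in>roots. root_space \<gamma>))" using span_t_roots by simp
      show "y \<in> span S" using y by (simp add: I_def)
      fix a b assume a: "a \<in> t \<union> (\<Union>\<gamma>\<in>roots. root_space \<gamma>)" and b: "b \<in> S"
      consider "a \<in> t" | \<epsilon> where "\<epsilon> \<in> A" "a \<in> root_space \<epsilon>" | \<epsilon> where "\<epsilon> \<in> B" "a \<in> root_space \<epsilon>"
        using a AB(3) by blast
      then show "bracket a b \<in> I"
      proof cases
        case 1
        consider \<gamma> where "\<gamma> \<in> A" "b \<in> root_space \<gamma>" | \<gamma> where "\<gamma> \<in> A" "b = dual_vector \<gamma>"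
          using b by (auto simp: S_def)
        then show ?thesis
        proof cases
          case g: 1
          have "bracket a b = \<gamma> a *s b" by (rule root_spaceD[OF g(2) 1])
          then show ?thesis using g gen(1)[OF g(1)] sI by (auto simp: subspace_scale)
        next
          case g: 2
          then have "bracket a b = 0" using 1 r dual_vector(1) t_abelian by blast
          then show ?thesis using subspace_0[OF sI] by simp
        qed
      next
        case e: 2
        consider \<gamma> where "\<gamma> \<in> A" "b \<in> root_space \<gamma>" | \<gamma> where "\<gamma> \<in> A" "b = dual_vector \<gamma>"
          using b by (auto simp: S_def)
        then show ?thesis
        proof cases
          case g: 1
          then show ?thesis using AA e by blast
        next
          case g: 2
          have "bracket a b = - (\<epsilon> b *s a)"
            using root_spaceD[OF e(2)] dual_vector(1)[of \<gamma>] r g bracket_anticommute[of a b] by simp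
          then show ?thesis using e gen(1)[OF e(1)] sI by (auto simp: subspace_neg subspace_scale)
        qed
      next
        case 3
        then show ?thesis using BA b subspace_0[OF sI] by simp
      qed
    qed
    then have "I = {0} \<or> I = UNIV" using sI by (intro simple_ideal) (simp add: ideal_of_def)
    then show False
    proof
      assume I0: "I = {0}"
      obtain \<gamma> where g: "\<gamma> \<in> A" using AB(1) by blast
      then show False using gen(1)[OF g] root_vector_exists[of \<gamma>] r I0 by blast
    next
      assume IU: "I = UNIV"
      obtain \<delta> where d: "\<delta> \<in> B" using AB(2) by blast
      then obtain y where y: "y \<in> root_space \<delta>" "y \<noteq> 0" using root_vector_exists r by blast
      have dr: "\<delta> \<in> roots" using r d by blast
      \<comment> \<open>Root vectors for \<delta> commute with all of \<open>S\<close>. If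
        \<open>I\<close> were everything, they would commute with
        \<open>dual_vector \<delta>\<close>, which acts on them by the norm of \<delta>.\<close>
      have "bracket y (dual_vector \<delta>) \<in> {0}"
      proof (rule bracket_span_subset[of y "{y}" "dual_vector \<delta>" S])
        show "dual_vector \<delta> \<in> span S" using IU by (simp add: I_def)
      qed (use y d BA in \<open>auto intro: span_base\<close>)
      then have "\<delta> (dual_vector \<delta>) *s y = 0"
        using root_spaceD[OF y(1) dual_vector(1)[OF dr]] bracket_anticommute[of y "dual_vector \<delta>"] by simp
      then show False using y(2) root_norm_nonzero[OF dr] by simp
    qed
  qed
  then show ?thesis using roots_nonempty unfolding irreducible_roots_def by blast
qed

lemma standard_system_roots: "standard_system roots"
  using irreducible_roots_roots supp_sub simple_root by (auto simp: standard_system_def)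

text \<open>The component consists of what can be reached from \<gamma> in the graph of
  nonorthogonality. In an orthogonal splitting, the part containing \<gamma> absorbs everything
  reachable.\<close>

lemma irreducible_component_exists:
  assumes P: "P \<subseteq> roots" and g: "\<gamma> \<in> P"
  shows "\<exists>C. irreducible_component C P \<and> \<gamma> \<in> C"
proof -
  define E where "E = {(x, y). x \<in> P \<and> y \<in> P \<and> root_form x y \<noteq> 0}"
  define C where "C = {\<delta>. (\<gamma>, \<delta>) \<in> E\<^sup>*}"
  have CP: "\<delta> \<in> P" if "\<delta> \<in> C" for \<delta>
    using that g unfolding C_def mem_Collect_eq by (induction rule: rtrancl_induct) (auto simp: E_def)
  have gC: "\<gamma> \<in> C" by (simp add: C_def)
  have one: "C \<subseteq> A" if A: "\<gamma> \<in> A" "C \<subseteq> A \<union> B" and orth: "\<And>x y. x \<in> A \<Longrightarrow> y \<in> B \<Longrightarrow> root_form x y = 0" for A B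
  proof
    fix \<delta> assume "\<delta> \<in> C"
    then have "(\<gamma>, \<delta>) \<in> E\<^sup>*" by (simp add: C_def)
    then show "\<delta> \<in> A"
    proof (induction rule: rtrancl_induct)
      case (step x y)
      then have "y \<in> C" by (auto simp: C_def)
      then show ?case using step.IH step.hyps(2) orth[of x y] A(2) by (auto simp: E_def)
    qed (rule A(1))
  qed
  have "irreducible_roots C"
    unfolding irreducible_roots_def
  proof (intro conjI notI)
    show False if "C = {}" using that gC by blast
  next
    assume "\<exists>A B. A \<noteq> {} \<and> B \<noteq> {} \<and> A \<union> B = C \<and> A \<inter> B = {} \<and> (\<forall>\<gamma>\<in>A. \<forall>\<delta>\<in>B. root_form \<gamma> \<delta> = 0)"
    then obtain A B where AB: "A \<noteq> {}" "B \<noteq> {}" "A \<union> B = C" "A \<inter> B = {}"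
      "\<forall>\<gamma>\<in>A. \<forall>\<delta>\<in>B. root_form \<gamma> \<delta> = 0" by blast
    consider "\<gamma> \<in> A" | "\<gamma> \<in> B" using gC AB(3) by blast
    then show False
    proof cases
      case 1
      have "C \<subseteq> A" by (rule one[OF 1, of B]) (use AB in auto)
      then show False using AB by blast
    next
      case 2
      have "root_form x y = 0" if "x \<in> B" "y \<in> A" for x y
        using AB(5) that root_form_commute by metis
      then have "C \<subseteq> B" using AB(3) by (intro one[OF 2, of A]) auto
      then show False using AB by blast
    qed
  qed
  moreover have "root_form x y = 0" if "x \<in> C" "y \<in> P - C" for x y
  proof (rule ccontr)
    assume "root_form x y \<noteq> 0"
    then have "(x, y) \<in> E" using that CP by (auto simp: E_def)
    then have "y \<in> C" using that by (auto simp: C_def intro: rtrancl_into_rtrancl)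
    then show False using that by blast
  qed
  ultimately have "irreducible_component C P" using CP unfolding irreducible_component_def by blast
  then show ?thesis using gC by blast
qed

text \<open>If a positive root of \<open>R\<close> is orthogonal to \<beta>, so are the simple roots
  in its support, because these have nonnegative products with the highest root. Supports therefore
  stay in the orthogonal system and, being connected, in one component.\<close>

lemma standard_system_component:
  assumes R: "standard_system R" and b: "highest_root R \<beta>"
    and C: "irreducible_component C {\<gamma> \<in> R. root_form \<gamma> \<beta> = 0}"
  shows "standard_system C"
proof -
  let ?P = "{\<gamma> \<in> R. root_form \<gamma> \<beta> = 0}"
  have br: "\<beta> \<in> roots" using b standard_systemD(1)[OF R] by (auto simp: highest_root_iff)
  have Rr: "\<gamma> \<in> roots" if "\<gamma> \<in> R" for \<gamma> using that standard_systemD(1)[OF R] by blast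
  have P: "\<gamma> \<in> ?P \<longleftrightarrow> \<gamma> \<in> R \<and> ip \<gamma> \<beta> = 0" for \<gamma> using Rr br root_form_eq_0 by blast
  have CP: "C \<subseteq> ?P" and irr: "irreducible_roots C"
    and orth: "\<And>\<gamma> \<delta>. \<gamma> \<in> C \<Longrightarrow> \<delta> \<in> ?P \<Longrightarrow> \<delta> \<notin> C \<Longrightarrow> ip \<gamma> \<delta> = 0"
    using C Rr root_form_eq_0 unfolding irreducible_component_def by blast+
  have Cr: "\<gamma> \<in> roots" if "\<gamma> \<in> C" for \<gamma> using that CP Rr by blast
  have suppP: "supp \<gamma> \<subseteq> ?P" if g: "\<gamma> \<in> C" "\<gamma> \<in> pos_roots" for \<gamma>
  proof
    fix \<alpha> assume a: "\<alpha> \<in> supp \<gamma>"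
    have gR: "\<gamma> \<in> R" "ip \<gamma> \<beta> = 0" using g CP P by auto
    have nn: "cf \<gamma> \<epsilon> * ip \<epsilon> \<beta> \<ge> 0" if "\<epsilon> \<in> supp \<gamma>" for \<epsilon>
    proof (rule mult_nonneg_nonneg[OF cf_nonneg[OF g(2)]])
      have "\<epsilon> \<in> simple_roots" "\<epsilon> \<in> R" using that standard_system_supp[OF R gR(1)] supp_sub by auto
      then show "ip \<epsilon> \<beta> \<ge> 0" using highest_root_ip[OF R b] simple_pos by blast
    qed
    have "cf \<gamma> \<alpha> * ip \<alpha> \<beta> = 0"
      by (rule sum_nonneg_0[OF finite_supp nn _ a])
        (use gR(2) ip_eq_sum_supp[OF Rr[OF gR(1)], of \<beta>] in auto)
    then have "ip \<alpha> \<beta> = 0" using a supp_cf[OF Rr[OF gR(1)]] by auto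
    then show "\<alpha> \<in> ?P" using P a standard_system_supp[OF R gR(1)] by blast
  qed
  have "- \<gamma> \<in> C" if g: "\<gamma> \<in> C" for \<gamma>
  proof (rule ccontr)
    assume n: "- \<gamma> \<notin> C"
    have "- \<gamma> \<in> ?P" using g CP P standard_systemD(3)[OF R] by (auto simp: ip_uminus)
    then have "ip \<gamma> (- \<gamma>) = 0" using orth[OF g] n by blast
    then show False using ip_self_pos[OF Cr[OF g]] by (simp add: ip_uminus_right Cr g)
  qed
  moreover have "\<gamma> + \<delta> \<in> C" if gd: "\<gamma> \<in> C" "\<delta> \<in> C" and s: "\<gamma> + \<delta> \<in> roots" for \<gamma> \<delta>
  proof (rule ccontr)
    assume n: "\<gamma> + \<delta> \<notin> C"
    have "\<gamma> + \<delta> \<in> R" using gd CP standard_systemD(4)[OF R _ _ s] by blast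
    moreover have "ip \<gamma> \<beta> = 0" "ip \<delta> \<beta> = 0" using gd CP P by blast+
    then have "ip (\<gamma> + \<delta>) \<beta> = 0" by (simp add: ip_add)
    ultimately have "\<gamma> + \<delta> \<in> ?P" using P by blast
    then have "ip \<gamma> (\<gamma> + \<delta>) = 0" "ip \<delta> (\<gamma> + \<delta>) = 0" using orth gd n by blast+
    then have "ip (\<gamma> + \<delta>) (\<gamma> + \<delta>) = 0" by (simp only: ip_add)
    then show False using ip_self_pos[OF s] by simp
  qed
  moreover have "supp \<gamma> \<subseteq> C" if g: "\<gamma> \<in> C" "\<gamma> \<in> pos_roots" for \<gamma>
  proof -
    have "supp \<gamma> \<subseteq> C \<or> supp \<gamma> \<subseteq> ?P - C"
      by (rule supp_connected[OF g(2)]) (use suppP[OF g] orth in auto)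
    moreover have False if s: "supp \<gamma> \<subseteq> ?P - C"
    proof -
      have "ip \<alpha> \<gamma> = 0" if "\<alpha> \<in> supp \<gamma>" for \<alpha>
      proof -
        have "\<alpha> \<in> roots" using that supp_sub simple_root by blast
        moreover have "ip \<gamma> \<alpha> = 0" using orth[OF g(1), of \<alpha>] s that by blast
        ultimately show ?thesis using ip_commute Cr[OF g(1)] by simp
      qed
      then have "ip \<gamma> \<gamma> = 0" unfolding ip_eq_sum_supp[OF Cr[OF g(1)], of \<gamma>] by (simp add: sum.neutral)
      then show False using ip_self_pos[OF Cr[OF g(1)]] by simp
    qed
    ultimately show ?thesis by blast
  qed
  ultimately show ?thesis unfolding standard_system_def using Cr irr by blast
qed

lemma cascade_pair_standard:
  "cascade_pair R \<beta> \<Longrightarrow> standard_system R \<and> highest_root R \<beta>"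
  by (induction rule: cascade_pair.induct) (use standard_system_roots standard_system_component in auto)

section \<open>Relative position of the systems in the cascade\<close>

definition nested_pair :: "('a \<Rightarrow> complex) set \<Rightarrow> ('a \<Rightarrow> complex) \<Rightarrow> ('a \<Rightarrow> complex) set \<Rightarrow> bool"
  where "nested_pair R \<beta> R' \<longleftrightarrow> R' \<subseteq> {\<gamma> \<in> R. root_form \<gamma> \<beta> = 0}"

definition orthogonal_systems :: "('a \<Rightarrow> complex) set \<Rightarrow> ('a \<Rightarrow> complex) set \<Rightarrow> bool"
  where "orthogonal_systems R R' \<longleftrightarrow> (\<forall>\<gamma>\<in>R. \<forall>\<delta>\<in>R'. root_form \<gamma> \<delta> = 0)"

definition comparable_pairs where
  "comparable_pairs R \<beta> R' \<beta>' \<longleftrightarrow> (R = R' \<and> \<beta> = \<beta>') \<or> nested_pair R \<beta> R' \<or> nested_pair R' \<beta>' R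
    \<or> orthogonal_systems R R'"

lemma root_form_self: "\<gamma> \<in> roots \<Longrightarrow> root_form \<gamma> \<gamma> \<noteq> 0"
  using ip_self_pos[of \<gamma>] root_form_eq_0[of \<gamma> \<gamma>] by simp

lemma component_cases:
  assumes C: "irreducible_component C P" and R: "irreducible_roots R" "R \<subseteq> P"
  shows "R \<subseteq> C \<or> orthogonal_systems C R \<and> R \<inter> C = {}"
proof -
  have "R \<subseteq> C \<or> R \<subseteq> P - C"
    by (rule irreducible_rootsD[OF R(1)]) (use R(2) C in \<open>auto simp: irreducible_component_def\<close>)
  then show ?thesis
    using C unfolding irreducible_component_def orthogonal_systems_def by blast
qed

text \<open>Induction along both descents. The position of \<open>C\<close> relative to the parent
  \<open>R''\<close> passes on to the component \<open>C'\<close>, except when \<open>C\<close> is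
  nested below \<open>R''\<close>. In that case \<open>C\<close> is orthogonal to \<open>C'\<close>
  or contained in it, and for containment the position of the parent \<open>R\<close> of
  \<open>C\<close> relative to \<open>C'\<close> decides.\<close>

lemma cascade_pairs_comparable:
  assumes "cascade_pair R \<beta>" "cascade_pair R' \<beta>'"
  shows "comparable_pairs R \<beta> R' \<beta>'"
  using assms
proof (induction arbitrary: R' \<beta>' rule: cascade_pair.induct)
  case (top \<theta>)
  have \<theta>: "\<theta> \<in> roots" using top by (simp add: highest_root_iff)
  from top(2) show ?case
  proof (induction rule: cascade_pair.induct)
    case (top \<theta>')
    then show ?case
      using highest_root_unique[OF standard_system_roots] \<open>highest_root roots \<theta>\<close>
      by (auto simp: comparable_pairs_def)
  next
    case (descendant R \<beta> C \<beta>')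
    have bR: "\<beta> \<in> R" "\<beta> \<in> roots"
      using cascade_pair_standard[OF descendant.hyps(1)] standard_systemD(1)[of R] by (auto simp: highest_root_iff)
    have C: "C \<subseteq> {\<gamma> \<in> R. root_form \<gamma> \<beta> = 0}" using descendant.hyps(2) by (simp add: irreducible_component_def)
    from descendant.IH have "R = roots \<and> \<theta> = \<beta> \<or> nested_pair roots \<theta> R"
      using bR root_form_self[OF bR(2)]
      by (auto simp: comparable_pairs_def nested_pair_def orthogonal_systems_def)
    then have "nested_pair roots \<theta> C" using C unfolding nested_pair_def by blast
    then show ?case by (simp add: comparable_pairs_def)
  qed
next
  case (descendant R \<beta> C \<beta>\<^sub>1)
  have R: "standard_system R" "highest_root R \<beta>" using cascade_pair_standard[OF descendant.hyps(1)] by auto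
  have bR: "\<beta> \<in> R" "\<beta> \<in> roots" using R standard_systemD(1)[of R] by (auto simp: highest_root_iff)
  have Cs: "standard_system C" by (rule standard_system_component[OF R descendant.hyps(2)])
  have C: "C \<subseteq> {\<gamma> \<in> R. root_form \<gamma> \<beta> = 0}" using descendant.hyps(2) by (simp add: irreducible_component_def)
  \<comment> \<open>A root of \<open>C\<close>; it excludes that \<open>C\<close> is disjoint from,
    or orthogonal to, a system containing it.\<close>
  obtain \<gamma>\<^sub>0 where g0: "\<gamma>\<^sub>0 \<in> C" "\<gamma>\<^sub>0 \<in> roots"
    using standard_systemD(1,6)[OF Cs] by blast
  from descendant.prems show ?case
  proof (induction rule: cascade_pair.induct)
    case (top \<theta>)
    have "cascade_pair roots \<theta>" by (rule cascade_pair.top[OF top])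
    then have "comparable_pairs R \<beta> roots \<theta>" by (rule descendant.IH)
    then have "R = roots \<and> \<beta> = \<theta> \<or> nested_pair roots \<theta> R"
      using bR root_form_self[OF bR(2)]
      by (auto simp: comparable_pairs_def nested_pair_def orthogonal_systems_def)
    then have "nested_pair roots \<theta> C" using C unfolding nested_pair_def by blast
    then show ?case by (simp add: comparable_pairs_def)
  next
    case inner: (descendant R'' \<beta>'' C' \<beta>\<^sub>2)
    have R'': "standard_system R''" "highest_root R'' \<beta>''" using cascade_pair_standard[OF inner.hyps(1)] by auto
    have C's: "standard_system C'" by (rule standard_system_component[OF R'' inner.hyps(2)])
    have C': "C' \<subseteq> {\<gamma> \<in> R''. root_form \<gamma> \<beta>'' = 0}" using inner.hyps(2) by (simp add: irreducible_component_def)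
    have pair': "cascade_pair C' \<beta>\<^sub>2" by (rule cascade_pair.descendant[OF inner.hyps(1,2,3)])
    consider "C = R''" "\<beta>\<^sub>1 = \<beta>''" | "nested_pair C \<beta>\<^sub>1 R''" | "orthogonal_systems C R''"
      | "nested_pair R'' \<beta>'' C"
      using inner.IH unfolding comparable_pairs_def by blast
    then show ?case
    proof cases
      case 1
      then have "nested_pair C \<beta>\<^sub>1 C'" using C' by (simp add: nested_pair_def)
      then show ?thesis by (simp add: comparable_pairs_def)
    next
      case 2
      then have "nested_pair C \<beta>\<^sub>1 C'" using C' unfolding nested_pair_def by blast
      then show ?thesis by (simp add: comparable_pairs_def)
    next
      case 3
      then have "orthogonal_systems C C'" using C' unfolding orthogonal_systems_def by blast
      then show ?thesis by (simp add: comparable_pairs_def)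
    next
      case 4
      then have "C \<subseteq> C' \<or> orthogonal_systems C' C"
        using component_cases[OF inner.hyps(2) standard_systemD(2)[OF Cs]] unfolding nested_pair_def by blast
      then show ?thesis
      proof
        assume "orthogonal_systems C' C"
        then have "orthogonal_systems C C'"
          using root_form_commute unfolding orthogonal_systems_def by metis
        then show ?thesis by (simp add: comparable_pairs_def)
      next
        assume CC': "C \<subseteq> C'"
        consider "R = C'" "\<beta> = \<beta>\<^sub>2" | "nested_pair R \<beta> C'" | "nested_pair C' \<beta>\<^sub>2 R" | "orthogonal_systems R C'"
          using descendant.IH[OF pair'] unfolding comparable_pairs_def by blast
        then show ?thesis
        proof cases
          case 1
          then have "nested_pair C' \<beta>\<^sub>2 C" using C by (simp add: nested_pair_def)
          then show ?thesis by (simp add: comparable_pairs_def)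
        next
          case 2
          then have "C' \<subseteq> C \<or> C' \<inter> C = {}"
            using component_cases[OF descendant.hyps(2) standard_systemD(2)[OF C's]] unfolding nested_pair_def by blast
          then have "C = C'" using CC' g0(1) by blast
          moreover have "\<beta>\<^sub>1 = \<beta>\<^sub>2"
            using highest_root_unique[OF Cs descendant.hyps(3)] inner.hyps(3) calculation by simp
          ultimately show ?thesis by (simp add: comparable_pairs_def)
        next
          case 3
          then have "nested_pair C' \<beta>\<^sub>2 C" using C unfolding nested_pair_def by blast
          then show ?thesis by (simp add: comparable_pairs_def)
        next
          case 4
          then have "root_form \<gamma>\<^sub>0 \<gamma>\<^sub>0 = 0" using g0 C CC' unfolding orthogonal_systems_def by blast
          then show ?thesis using root_form_self[OF g0(2)] by simp
        qed
      qed
    qed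
  qed
qed

text \<open>The existential quantifier over systems in \<open>cascade\<close> is resolved: the
  system belonging to \<beta> is the one on its support.\<close>

lemma cascade_system:
  assumes "\<beta> \<in> cascade"
  shows "cascade_pair (supp_system \<beta>) \<beta>" "standard_system (supp_system \<beta>)" "highest_root (supp_system \<beta>) \<beta>"
proof -
  obtain R where R: "cascade_pair R \<beta>" using assms by (auto simp: cascade_def)
  have s: "standard_system R" "highest_root R \<beta>" using cascade_pair_standard[OF R] by auto
  have "R = supp_system \<beta>" by (rule standard_system_eq_supp_system[OF s])
  then show "cascade_pair (supp_system \<beta>) \<beta>" "standard_system (supp_system \<beta>)" "highest_root (supp_system \<beta>) \<beta>"
    using R s by auto
qed

lemma cascade_pos: "\<beta> \<in> cascade \<Longrightarrow> \<beta> \<in> pos_roots"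
  using highest_root_pos cascade_system by blast

lemma cascade_mem: "\<beta> \<in> cascade \<Longrightarrow> \<beta> \<in> supp_system \<beta>"
  using cascade_pos pos_root by (simp add: supp_system_def)

lemma supp_system_root: "\<gamma> \<in> supp_system \<beta> \<Longrightarrow> \<gamma> \<in> roots"
  by (simp add: supp_system_def)

section \<open>Heisenberg sets and sums of their roots\<close>

lemma heisenberg_rootD:
  assumes "\<beta> \<in> cascade" "\<gamma> \<in> heisenberg_roots \<beta>"
  shows "\<gamma> \<in> supp_system \<beta>" "\<gamma> \<in> pos_roots" "\<gamma> \<in> roots" "ip \<gamma> \<beta> \<noteq> 0"
  using assms root_form_eq_0[of \<gamma> \<beta>] cascade_pos by (auto simp: heisenberg_roots_def pos_root)

lemma heisenberg_rootI:
  assumes "\<beta> \<in> cascade" "\<gamma> \<in> supp_system \<beta>" "\<gamma> \<in> pos_roots" "ip \<gamma> \<beta> \<noteq> 0"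
  shows "\<gamma> \<in> heisenberg_roots \<beta>"
  using assms root_form_eq_0[of \<gamma> \<beta>] cascade_pos by (auto simp: heisenberg_roots_def pos_root)

lemma cascade_mem_heisenberg: "\<beta> \<in> cascade \<Longrightarrow> \<beta> \<in> heisenberg_roots \<beta>"
  using cascade_mem cascade_pos pos_root ip_self_pos[of \<beta>] by (intro heisenberg_rootI) auto

lemma heisenberg_complement:
  assumes b: "\<beta> \<in> cascade" and g: "\<gamma> \<in> heisenberg_roots \<beta>" "\<gamma> \<noteq> \<beta>"
  shows "\<beta> - \<gamma> \<in> heisenberg_roots \<beta>"
proof -
  note gD = heisenberg_rootD[OF b g(1)]
  note c = highest_root_complement[OF cascade_system(2,3)[OF b] gD(1,2) g(2) gD(4)]
  have "ip (\<beta> - \<gamma>) \<beta> \<noteq> 0" using c(3) gD(4) by (simp add: ip_diff)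
  then show ?thesis using c b by (intro heisenberg_rootI)
qed

text \<open>The grading by the coroot of \<beta>: degree 2 for \<beta> itself and degree 1 for the
  other members of its Heisenberg set.\<close>

lemma heisenberg_ip:
  assumes b: "\<beta> \<in> cascade" and g: "\<gamma> \<in> heisenberg_roots \<beta>"
  shows "2 * ip \<gamma> \<beta> \<ge> ip \<beta> \<beta>" "2 * ip \<gamma> \<beta> = 2 * ip \<beta> \<beta> \<longleftrightarrow> \<gamma> = \<beta>"
proof -
  note gD = heisenberg_rootD[OF b g(1)]
  have bb: "ip \<beta> \<beta> > 0" using b cascade_pos pos_root ip_self_pos by blast
  have "\<gamma> = \<beta> \<or> 2 * ip \<gamma> \<beta> = ip \<beta> \<beta>"
    using highest_root_complement(3)[OF cascade_system(2,3)[OF b] gD(1,2) _ gD(4)] by blast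
  then show "2 * ip \<gamma> \<beta> \<ge> ip \<beta> \<beta>" "2 * ip \<gamma> \<beta> = 2 * ip \<beta> \<beta> \<longleftrightarrow> \<gamma> = \<beta>"
    using bb by auto
qed

lemma heisenberg_closed:
  assumes b: "\<beta> \<in> cascade" and g: "\<gamma> \<in> supp_system \<beta>" "\<gamma> \<in> pos_roots"
    and d: "\<delta> \<in> supp_system \<beta>" "\<delta> \<in> pos_roots" and s: "\<gamma> + \<delta> \<in> roots"
  shows "\<gamma> + \<delta> \<in> supp_system \<beta>" "\<gamma> + \<delta> \<in> pos_roots"
  using standard_systemD(4)[OF cascade_system(2)[OF b] g(1) d(1) s] pos_add[OF g(2) d(2) s] by auto

text \<open>The degrees with respect to \<beta> add up to at least 2, and among the positive roots
  of the system only \<beta> has such a degree.\<close>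

lemma heisenberg_add:
  assumes b: "\<beta> \<in> cascade" and g: "\<gamma> \<in> heisenberg_roots \<beta>" and d: "\<delta> \<in> heisenberg_roots \<beta>"
    and s: "\<gamma> + \<delta> \<in> roots"
  shows "\<gamma> + \<delta> = \<beta>"
proof (rule ccontr)
  assume ne: "\<gamma> + \<delta> \<noteq> \<beta>"
  note gD = heisenberg_rootD[OF b g] and dD = heisenberg_rootD[OF b d]
  note c = heisenberg_closed[OF b gD(1,2) dD(1,2) s]
  have bb: "ip \<beta> \<beta> > 0" using b cascade_pos pos_root ip_self_pos by blast
  have ge: "2 * ip (\<gamma> + \<delta>) \<beta> \<ge> 2 * ip \<beta> \<beta>"
    using heisenberg_ip(1)[OF b g] heisenberg_ip(1)[OF b d] by (simp add: ip_add)
  then have "ip (\<gamma> + \<delta>) \<beta> \<noteq> 0" using bb by auto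
  then have "2 * ip (\<gamma> + \<delta>) \<beta> = ip \<beta> \<beta>"
    by (rule highest_root_complement(3)[OF cascade_system(2,3)[OF b] c ne])
  then show False using ge bb by simp
qed

text \<open>Descent from the whole root system: either \<gamma> is not orthogonal to the highest
  root, or it lies in a component of the orthogonal roots, which is smaller since it misses that
  highest root.\<close>

lemma heisenberg_exhausts:
  assumes g: "\<gamma> \<in> pos_roots"
  shows "\<exists>\<beta>\<in>cascade. \<gamma> \<in> heisenberg_roots \<beta>"
proof -
  have step: "\<exists>\<beta>'\<in>cascade. \<gamma> \<in> heisenberg_roots \<beta>'" if "cascade_pair R \<beta>" "\<gamma> \<in> R" for R \<beta>
    using that
  proof (induction "card R" arbitrary: R \<beta> rule: less_induct)
    case less
    have R: "standard_system R" "highest_root R \<beta>" using cascade_pair_standard[OF less.prems(1)] by auto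
    have b: "\<beta> \<in> cascade" using less.prems(1) by (auto simp: cascade_def)
    have Rs: "R = supp_system \<beta>" by (rule standard_system_eq_supp_system[OF R])
    have finR: "finite R" using standard_systemD(1)[OF R(1)] finite_roots by (rule finite_subset)
    show ?case
    proof (cases "root_form \<gamma> \<beta> = 0")
      case False
      then have "\<gamma> \<in> heisenberg_roots \<beta>" using less.prems(2) g Rs by (simp add: heisenberg_roots_def)
      then show ?thesis using b by blast
    next
      case True
      let ?P = "{\<gamma> \<in> R. root_form \<gamma> \<beta> = 0}"
      have "?P \<subseteq> roots" "\<gamma> \<in> ?P" using standard_systemD(1)[OF R(1)] less.prems(2) True by auto
      then obtain C where C: "irreducible_component C ?P" "\<gamma> \<in> C"
        using irreducible_component_exists by blast
      obtain \<beta>' where b': "highest_root C \<beta>'"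
        using highest_root_exists[OF standard_system_component[OF R C(1)]] by blast
      have pair: "cascade_pair C \<beta>'" by (rule cascade_pair.descendant[OF less.prems(1) C(1) b'])
      have "C \<subseteq> ?P" using C(1) by (simp add: irreducible_component_def)
      moreover have "\<beta> \<in> R" "root_form \<beta> \<beta> \<noteq> 0"
        using R(2) standard_systemD(1)[OF R(1)] root_form_self by (auto simp: highest_root_iff)
      ultimately have "C \<subset> R" by blast
      then have "card C < card R" using finR by (rule psubset_card_mono[rotated])
      then show ?thesis using less.hyps pair C(2) by blast
    qed
  qed
  obtain \<theta> where "highest_root roots \<theta>" using highest_root_exists[OF standard_system_roots] by blast
  then show ?thesis using step[OF cascade_pair.top] pos_root[OF g] by blast
qed

lemma cascade_cases:
  assumes b: "\<beta> \<in> cascade" and b': "\<beta>' \<in> cascade" and ne: "\<beta> \<noteq> \<beta>'"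
  obtains "nested_pair (supp_system \<beta>) \<beta> (supp_system \<beta>')"
    | "nested_pair (supp_system \<beta>') \<beta>' (supp_system \<beta>)"
    | "orthogonal_systems (supp_system \<beta>) (supp_system \<beta>')"
  using cascade_pairs_comparable[OF cascade_system(1)[OF b] cascade_system(1)[OF b']] ne that
  unfolding comparable_pairs_def by blast

lemma heisenberg_disjoint:
  assumes b: "\<beta> \<in> cascade" and b': "\<beta>' \<in> cascade" and ne: "\<beta> \<noteq> \<beta>'"
  shows "heisenberg_roots \<beta> \<inter> heisenberg_roots \<beta>' = {}"
proof (rule ccontr)
  assume "\<not> ?thesis"
  then obtain \<gamma> where g: "\<gamma> \<in> supp_system \<beta>" "\<gamma> \<in> supp_system \<beta>'"
    "root_form \<gamma> \<beta> \<noteq> 0" "root_form \<gamma> \<beta>' \<noteq> 0"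
    by (auto simp: heisenberg_roots_def)
  have "\<gamma> \<in> roots" by (rule supp_system_root[OF g(1)])
  with b b' ne show False
    by (cases rule: cascade_cases)
      (use g root_form_self in \<open>auto simp: nested_pair_def orthogonal_systems_def\<close>)
qed

text \<open>With orthogonal summands, \<open>\<gamma> - \<delta>\<close> would be a root as well;
  the supports are disjoint, so its coefficients would have both signs.\<close>

lemma orthogonal_sum_not_root:
  assumes b: "\<beta> \<in> cascade" and b': "\<beta>' \<in> cascade"
    and orth: "orthogonal_systems (supp_system \<beta>) (supp_system \<beta>')"
    and g: "\<gamma> \<in> supp_system \<beta>" "\<gamma> \<in> pos_roots" and d: "\<delta> \<in> supp_system \<beta>'" "\<delta> \<in> pos_roots"
  shows "\<gamma> + \<delta> \<notin> roots"
proof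
  assume s: "\<gamma> + \<delta> \<in> roots"
  have r: "\<gamma> \<in> roots" "\<delta> \<in> roots" using g d by (auto simp: pos_root)
  have "ip \<gamma> \<delta> = 0" using orth g d r root_form_eq_0 unfolding orthogonal_systems_def by blast
  then have m: "\<gamma> - \<delta> \<in> roots" using diff_root_if_orthogonal r s by blast
  have "supp \<gamma> \<inter> supp \<delta> = {}"
  proof (rule ccontr)
    assume "supp \<gamma> \<inter> supp \<delta> \<noteq> {}"
    then obtain \<alpha> where a: "\<alpha> \<in> supp \<gamma>" "\<alpha> \<in> supp \<delta>" by blast
    then have "\<alpha> \<in> supp_system \<beta>" "\<alpha> \<in> supp_system \<beta>'"
      using standard_system_supp[OF cascade_system(2)] b b' g d by blast+
    then show False using orth root_form_self[of \<alpha>] supp_system_root unfolding orthogonal_systems_def by blast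
  qed
  then have disj: "cf \<gamma> \<alpha> = 0 \<or> cf \<delta> \<alpha> = 0" for \<alpha>
    using supp_cf[OF r(1)] supp_cf[OF r(2)] cf_nonsimple[of \<alpha>] by (cases "\<alpha> \<in> simple_roots") auto
  obtain \<alpha> where a: "cf \<gamma> \<alpha> > 0" using pos_cf_pos[OF g(2)] by blast
  have "cf (\<gamma> - \<delta>) \<alpha> > 0" using a disj[of \<alpha>] r by (simp add: cf_diff root_span)
  then have mp: "\<gamma> - \<delta> \<in> pos_roots" by (rule pos_if_cf_pos[OF m])
  obtain \<alpha>' where a': "cf \<delta> \<alpha>' > 0" using pos_cf_pos[OF d(2)] by blast
  have "cf (\<gamma> - \<delta>) \<alpha>' < 0" using a' disj[of \<alpha>'] r by (simp add: cf_diff root_span)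
  then show False using cf_nonneg[OF mp, of \<alpha>'] by simp
qed

text \<open>The size condition excludes that \<open>\<beta>'\<close> lies above \<beta>, and on
  orthogonal branches there are no sums. So \<delta> is orthogonal to \<beta>, and adding it keeps
  the degree with respect to \<beta>; a sum equal to \<beta> would force
  \<open>\<gamma> = \<beta>\<close>.\<close>

lemma heisenberg_add_other:
  assumes b: "\<beta> \<in> cascade" and b': "\<beta>' \<in> cascade" and ne: "\<beta> \<noteq> \<beta>'"
    and card: "card (supp_system \<beta>') \<le> card (supp_system \<beta>)"
    and g: "\<gamma> \<in> heisenberg_roots \<beta>" and d: "\<delta> \<in> heisenberg_roots \<beta>'" and s: "\<gamma> + \<delta> \<in> roots"
  shows "\<gamma> + \<delta> \<in> heisenberg_roots \<beta>" "\<gamma> + \<delta> \<noteq> \<beta>"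
proof -
  note gD = heisenberg_rootD[OF b g] and dD = heisenberg_rootD[OF b' d]
  have "nested_pair (supp_system \<beta>) \<beta> (supp_system \<beta>')"
    using b b' ne
  proof (cases rule: cascade_cases)
    case 2
    have "root_form \<beta>' \<beta>' \<noteq> 0" using root_form_self pos_root cascade_pos b' by blast
    then have "supp_system \<beta> \<subset> supp_system \<beta>'"
      using 2 cascade_mem[OF b'] by (auto simp: nested_pair_def)
    moreover have "finite (supp_system \<beta>')"
      using supp_system_root finite_roots by (meson finite_subset subsetI)
    ultimately show ?thesis using card psubset_card_mono[of "supp_system \<beta>'" "supp_system \<beta>"] by simp
  next
    case 3
    then show ?thesis using orthogonal_sum_not_root[OF b b' 3 gD(1,2) dD(1,2)] s by blast
  qed
  then have d': "\<delta> \<in> supp_system \<beta>" "ip \<delta> \<beta> = 0"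
    using dD(1,3) root_form_eq_0 cascade_pos[OF b] pos_root unfolding nested_pair_def by blast+
  note c = heisenberg_closed[OF b gD(1,2) d'(1) dD(2) s]
  have eq: "ip (\<gamma> + \<delta>) \<beta> = ip \<gamma> \<beta>" using d'(2) by (simp add: ip_add)
  then show "\<gamma> + \<delta> \<in> heisenberg_roots \<beta>" using c gD(4) b by (intro heisenberg_rootI) auto
  show "\<gamma> + \<delta> \<noteq> \<beta>"
  proof
    assume s: "\<gamma> + \<delta> = \<beta>"
    then have "\<gamma> = \<beta>" using heisenberg_ip(2)[OF b g] eq by simp
    then show False using s dD(3) root_ne_0 by auto
  qed
qed

text \<open>If the two cascade elements differed, the sum would lie in the Heisenberg set of the one
  with the larger system without being that element, whereas a cascade element lies in its own
  Heisenberg set only.\<close>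

lemma heisenberg_add_cascade:
  assumes b: "\<beta> \<in> cascade" and b': "\<beta>' \<in> cascade"
    and g: "\<gamma> \<in> heisenberg_roots \<beta>" and d: "\<delta> \<in> heisenberg_roots \<beta>'" and s: "\<gamma> + \<delta> \<in> cascade"
  shows "\<gamma> + \<delta> = \<beta>"
proof -
  have r: "\<gamma> + \<delta> \<in> roots" using s cascade_pos pos_root by blast
  have False if ne: "\<beta> \<noteq> \<beta>'" and le: "card (supp_system \<beta>') \<le> card (supp_system \<beta>)"
    and b: "\<beta> \<in> cascade" and b': "\<beta>' \<in> cascade"
    and g: "\<gamma> \<in> heisenberg_roots \<beta>" and d: "\<delta> \<in> heisenberg_roots \<beta>'"
    and s: "\<gamma> + \<delta> \<in> cascade" "\<gamma> + \<delta> \<in> roots" for \<beta> \<beta>' \<gamma> \<delta>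
    using heisenberg_add_other[OF b b' ne le g d s(2)] heisenberg_disjoint[OF b s(1)]
      cascade_mem_heisenberg[OF s(1)] by blast
  from this[of \<beta> \<beta>' \<gamma> \<delta>] this[of \<beta>' \<beta> \<delta> \<gamma>] have "\<beta> = \<beta>'"
    using b b' g d s r by (metis add.commute linear)
  then show ?thesis using heisenberg_add[OF b g _ r] d by simp
qed


subsection \<open>Sums of root spaces\<close>

text \<open>Root spaces are lines, so one chosen vector per root spans each of them, and sums of
  root spaces are handled through sets of roots.\<close>

definition root_vec :: "('a \<Rightarrow> complex) \<Rightarrow> 'a"
  where "root_vec \<gamma> = (SOME x. x \<in> root_space \<gamma> \<and> x \<noteq> 0)"

lemma root_vec: "\<gamma> \<in> roots \<Longrightarrow> root_vec \<gamma> \<in> root_space \<gamma>" "\<gamma> \<in> roots \<Longrightarrow> root_vec \<gamma> \<noteq> 0"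
  unfolding root_vec_def using someI_ex[of "\<lambda>x. x \<in> root_space \<gamma> \<and> x \<noteq> 0"] root_vector_exists by blast+

lemma root_space_eq_span: "\<gamma> \<in> roots \<Longrightarrow> root_space \<gamma> = span {root_vec \<gamma>}"
proof
  assume g: "\<gamma> \<in> roots"
  show "span {root_vec \<gamma>} \<subseteq> root_space \<gamma>"
    by (rule span_minimal) (use root_vec(1)[OF g] subspace_root_space in auto)
  show "root_space \<gamma> \<subseteq> span {root_vec \<gamma>}"
    using root_space_proportional[OF g root_vec[OF g]] span_scale[OF span_base[of "root_vec \<gamma>" "{root_vec \<gamma>}"]]
    by auto
qed

lemma root_vec_sum_eq_0:
  assumes "S \<subseteq> roots" "(\<Sum>\<gamma>\<in>S. c \<gamma> *s root_vec \<gamma>) = 0" "\<gamma> \<in> S"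
  shows "c \<gamma> = 0"
proof -
  have "finite S" "S \<subseteq> dual_space t"
    using assms(1) finite_roots finite_subset root_dual by blast+
  then have "c \<gamma> *s root_vec \<gamma> = 0"
    by (rule weight_vectors_independent[OF _ _ _ assms(2,3)])
      (use assms(1) root_vec in \<open>auto intro!: subspace_scale subspace_root_space\<close>)
  then show ?thesis using assms root_vec(2) by auto
qed

lemma inj_on_root_vec: "S \<subseteq> roots \<Longrightarrow> inj_on root_vec S"
proof (rule inj_onI, rule ccontr)
  fix a b assume S: "S \<subseteq> roots" and ab: "a \<in> S" "b \<in> S" "root_vec a = root_vec b" "a \<noteq> b"
  have "(\<Sum>\<gamma>\<in>{a, b}. (if \<gamma> = a then 1 else - 1) *s root_vec \<gamma>) = 0" using ab by simp
  then have "(if a = a then 1 else - 1 :: complex) = 0"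
    by (rule root_vec_sum_eq_0[rotated, of "\<lambda>\<gamma>. if \<gamma> = a then 1 else - 1"]) (use ab S in auto)
  then show False by simp
qed

lemma independent_root_vec:
  assumes "S \<subseteq> roots"
  shows "independent (root_vec ` S)"
proof (rule independent_if_scalars_zero)
  show "finite (root_vec ` S)" using assms finite_roots finite_subset by blast
  fix c x assume "(\<Sum>x\<in>root_vec ` S. c x *s x) = 0" "x \<in> root_vec ` S"
  then show "c x = 0"
    using root_vec_sum_eq_0[OF assms, of "\<lambda>s. c (root_vec s)"] inj_on_root_vec[OF assms]
    by (auto simp: sum.reindex)
qed

definition root_sum :: "('a \<Rightarrow> complex) set \<Rightarrow> 'a set"
  where "root_sum S = span (root_vec ` S)"

lemma subspace_root_sum: "subspace (root_sum S)"
  by (simp add: root_sum_def)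

lemma root_sum_mono: "S \<subseteq> T \<Longrightarrow> root_sum S \<subseteq> root_sum T"
  unfolding root_sum_def by (intro span_mono image_mono)

lemma root_sum_eq: "S \<subseteq> roots \<Longrightarrow> span (\<Union>\<gamma>\<in>S. root_space \<gamma>) = root_sum S"
proof -
  assume S: "S \<subseteq> roots"
  have "root_space \<gamma> \<subseteq> root_sum S" if "\<gamma> \<in> S" for \<gamma>
  proof -
    have "root_space \<gamma> = span {root_vec \<gamma>}" using that S by (intro root_space_eq_span) auto
    then show ?thesis using that unfolding root_sum_def by (simp only:) (rule span_mono, blast)
  qed
  moreover have "root_vec ` S \<subseteq> span (\<Union>\<gamma>\<in>S. root_space \<gamma>)"
    using S root_vec(1) by (auto intro!: span_base)
  ultimately show ?thesis
    unfolding root_sum_def by (auto simp: span_eq)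
qed

lemma root_vec_mem: "\<gamma> \<in> S \<Longrightarrow> root_vec \<gamma> \<in> root_sum S"
  by (simp add: root_sum_def span_base)

lemma dim_root_sum: "S \<subseteq> roots \<Longrightarrow> dim (root_sum S) = card S"
  unfolding root_sum_def
  using dim_span_eq_card_independent[OF independent_root_vec] card_image[OF inj_on_root_vec] by metis

lemma root_vec_mem_iff:
  assumes "S \<subseteq> roots" "\<gamma> \<in> roots"
  shows "root_vec \<gamma> \<in> root_sum S \<longleftrightarrow> \<gamma> \<in> S"
proof
  assume m: "root_vec \<gamma> \<in> root_sum S"
  show "\<gamma> \<in> S"
  proof (rule ccontr)
    assume n: "\<gamma> \<notin> S"
    have i: "inj_on root_vec (insert \<gamma> S)" using assms by (intro inj_on_root_vec) auto
    then have "root_vec \<gamma> \<notin> root_vec ` S" using n by auto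
    then have "root_vec ` insert \<gamma> S - {root_vec \<gamma>} = root_vec ` S" by auto
    moreover have "independent (root_vec ` insert \<gamma> S)" using assms by (intro independent_root_vec) auto
    ultimately show False using m unfolding root_sum_def dependent_def by auto
  qed
qed (rule root_vec_mem)

lemma root_sum_inter:
  assumes "S \<subseteq> roots" "T \<subseteq> roots" "S \<inter> T = {}"
  shows "root_sum S \<inter> root_sum T = {0}"
proof -
  have fin: "finite S" "finite T" using assms finite_roots finite_subset by blast+
  have "x = 0" if x: "x \<in> root_sum S" "x \<in> root_sum T" for x
  proof -
    have ex: "\<exists>c. x = (\<Sum>\<gamma>\<in>S. c \<gamma> *s root_vec \<gamma>)" if "x \<in> root_sum S" "finite S" "S \<subseteq> roots" for S
    proof -
      obtain c where "x = (\<Sum>v\<in>root_vec ` S. c v *s v)"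
        using \<open>x \<in> root_sum S\<close> \<open>finite S\<close> by (auto simp: root_sum_def span_finite)
      then have "x = (\<Sum>\<gamma>\<in>S. c (root_vec \<gamma>) *s root_vec \<gamma>)"
        using inj_on_root_vec[OF \<open>S \<subseteq> roots\<close>] by (simp add: sum.reindex)
      then show ?thesis by (rule exI[where x = "\<lambda>\<gamma>. c (root_vec \<gamma>)"])
    qed
    obtain c where c: "x = (\<Sum>\<gamma>\<in>S. c \<gamma> *s root_vec \<gamma>)" using ex[OF x(1) fin(1) assms(1)] by metis
    obtain d where d: "x = (\<Sum>\<gamma>\<in>T. d \<gamma> *s root_vec \<gamma>)" using ex[OF x(2) fin(2) assms(2)] by metis
    let ?e = "\<lambda>\<gamma>. if \<gamma> \<in> S then c \<gamma> else - d \<gamma>"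
    have "(\<Sum>\<gamma>\<in>S. ?e \<gamma> *s root_vec \<gamma>) = x" unfolding c by (rule sum.cong) auto
    moreover have "(\<Sum>\<gamma>\<in>T. ?e \<gamma> *s root_vec \<gamma>) = (\<Sum>\<gamma>\<in>T. - (d \<gamma> *s root_vec \<gamma>))"
      by (rule sum.cong) (use assms(3) in auto)
    then have "(\<Sum>\<gamma>\<in>T. ?e \<gamma> *s root_vec \<gamma>) = - x" by (simp add: sum_negf d)
    ultimately have "(\<Sum>\<gamma>\<in>S \<union> T. ?e \<gamma> *s root_vec \<gamma>) = 0"
      by (simp only: sum.union_disjoint[OF fin assms(3)]) simp
    then have "?e \<gamma> = 0" if "\<gamma> \<in> S \<union> T" for \<gamma>
      by (rule root_vec_sum_eq_0[rotated, OF _ that]) (use assms in auto)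
    then have "c \<gamma> = 0" if "\<gamma> \<in> S" for \<gamma> using that by force
    then show "x = 0" using c by (simp add: sum.neutral)
  qed
  then show ?thesis using subspace_0[OF subspace_root_sum] by blast
qed

lemma pos_sum_weight: "\<gamma> \<in> pos_roots \<Longrightarrow> \<delta> \<in> pos_roots \<Longrightarrow> \<gamma> + \<delta> \<in> weights \<longleftrightarrow> \<gamma> + \<delta> \<in> roots"
  using pos_ne_uminus by auto

lemma bracket_root_spaces_eq_0:
  assumes "\<gamma> \<in> roots" "\<delta> \<in> roots" "\<gamma> + \<delta> \<notin> weights" "x \<in> root_space \<gamma>" "y \<in> root_space \<delta>"
  shows "bracket x y = 0"
  using weight_mem[OF dual_space_plus[OF root_dual root_dual] bracket_root_space] assms by blast

lemma bracket_root_vec: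
  assumes "\<gamma> \<in> roots" "\<delta> \<in> roots" "\<gamma> + \<delta> \<in> roots"
  obtains k where "k \<noteq> 0" "bracket (root_vec \<gamma>) (root_vec \<delta>) = k *s root_vec (\<gamma> + \<delta>)"
proof -
  have "bracket (root_vec \<gamma>) (root_vec \<delta>) \<noteq> 0"
    using bracket_root_vectors_nonzero[OF assms root_vec[OF assms(1)] root_vec[OF assms(2)]] .
  moreover obtain k where "bracket (root_vec \<gamma>) (root_vec \<delta>) = k *s root_vec (\<gamma> + \<delta>)"
    using root_space_proportional[OF assms(3) root_vec[OF assms(3)]]
      bracket_root_space[OF root_vec(1)[OF assms(1)] root_vec(1)[OF assms(2)]] by blast
  ultimately show ?thesis using that[of k] by auto
qed

lemma bracket_root_vec_mem:
  assumes "\<gamma> \<in> pos_roots" "\<delta> \<in> pos_roots" "\<gamma> + \<delta> \<in> roots \<Longrightarrow> \<gamma> + \<delta> \<in> Q"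
  shows "bracket (root_vec \<gamma>) (root_vec \<delta>) \<in> root_sum Q"
proof (cases "\<gamma> + \<delta> \<in> roots")
  case True
  then obtain k where "bracket (root_vec \<gamma>) (root_vec \<delta>) = k *s root_vec (\<gamma> + \<delta>)"
    using bracket_root_vec pos_root assms(1,2) by metis
  then show ?thesis
    using root_vec_mem[OF assms(3)[OF True]] subspace_scale[OF subspace_root_sum] by simp
next
  case False
  then have "\<gamma> + \<delta> \<notin> weights" using pos_sum_weight[OF assms(1,2)] by blast
  then have "bracket (root_vec \<gamma>) (root_vec \<delta>) = 0"
    using bracket_root_spaces_eq_0 assms(1,2) pos_root root_vec(1) by blast
  then show ?thesis using subspace_0[OF subspace_root_sum] by simp
qed

lemma bracket_root_sum:
  assumes "x \<in> root_sum S" "y \<in> root_sum T" "S \<subseteq> pos_roots" "T \<subseteq> pos_roots"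
    and "\<And>\<gamma> \<delta>. \<gamma> \<in> S \<Longrightarrow> \<delta> \<in> T \<Longrightarrow> \<gamma> + \<delta> \<in> roots \<Longrightarrow> \<gamma> + \<delta> \<in> Q"
  shows "bracket x y \<in> root_sum Q"
proof (rule bracket_span_subset[of x "root_vec ` S" y "root_vec ` T"])
  fix a b assume "a \<in> root_vec ` S" "b \<in> root_vec ` T"
  then show "bracket a b \<in> root_sum Q" using assms(3-) bracket_root_vec_mem by blast
qed (use assms(1,2) subspace_root_sum in \<open>auto simp: root_sum_def\<close>)


subsection \<open>Nilradicals of standard parabolic subalgebras\<close>

lemma u_root_sum: "u = root_sum pos_roots"
proof -
  have "pos_roots \<subseteq> roots" using pos_root by blast
  from u_eq root_sum_eq[OF this] show ?thesis by (rule trans)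
qed

lemma borel_subset:
  assumes "borel \<subseteq> p"
  shows "t \<subseteq> p" "u \<subseteq> p"
proof -
  have su: "subspace u"
    by (subst u_root_sum) (rule subspace_root_sum)
  have "0 + h \<in> borel" if "h \<in> t" for h
    using that subspace_0[OF su] unfolding borel_def by blast
  then show "t \<subseteq> p" using assms by auto
  have "x + 0 \<in> borel" if "x \<in> u" for x
    using that subspace_0[OF subspace_t] unfolding borel_def by blast
  then show "u \<subseteq> p" using assms by auto
qed

lemma root_space_subset_if_mem:
  assumes "\<gamma> \<in> roots" "x \<in> root_space \<gamma>" "x \<noteq> 0" "x \<in> V" "subspace V"
  shows "root_space \<gamma> \<subseteq> V"
  using root_space_proportional[OF assms(1-3)] subspace_scale[OF assms(5,4)] by blast

lemma root_vec_mem_roots_in: "\<gamma> \<in> roots \<Longrightarrow> subspace V \<Longrightarrow> root_vec \<gamma> \<in> V \<longleftrightarrow> \<gamma> \<in> roots_in V"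
  using root_vec[of \<gamma>] root_space_subset_if_mem[of \<gamma> "root_vec \<gamma>" V] unfolding roots_in_def by blast

lemma pos_root_space_u: "\<gamma> \<in> pos_roots \<Longrightarrow> root_space \<gamma> \<subseteq> u"
  by (simp add: pos_roots_def roots_in_def)

text \<open>Meant for a parabolic subalgebra and for its nilradical, which are thus spanned by their
  weight vectors.\<close>

lemma t_stable_component_mem:
  assumes "subspace V" "\<And>h x. h \<in> t \<Longrightarrow> x \<in> V \<Longrightarrow> bracket h x \<in> V" "x \<in> V"
  obtains v where "\<And>\<gamma>. \<gamma> \<in> weights \<Longrightarrow> v \<gamma> \<in> root_space \<gamma> \<and> v \<gamma> \<in> V" "x = (\<Sum>\<gamma>\<in>weights. v \<gamma>)"
proof -
  obtain v where v: "\<forall>\<gamma>\<in>weights. v \<gamma> \<in> root_space \<gamma>" "x = (\<Sum>\<gamma>\<in>weights. v \<gamma>)"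
    using weight_decomposition[of x] by blast
  have "v \<gamma> \<in> V" if "\<gamma> \<in> weights" for \<gamma>
    by (rule weight_vector_component[OF finite_weights weights_dual assms(1,2) _ _ that])
      (use v assms(3) in blast)+
  then show ?thesis using that v by blast
qed

text \<open>Brackets add heights, and positive roots have height at least 1; so the
  \<open>k\<close>-th term of the lower central series involves only heights above
  \<open>k\<close>.\<close>

lemma nilpotent_root_sum:
  assumes "S \<subseteq> pos_roots"
  shows "nilpotent (root_sum S)"
proof -
  define L where "L k = root_sum {\<gamma> \<in> pos_roots. k < ht \<gamma>}" for k
  have sub: "lower_central (root_sum S) k \<subseteq> L k" for k
  proof (induction k)
    case 0
    show ?case using assms ht_pos by (auto simp: L_def intro!: root_sum_mono)
  next
    case (Suc k)
    have "bracket x y \<in> L (Suc k)" if "x \<in> root_sum S" "y \<in> lower_central (root_sum S) k" for x y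
      unfolding L_def
    proof (rule bracket_root_sum[of x S y "{\<gamma> \<in> pos_roots. k < ht \<gamma>}"])
      show "y \<in> root_sum {\<gamma> \<in> pos_roots. k < ht \<gamma>}" using that Suc.IH by (auto simp: L_def)
    next
      fix \<gamma> \<delta> assume gd: "\<gamma> \<in> S" "\<delta> \<in> {\<gamma> \<in> pos_roots. k < ht \<gamma>}" "\<gamma> + \<delta> \<in> roots"
      then have p: "\<gamma> \<in> pos_roots" "\<delta> \<in> pos_roots" "\<gamma> + \<delta> \<in> pos_roots" using assms pos_add by auto
      then show "\<gamma> + \<delta> \<in> {\<gamma> \<in> pos_roots. Suc k < ht \<gamma>}"
        using gd(2) ht_add[OF p] ht_pos[OF p(1)] by simp
    qed (use that assms in auto)
    moreover have "subspace (L (Suc k))" by (simp add: L_def subspace_root_sum)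
    ultimately show ?case unfolding lower_central.simps by (intro span_minimal) blast+
  qed
  have fin: "finite pos_roots" using finite_roots pos_root by (meson finite_subset subsetI)
  define k where "k = Max (insert 0 (ht ` pos_roots))"
  have "ht \<gamma> \<le> k" if "\<gamma> \<in> pos_roots" for \<gamma> using that fin by (simp add: k_def)
  then have empty: "{\<gamma> \<in> pos_roots. k < ht \<gamma>} = {}" by (auto simp: not_less)
  have Lk: "L k = {0}" unfolding L_def empty by (simp add: root_sum_def)
  have "0 \<in> lower_central (root_sum S) k"
    by (cases k) (auto simp: subspace_0 subspace_root_sum span_zero)
  then have "lower_central (root_sum S) k = {0}" using sub[of k] Lk by blast
  then show ?thesis by (auto simp: nilpotent_def)
qed

text \<open>A nonzero \<open>h\<close> of \<open>t\<close> in the nilradical acts on some positive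
  root vector by a nonzero scalar; this vector then lies in the nilradical and in every term of its
  lower central series. A vector of negative weight, bracketed with an opposite vector of
  \<open>u\<close>, would yield such an \<open>h\<close>.\<close>

lemma nilradical_pos_component:
  assumes p: "subalgebra p" "borel \<subseteq> p" and n: "is_nilradical_of n p"
    and g: "\<gamma> \<in> weights" "x \<in> root_space \<gamma>" "x \<in> n" "x \<noteq> 0"
  shows "\<gamma> \<in> pos_roots"
proof -
  have tp: "t \<subseteq> p" and up: "u \<subseteq> p" using borel_subset[OF p(2)] by auto
  have idl: "subspace n" "\<And>x y. x \<in> p \<Longrightarrow> y \<in> n \<Longrightarrow> bracket x y \<in> n"
    and nil: "nilpotent n"
    using n by (auto simp: is_nilradical_of_def ideal_of_def)
  have no_t: "h = 0" if h: "h \<in> t" "h \<in> n" for h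
  proof (rule ccontr)
    assume "h \<noteq> 0"
    then obtain \<delta>' where d': "\<delta>' \<in> roots" "\<delta>' h \<noteq> 0" using roots_separate[OF h(1)] by blast
    obtain \<delta> where d: "\<delta> \<in> pos_roots" "\<delta> h \<noteq> 0"
    proof (cases "\<delta>' \<in> pos_roots")
      case False
      then have "- \<delta>' \<in> pos_roots" using pos_or_neg[OF d'(1)] by blast
      then show ?thesis using that[of "- \<delta>'"] d'(2) by simp
    qed (use that d' in blast)
    let ?e = "root_vec \<delta>"
    have e: "?e \<in> root_space \<delta>" "?e \<noteq> 0" using root_vec pos_root d(1) by auto
    have he: "bracket h ?e = \<delta> h *s ?e" by (rule root_spaceD[OF e(1) h(1)])
    have e_eq: "?e = inverse (\<delta> h) *s bracket h ?e" using d(2) by (simp add: he)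
    have "bracket ?e h \<in> n" using e(1) pos_root_space_u[OF d(1)] up h(2) by (intro idl(2)) auto
    then have "bracket h ?e \<in> n" using bracket_anticommute[of h ?e] subspace_neg[OF idl(1)] by simp
    then have en: "?e \<in> n" using e_eq subspace_scale[OF idl(1)] by metis
    have "?e \<in> lower_central n k" for k
    proof (induction k)
      case (Suc k)
      have "bracket h ?e \<in> lower_central n (Suc k)" using Suc.IH h(2) by (auto intro!: span_base)
      then have "inverse (\<delta> h) *s bracket h ?e \<in> lower_central n (Suc k)"
        by (simp only: lower_central.simps span_scale)
      then show ?case using e_eq by simp
    qed (use en in simp)
    moreover obtain k where "lower_central n k = {0}" using nil by (auto simp: nilpotent_def)
    ultimately show False using e(2) by blast
  qed
  have "\<gamma> \<noteq> 0" using no_t g root_space_0 by blast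
  then have gr: "\<gamma> \<in> roots" using g(1) by simp
  show ?thesis
  proof (rule ccontr)
    assume "\<gamma> \<notin> pos_roots"
    then have np: "- \<gamma> \<in> pos_roots" using pos_or_neg[OF gr] by blast
    obtain y where y: "y \<in> root_space (- \<gamma>)" "killing x y \<noteq> 0"
      using killing_root_space_pairing[OF g(1,2,4)] by blast
    have b: "bracket x y = killing x y *s dual_vector \<gamma>" by (rule bracket_opposite[OF gr g(2) y(1)])
    have "bracket y x \<in> n" using y(1) pos_root_space_u[OF np] up g(3) by (intro idl(2)) auto
    then have "bracket x y \<in> n" using bracket_anticommute[of x y] subspace_neg[OF idl(1)] by simp
    moreover have "bracket x y \<in> t" by (rule bracket_opposite_mem_t[OF g(2) y(1)])
    ultimately have "bracket x y = 0" using no_t by blast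
    then show False using b y(2) dual_vector_nonzero[OF gr] by simp
  qed
qed

text \<open>The roots \<open>\<gamma>\<close> with \<open>-\<gamma>\<close> not a root of \<open>p\<close> span a nilpotent ideal of \<open>p\<close>.\<close>

lemma nilradical_contains:
  assumes p: "subalgebra p" "borel \<subseteq> p" and n: "is_nilradical_of n p"
    and g: "\<gamma> \<in> pos_roots" "\<not> root_space (- \<gamma>) \<subseteq> p"
  shows "\<gamma> \<in> roots_in n"
proof -
  have tp: "t \<subseteq> p" and up: "u \<subseteq> p" using borel_subset[OF p(2)] by auto
  have sp: "subspace p" and bp: "\<And>x y. x \<in> p \<Longrightarrow> y \<in> p \<Longrightarrow> bracket x y \<in> p"
    using p(1) by (auto simp: subalgebra_def)
  define J where "J = {\<gamma> \<in> pos_roots. \<not> root_space (- \<gamma>) \<subseteq> p}"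
  have Jpos: "J \<subseteq> pos_roots" by (auto simp: J_def)
  have gen: "bracket a b \<in> root_sum J"
    if a: "a \<in> (\<Union>\<delta>\<in>weights. root_space \<delta> \<inter> p)" and b: "b \<in> root_vec ` J" for a b
  proof (cases "a = 0")
    case True
    then show ?thesis using subspace_0[OF subspace_root_sum] by simp
  next
    case a0: False
    obtain \<delta> where d: "\<delta> \<in> weights" "a \<in> root_space \<delta>" "a \<in> p" using a by blast
    obtain \<epsilon> where e: "\<epsilon> \<in> J" "b = root_vec \<epsilon>" using b by blast
    have ep: "\<epsilon> \<in> pos_roots" "\<not> root_space (- \<epsilon>) \<subseteq> p" using e(1) by (auto simp: J_def)
    have er: "\<epsilon> \<in> roots" using pos_root[OF ep(1)] .
    show ?thesis
    proof (cases "\<delta> = 0")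
      case True
      then have "a \<in> t" using d root_space_0 by simp
      then have "bracket a b = \<epsilon> a *s b" using root_spaceD[OF root_vec(1)[OF er]] e by simp
      then show ?thesis using root_vec_mem[OF e(1)] e(2) subspace_scale[OF subspace_root_sum] by simp
    next
      case False
      then have dr: "\<delta> \<in> roots" using d by simp
      have dp: "root_space \<delta> \<subseteq> p" by (rule root_space_subset_if_mem[OF dr d(2) a0 d(3) sp])
      show ?thesis
      proof (cases "\<delta> + \<epsilon> \<in> weights")
        case False
        then have "bracket a b = 0"
          using bracket_root_spaces_eq_0[OF dr er _ d(2) root_vec(1)[OF er]] e(2) by simp
        then show ?thesis using subspace_0[OF subspace_root_sum] by simp
      next
        case True
        have "\<delta> + \<epsilon> \<noteq> 0"
        proof
          assume "\<delta> + \<epsilon> = 0"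
          then have "\<delta> = - \<epsilon>" by (simp add: eq_neg_iff_add_eq_0)
          then show False using dp ep(2) by simp
        qed
        then have s: "\<delta> + \<epsilon> \<in> roots" using True by simp
        \<comment> \<open>Otherwise the bracket of \<open>a\<close> with the root vector of
          \<open>- (\<delta> + \<epsilon>)\<close> would be a nonzero element of \<open>p\<close> of
          weight \<open>- \<epsilon>\<close>.\<close>
        have not_p: "\<not> root_space (- (\<delta> + \<epsilon>)) \<subseteq> p"
        proof
          assume c: "root_space (- (\<delta> + \<epsilon>)) \<subseteq> p"
          have sr: "- (\<delta> + \<epsilon>) \<in> roots" using uminus_root[OF s] .
          let ?y = "bracket a (root_vec (- (\<delta> + \<epsilon>)))"
          have sum: "\<delta> + - (\<delta> + \<epsilon>) = - \<epsilon>" by simp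
          have "?y \<noteq> 0"
            by (rule bracket_root_vectors_nonzero[OF dr sr _ d(2) a0 root_vec[OF sr]])
              (use er sum in simp)
          moreover have "?y \<in> root_space (- \<epsilon>)"
            using bracket_root_space[OF d(2) root_vec(1)[OF sr]] sum by simp
          moreover have "?y \<in> p" using bp d(3) c root_vec(1)[OF sr] by blast
          ultimately have "root_space (- \<epsilon>) \<subseteq> p"
            using root_space_subset_if_mem[OF uminus_root[OF er] _ _ _ sp] by blast
          then show False using ep(2) by blast
        qed
        have "\<delta> + \<epsilon> \<in> pos_roots"
          using pos_or_neg[OF s] not_p pos_root_space_u[of "- (\<delta> + \<epsilon>)"] up by blast
        then have "\<delta> + \<epsilon> \<in> J" using not_p by (simp add: J_def)
        moreover have "bracket a b \<in> root_space (\<delta> + \<epsilon>)"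
          using bracket_root_space[OF d(2) root_vec(1)[OF er]] e(2) by simp
        moreover have "root_space (\<delta> + \<epsilon>) \<subseteq> root_sum {\<delta> + \<epsilon>}"
          using root_space_eq_span[OF s] by (simp add: root_sum_def)
        ultimately show ?thesis using root_sum_mono[of "{\<delta> + \<epsilon>}" J] by blast
      qed
    qed
  qed
  have "bracket x y \<in> root_sum J" if x: "x \<in> p" and y: "y \<in> root_sum J" for x y
  proof (rule bracket_span_subset[of x "\<Union>\<delta>\<in>weights. root_space \<delta> \<inter> p" y "root_vec ` J"])
    obtain v where v: "\<And>\<gamma>. \<gamma> \<in> weights \<Longrightarrow> v \<gamma> \<in> root_space \<gamma> \<and> v \<gamma> \<in> p" "x = (\<Sum>\<gamma>\<in>weights. v \<gamma>)"
      using t_stable_component_mem[OF sp _ x] bp tp by blast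
    show "x \<in> span (\<Union>\<delta>\<in>weights. root_space \<delta> \<inter> p)"
      unfolding v(2) by (intro span_sum span_base) (use v(1) in blast)
    show "y \<in> span (root_vec ` J)" using y by (simp add: root_sum_def)
  qed (use gen subspace_root_sum in auto)
  moreover have "root_sum J \<subseteq> p"
    by (rule order_trans[OF root_sum_mono[OF Jpos] ord_eq_le_trans[OF u_root_sum[symmetric] up]])
  ultimately have "ideal_of (root_sum J) p" using subspace_root_sum by (simp add: ideal_of_def)
  then have "root_sum J \<subseteq> n"
    using n nilpotent_root_sum[OF Jpos] by (simp add: is_nilradical_of_def)
  moreover have "subspace n" using n by (simp add: is_nilradical_of_def ideal_of_def)
  moreover have "\<gamma> \<in> J" using g by (simp add: J_def)
  ultimately show ?thesis using root_vec_mem[of \<gamma> J] root_vec_mem_roots_in pos_root[OF g(1)] by blast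
qed

text \<open>The last two facts drive the counting below. For the last one: if the positive root
  \<delta> is not in the nilradical, the parabolic contains the root space of
  \<open>- \<delta>\<close>, and bracketing with it moves \<open>\<gamma> + \<delta>\<close> to
  \<gamma> inside the ideal.\<close>

lemma standard_nilradical_roots:
  assumes "standard_nilradical n"
  shows "roots_in n \<subseteq> pos_roots" "n = root_sum (roots_in n)" "subalgebra n"
    "\<And>\<gamma> \<delta>. \<gamma> \<in> roots_in n \<Longrightarrow> \<delta> \<in> pos_roots \<Longrightarrow> \<gamma> + \<delta> \<in> roots \<Longrightarrow> \<gamma> + \<delta> \<in> roots_in n"
    "\<And>\<gamma> \<delta>. \<gamma> \<in> pos_roots \<Longrightarrow> \<delta> \<in> pos_roots \<Longrightarrow> \<gamma> + \<delta> \<in> roots_in n \<Longrightarrow> \<gamma> \<in> roots_in n \<or> \<delta> \<in> roots_in n"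
proof -
  obtain p where p: "subalgebra p" "borel \<subseteq> p" and n: "is_nilradical_of n p"
    using assms by (auto simp: standard_nilradical_def)
  have tp: "t \<subseteq> p" and up: "u \<subseteq> p" using borel_subset[OF p(2)] by auto
  have sn: "subspace n" and idl: "\<And>x y. x \<in> p \<Longrightarrow> y \<in> n \<Longrightarrow> bracket x y \<in> n" and np: "n \<subseteq> p"
    using n by (auto simp: is_nilradical_of_def ideal_of_def)
  show "subalgebra n" using sn idl np by (auto simp: subalgebra_def)
  show pos: "roots_in n \<subseteq> pos_roots"
  proof
    fix \<gamma> assume "\<gamma> \<in> roots_in n"
    then have g: "\<gamma> \<in> roots" "root_space \<gamma> \<subseteq> n" by (auto simp: roots_in_def)
    then show "\<gamma> \<in> pos_roots"
      using nilradical_pos_component[OF p n _ root_vec(1)[OF g(1)] _ root_vec(2)[OF g(1)]]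
        root_vec(1)[OF g(1)] by blast
  qed
  show "n = root_sum (roots_in n)"
  proof
    show "root_sum (roots_in n) \<subseteq> n"
      unfolding root_sum_def
      by (rule span_minimal[OF _ sn]) (use root_vec(1) in \<open>auto simp: roots_in_def\<close>)
    show "n \<subseteq> root_sum (roots_in n)"
    proof
      fix x assume x: "x \<in> n"
      obtain v where v: "\<And>\<gamma>. \<gamma> \<in> weights \<Longrightarrow> v \<gamma> \<in> root_space \<gamma> \<and> v \<gamma> \<in> n" "x = (\<Sum>\<gamma>\<in>weights. v \<gamma>)"
        using t_stable_component_mem[OF sn _ x] idl tp by blast
      have "v \<gamma> \<in> root_sum (roots_in n)" if g: "\<gamma> \<in> weights" for \<gamma>
      proof (cases "v \<gamma> = 0")
        case True
        then show ?thesis using subspace_0[OF subspace_root_sum] by simp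
      next
        case False
        then have "\<gamma> \<in> pos_roots" using nilradical_pos_component[OF p n g] v(1)[OF g] by blast
        then have r: "\<gamma> \<in> roots" by (rule pos_root)
        then have "root_space \<gamma> \<subseteq> n" using root_space_subset_if_mem[OF r _ False _ sn] v(1)[OF g] by blast
        then have "\<gamma> \<in> roots_in n" using r by (simp add: roots_in_def)
        then have "root_sum {\<gamma>} \<subseteq> root_sum (roots_in n)" by (intro root_sum_mono) blast
        moreover have "v \<gamma> \<in> root_sum {\<gamma>}"
          using v(1)[OF g] root_space_eq_span[OF r] by (simp add: root_sum_def)
        ultimately show ?thesis by blast
      qed
      then show "x \<in> root_sum (roots_in n)" unfolding v(2) by (intro subspace_sum subspace_root_sum)
    qed
  qed
  have move: "\<gamma> + \<delta> \<in> roots_in n"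
    if g: "\<gamma> \<in> roots_in n" and d: "\<delta> \<in> roots" "root_vec \<delta> \<in> p" and s: "\<gamma> + \<delta> \<in> roots" for \<gamma> \<delta>
  proof -
    have gr: "\<gamma> \<in> roots" "root_vec \<gamma> \<in> n" using g root_vec(1) by (auto simp: roots_in_def)
    have s': "\<delta> + \<gamma> \<in> roots" using s by (simp add: add.commute)
    obtain k where k: "k \<noteq> 0" "bracket (root_vec \<delta>) (root_vec \<gamma>) = k *s root_vec (\<delta> + \<gamma>)"
      using bracket_root_vec[OF d(1) gr(1) s'] .
    have "k *s root_vec (\<delta> + \<gamma>) \<in> n" using idl[OF d(2) gr(2)] k(2) by simp
    then have "inverse k *s (k *s root_vec (\<delta> + \<gamma>)) \<in> n" by (rule subspace_scale[OF sn])
    then have "root_vec (\<gamma> + \<delta>) \<in> n" using k(1) by (simp add: add.commute)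
    then show ?thesis using root_vec_mem_roots_in[OF s sn] by blast
  qed
  show "\<gamma> + \<delta> \<in> roots_in n" if "\<gamma> \<in> roots_in n" "\<delta> \<in> pos_roots" "\<gamma> + \<delta> \<in> roots" for \<gamma> \<delta>
    by (rule move) (use that pos_root pos_root_space_u up root_vec(1) in blast)+
  show "\<gamma> \<in> roots_in n \<or> \<delta> \<in> roots_in n"
    if g: "\<gamma> \<in> pos_roots" and d: "\<delta> \<in> pos_roots" and s: "\<gamma> + \<delta> \<in> roots_in n" for \<gamma> \<delta>
  proof (rule disjCI)
    assume nd: "\<delta> \<notin> roots_in n"
    have dm: "- \<delta> \<in> roots" using pos_root[OF d] by simp
    have "root_space (- \<delta>) \<subseteq> p" using nilradical_contains[OF p n d] nd by blast
    then have "root_vec (- \<delta>) \<in> p" using root_vec(1)[OF dm] by blast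
    then have "\<gamma> + \<delta> + - \<delta> \<in> roots_in n" using pos_root[OF g] by (intro move[OF s dm]) simp_all
    then show "\<gamma> \<in> roots_in n" by simp
  qed
qed


subsection \<open>The index of a nilradical\<close>

text \<open>Since \<open>ad x\<close> maps \<open>N\<close> into the Heisenberg part, that into the line of \<open>root_vec \<beta>\<close> and the line to
  \<open>0\<close>, its exponential \<open>\<phi>\<close> is quadratic. For a suitable \<open>x\<close> the form \<open>f \<circ> \<phi>\<close> vanishes on the root
  vectors of \<open>Q - {\<beta>}\<close>, so that its radical splits.\<close>

lemma rad_dim_step:
  assumes b: "\<beta> \<in> cascade" and D: "D \<subseteq> pos_roots" "\<beta> \<in> D"
    and up: "\<And>\<gamma> \<delta>. \<gamma> \<in> D \<Longrightarrow> \<delta> \<in> pos_roots \<Longrightarrow> \<gamma> + \<delta> \<in> roots \<Longrightarrow> \<gamma> + \<delta> \<in> D"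
    and T: "T \<subseteq> D" "heisenberg_roots \<beta> \<inter> T = {}"
    and other: "\<And>\<gamma> \<delta>. \<gamma> \<in> heisenberg_roots \<beta> \<Longrightarrow> \<delta> \<in> T \<Longrightarrow> \<gamma> + \<delta> \<in> roots \<Longrightarrow>
      \<gamma> + \<delta> \<in> heisenberg_roots \<beta> - {\<beta>}"
    and f: "linear_form f" "f (root_vec \<beta>) \<noteq> 0"
    and IH: "\<And>g. linear_form g \<Longrightarrow> k \<le> dim (rad g (root_sum T))"
  shows "card {\<gamma> \<in> heisenberg_roots \<beta> \<inter> D. \<gamma> = \<beta> \<or> \<beta> - \<gamma> \<notin> D} + k
    \<le> dim (rad f (root_sum (heisenberg_roots \<beta> \<inter> D \<union> T)))"
proof -
  define H where "H = heisenberg_roots \<beta>"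
  define Q where "Q = H \<inter> D"
  define N where "N = root_sum (Q \<union> T)"
  \<comment> \<open>Roots without a partner in \<open>D\<close> summing to \<beta>; their root
    vectors end up in the radical of the transformed form.\<close>
  define E where "E = {\<gamma> \<in> Q. \<gamma> = \<beta> \<or> \<beta> - \<gamma> \<notin> D}"
  let ?e = root_vec
  have Hpos: "H \<subseteq> pos_roots" using heisenberg_rootD(2)[OF b] by (auto simp: H_def)
  have bH: "\<beta> \<in> H" using cascade_mem_heisenberg[OF b] by (simp add: H_def)
  have Tpos: "T \<subseteq> pos_roots" and Qpos: "Q \<subseteq> pos_roots" and EQ: "E \<subseteq> Q" and QH: "Q \<subseteq> H" and QD: "Q \<subseteq> D"
    using T D Hpos by (auto simp: Q_def E_def)
  have QTpos: "Q \<union> T \<subseteq> pos_roots" using Tpos Qpos by blast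
  have roots: "H \<subseteq> roots" "Q \<subseteq> roots" "T \<subseteq> roots" "E \<subseteq> roots"
    using Hpos Tpos QH EQ pos_root by blast+
  have HH: "\<gamma> + \<delta> = \<beta>" if "\<gamma> \<in> H" "\<delta> \<in> H" "\<gamma> + \<delta> \<in> roots" for \<gamma> \<delta>
    using heisenberg_add[OF b] that by (simp add: H_def)
  have HT: "\<gamma> + \<delta> \<in> Q - {\<beta>}" if "\<gamma> \<in> H" "\<delta> \<in> T" "\<gamma> + \<delta> \<in> roots" for \<gamma> \<delta>
    using other[of \<gamma> \<delta>] up[of \<delta> \<gamma>] that T Hpos by (auto simp: H_def Q_def add.commute)
  have Hb: "\<gamma> + \<beta> \<notin> roots" if "\<gamma> \<in> H" for \<gamma>
    using HH[OF that bH] that roots(1) root_ne_0[of \<gamma>] by auto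
  have sN: "subspace N" by (simp add: N_def subspace_root_sum)
  have comp: "\<beta> - \<gamma> \<in> H" if "\<gamma> \<in> H" "\<gamma> \<noteq> \<beta>" for \<gamma>
    using heisenberg_complement[OF b] that by (simp add: H_def)
  have "\<exists>c. c \<noteq> 0 \<and> bracket (?e (\<beta> - \<gamma>)) (?e \<gamma>) = c *s ?e \<beta>" if g: "\<gamma> \<in> Q - {\<beta>}" for \<gamma>
  proof -
    have r: "\<beta> - \<gamma> \<in> roots" "\<gamma> \<in> roots" "\<beta> - \<gamma> + \<gamma> \<in> roots"
      using g comp QH roots bH by auto
    show ?thesis using bracket_root_vec[OF r] by auto
  qed
  then obtain \<kappa> where \<kappa>: "\<And>\<gamma>. \<gamma> \<in> Q - {\<beta>} \<Longrightarrow> \<kappa> \<gamma> \<noteq> 0 \<and> bracket (?e (\<beta> - \<gamma>)) (?e \<gamma>) = \<kappa> \<gamma> *s ?e \<beta>"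
    by metis
  \<comment> \<open>The value for which \<open>f\<close> vanishes on
    \<open>?e \<gamma> + (c \<gamma> * \<kappa> \<gamma>) *s ?e \<beta>\<close>; this is where
    \<open>f (?e \<beta>)\<close> must be nonzero.\<close>
  define c where "c \<gamma> = - f (?e \<gamma>) / (\<kappa> \<gamma> * f (?e \<beta>))" for \<gamma>
  define x where "x = (\<Sum>\<gamma>\<in>Q - {\<beta>}. c \<gamma> *s ?e (\<beta> - \<gamma>))"
  have fin: "finite Q" using roots(2) finite_roots by (rule finite_subset)
  have xH: "x \<in> root_sum H"
    unfolding x_def using comp QH
    by (intro subspace_sum[OF subspace_root_sum] subspace_scale[OF subspace_root_sum] root_vec_mem) auto
  have xQ: "bracket x (?e \<gamma>) = (c \<gamma> * \<kappa> \<gamma>) *s ?e \<beta>" if g: "\<gamma> \<in> Q - {\<beta>}" for \<gamma>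
  proof -
    \<comment> \<open>Only the summand of \<open>x\<close> belonging to \<gamma> acts on
      \<open>?e \<gamma>\<close>, because a root that is a sum of two members of the Heisenberg set
      is \<beta>.\<close>
    have "bracket (?e (\<beta> - \<delta>)) (?e \<gamma>) = 0" if d: "\<delta> \<in> Q - {\<beta>}" "\<delta> \<noteq> \<gamma>" for \<delta>
    proof -
      have h: "\<beta> - \<delta> \<in> H" "\<gamma> \<in> H" using d g comp QH by auto
      have "\<beta> - \<delta> + \<gamma> \<notin> roots"
      proof
        assume "\<beta> - \<delta> + \<gamma> \<in> roots"
        then have "\<beta> - \<delta> + \<gamma> = \<beta>" by (rule HH[OF h])
        then show False using d(2) by (simp add: algebra_simps)
      qed
      then have "\<beta> - \<delta> + \<gamma> \<notin> weights"
        using pos_sum_weight[of "\<beta> - \<delta>" \<gamma>] h Hpos by blast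
      then show ?thesis
        using bracket_root_spaces_eq_0[of "\<beta> - \<delta>" \<gamma>] h roots(1) root_vec(1) by blast
    qed
    then have "bracket x (?e \<gamma>) = (\<Sum>\<delta>\<in>Q - {\<beta>}. if \<delta> = \<gamma> then (c \<gamma> * \<kappa> \<gamma>) *s ?e \<beta> else 0)"
      unfolding x_def bracket_sum_left bracket_scale_left using \<kappa>[OF g] by (intro sum.cong) auto
    then show ?thesis using g fin by simp
  qed
  have xE: "bracket x y \<in> root_sum {\<beta>}" if "y \<in> root_sum Q" for y
    by (rule bracket_root_sum[OF xH that Hpos Qpos]) (use HH QH in blast)
  have xN: "bracket x y \<in> root_sum Q" if "y \<in> N" for y
  proof (rule bracket_root_sum[OF xH that[unfolded N_def] Hpos QTpos])
    fix \<gamma> \<delta> assume gd: "\<gamma> \<in> H" "\<delta> \<in> Q \<union> T" "\<gamma> + \<delta> \<in> roots"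
    show "\<gamma> + \<delta> \<in> Q"
    proof (cases "\<delta> \<in> T")
      case True
      then show ?thesis using HT[OF gd(1) True gd(3)] by blast
    next
      case False
      then have "\<gamma> + \<delta> = \<beta>" using HH[OF gd(1) _ gd(3)] gd(2) QH by blast
      then show ?thesis using bH D(2) by (simp add: Q_def)
    qed
  qed
  have bpos: "{\<beta>} \<subseteq> pos_roots" using bH Hpos by blast
  have central: "bracket y w = 0" if "y \<in> root_sum H" "w \<in> root_sum {\<beta>}" for y w
  proof -
    have "bracket y w \<in> root_sum {}"
      by (rule bracket_root_sum[OF that Hpos bpos]) (use Hb in blast)
    then show ?thesis by (simp add: root_sum_def)
  qed
  have QN: "root_sum Q \<subseteq> N" and QHs: "root_sum Q \<subseteq> root_sum H" and bQ: "root_sum {\<beta>} \<subseteq> root_sum Q"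
    unfolding N_def using QH bH D(2) by (auto intro!: root_sum_mono simp: Q_def)
  have N1: "bracket x y \<in> root_sum H" "bracket x y \<in> N" if "y \<in> N" for y using xN[OF that] QHs QN by auto
  have N2: "bracket x (bracket x y) \<in> root_sum {\<beta>}" "bracket x (bracket x y) \<in> N"
    "bracket x (bracket x y) \<in> root_sum H" if "y \<in> N" for y
    using xE[OF xN[OF that]] bQ QN QHs by auto
  have N3: "bracket x (bracket x (bracket x y)) = 0" if "y \<in> N" for y
    by (rule central[OF xH N2(1)[OF that]])
  have half: "(1/2) *s v + (1/2) *s v = v" for v
    by (simp add: scale_left_distrib[symmetric])
  define \<phi> where "\<phi> w = w + bracket x w + (1/2) *s bracket x (bracket x w)" for w
  \<comment> \<open>The exponential of \<open>- bracket x\<close>, inverse to \<phi> on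
    \<open>N\<close>, where triple brackets with \<open>x\<close> vanish.\<close>
  define \<psi> where "\<psi> w = w - bracket x w + (1/2) *s bracket x (bracket x w)" for w
  have \<phi>N: "\<phi> w \<in> N" and \<psi>N: "\<psi> w \<in> N" if "w \<in> N" for w
    unfolding \<phi>_def \<psi>_def using that N1(2) N2(2) sN
    by (simp_all add: subspace_add subspace_diff subspace_scale)
  have lin: "linear_map \<phi>"
    by (simp add: linear_map_def \<phi>_def bracket_add_right bracket_scale_right scale_right_distrib
        add.assoc add.left_commute mult.commute)
  have \<phi>\<psi>: "\<phi> (\<psi> w) = w" and \<psi>\<phi>: "\<psi> (\<phi> w) = w" if "w \<in> N" for w
  proof -
    define w1 where "w1 = bracket x w"
    define w2 where "w2 = bracket x w1"
    have w3: "bracket x w2 = 0" using N3[OF that] by (simp add: w1_def w2_def)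
    have "\<phi> (\<psi> w) = w + ((1/2) *s w2 + (1/2) *s w2 - w2)" "\<psi> (\<phi> w) = w + ((1/2) *s w2 + (1/2) *s w2 - w2)"
      unfolding \<phi>_def \<psi>_def w1_def[symmetric] w2_def[symmetric]
      by (simp_all add: bracket_add_right bracket_diff_right bracket_scale_right w1_def[symmetric]
          w2_def[symmetric] w3 scale_right_distrib scale_right_diff_distrib algebra_simps)
    then show "\<phi> (\<psi> w) = w" "\<psi> (\<phi> w) = w" by (simp_all only: half) simp_all
  qed
  have hom: "bracket (\<phi> y) (\<phi> w) = \<phi> (bracket y w)" if y: "y \<in> N" and w: "w \<in> N" for y w
  proof -
    define y1 where "y1 = bracket x y"
    define w1 where "w1 = bracket x w"
    define y2 where "y2 = bracket x y1"
    define w2 where "w2 = bracket x w1"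
    \<comment> \<open>The terms of degree three and four in the product of the two exponentials;
      they vanish because the line of \<beta> commutes with the Heisenberg part.\<close>
    have z: "bracket y1 w2 = 0" "bracket y2 w2 = 0" "bracket y2 w1 = 0"
      using central[OF N1(1)[OF y] N2(1)[OF w]] central[OF N2(3)[OF y] N2(1)[OF w]]
        central[OF N1(1)[OF w] N2(1)[OF y]] bracket_anticommute[of y2 w1]
      by (simp_all add: y1_def y2_def w1_def w2_def)
    have d1: "bracket x (bracket y w) = bracket y1 w + bracket y w1"
      using bracket_leibniz[of x y w] by (simp add: y1_def w1_def)
    have d2: "bracket x (bracket x (bracket y w))
        = (bracket y2 w + bracket y w2) + (bracket y1 w1 + bracket y1 w1)"
      unfolding d1 bracket_add_right using bracket_leibniz[of x y1 w] bracket_leibniz[of x y w1]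
      by (simp add: y1_def[symmetric] w1_def[symmetric] y2_def[symmetric] w2_def[symmetric])
    have "\<phi> (bracket y w) = bracket y w + (bracket y1 w + bracket y w1)
        + (1/2) *s (bracket y2 w + bracket y w2) + ((1/2) *s bracket y1 w1 + (1/2) *s bracket y1 w1)"
      unfolding \<phi>_def d2 unfolding d1 by (simp add: scale_right_distrib)
    also have "\<dots> = bracket y w + (bracket y1 w + bracket y w1)
        + (1/2) *s (bracket y2 w + bracket y w2) + bracket y1 w1"
      by (simp only: half)
    also have "\<dots> = bracket (\<phi> y) (\<phi> w)"
      unfolding \<phi>_def y1_def[symmetric] w1_def[symmetric] y2_def[symmetric] w2_def[symmetric]
      by (simp add: bracket_add_left bracket_add_right bracket_scale_left bracket_scale_right z
          scale_right_distrib)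
    finally show ?thesis by (rule sym)
  qed
  define f' where "f' w = f (\<phi> w)" for w
  have f': "linear_form f'"
    using f(1) lin by (simp add: linear_form_def linear_map_def f'_def)
  have vanish: "f' w = 0" if "w \<in> root_sum (Q - {\<beta>})" for w
  proof (rule linear_form_eq_0_on_span[OF f' _ that[unfolded root_sum_def]])
    fix w assume "w \<in> ?e ` (Q - {\<beta>})"
    then obtain \<gamma> where g: "\<gamma> \<in> Q - {\<beta>}" "w = ?e \<gamma>" by blast
    have "bracket x (?e \<beta>) = 0" by (rule central[OF xH root_vec_mem]) simp
    then have "\<phi> w = ?e \<gamma> + (c \<gamma> * \<kappa> \<gamma>) *s ?e \<beta>"
      by (simp add: \<phi>_def g(2) xQ[OF g(1)] bracket_scale_right)
    then show "f' w = 0"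
      using \<kappa>[OF g(1)] f by (simp add: f'_def linear_form_diff linear_form_add linear_form_scale c_def)
  qed
  have "\<phi> ` rad f' N \<subseteq> rad f N"
  proof
    fix v assume "v \<in> \<phi> ` rad f' N"
    then obtain w where w: "w \<in> N" "\<And>y. y \<in> N \<Longrightarrow> f' (bracket w y) = 0" "v = \<phi> w"
      by (auto simp: rad_def)
    have "f (bracket v y) = 0" if y: "y \<in> N" for y
    proof -
      have "bracket v y = bracket (\<phi> w) (\<phi> (\<psi> y))" using \<phi>\<psi>[OF y] w(3) by simp
      also have "\<dots> = \<phi> (bracket w (\<psi> y))" by (rule hom[OF w(1) \<psi>N[OF y]])
      finally show ?thesis using w(2)[OF \<psi>N[OF y]] by (simp add: f'_def)
    qed
    then show "v \<in> rad f N" using \<phi>N[OF w(1)] w(3) by (simp add: rad_def)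
  qed
  then have "dim (\<phi> ` rad f' N) \<le> dim (rad f N)" by (rule dim_subset)
  moreover have "dim (\<phi> ` rad f' N) = dim (rad f' N)"
  proof -
    interpret pair: finite_dimensional_vector_space_pair_1 scale Basis scale by unfold_locales
    have "Vector_Spaces.linear scale scale \<phi>"
      using lin by (simp add: Vector_Spaces.linear_iff linear_map_def vector_space_axioms)
    moreover have "inj_on \<phi> (span (rad f' N))"
    proof (rule inj_on_inverseI[of _ \<psi>])
      fix w assume "w \<in> span (rad f' N)"
      then have "w \<in> rad f' N" using span_minimal[OF order_refl subspace_rad[OF f' sN]] by blast
      then show "\<psi> (\<phi> w) = w" using rad_subset by (intro \<psi>\<phi>) blast
    qed
    ultimately show ?thesis by (rule pair.dim_image_eq)
  qed
  ultimately have le: "dim (rad f' N) \<le> dim (rad f N)" by simp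
  have E_rad: "root_sum E \<subseteq> rad f' N"
  proof
    fix y assume y: "y \<in> root_sum E"
    have yN: "y \<in> N" using y root_sum_mono[OF EQ] QN by blast
    have "f' (bracket y w) = 0" if w: "w \<in> N" for w
    proof (rule vanish, rule bracket_root_sum[OF y w[unfolded N_def] _ QTpos])
      show "E \<subseteq> pos_roots" using EQ Qpos by blast
      fix \<gamma> \<delta> assume gd: "\<gamma> \<in> E" "\<delta> \<in> Q \<union> T" "\<gamma> + \<delta> \<in> roots"
      have gH: "\<gamma> \<in> H" using gd(1) EQ QH by blast
      show "\<gamma> + \<delta> \<in> Q - {\<beta>}"
      proof (cases "\<delta> \<in> T")
        case True
        then show ?thesis by (rule HT[OF gH _ gd(3)])
      next
        case False
        then have dQ: "\<delta> \<in> Q" using gd(2) by blast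
        then have s: "\<gamma> + \<delta> = \<beta>" using HH[OF gH _ gd(3)] QH by blast
        have "\<gamma> \<noteq> \<beta>" using s dQ roots(2) root_ne_0[of \<delta>] by auto
        moreover have "\<beta> - \<gamma> = \<delta>" using s by auto
        ultimately show ?thesis using gd(1) dQ QD by (auto simp: E_def)
      qed
    qed
    then show "y \<in> rad f' N" using yN by (simp add: rad_def)
  qed
  \<comment> \<open>Brackets of \<open>T\<close> with \<open>Q\<close> end in
    \<open>Q - {\<beta>}\<close>, where \<open>f'\<close> vanishes; so only brackets inside
    \<open>T\<close> matter.\<close>
  have T_rad: "rad f' (root_sum T) \<subseteq> rad f' N"
  proof
    fix y assume y: "y \<in> rad f' (root_sum T)"
    then have yT: "y \<in> root_sum T" by (simp add: rad_def)
    have "f' (bracket y w) = 0" if w: "w \<in> N" for w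
    proof (rule linear_form_eq_0_on_span[OF linear_form_bracket_right[OF f'] _ w[unfolded N_def root_sum_def]])
      fix v assume "v \<in> ?e ` (Q \<union> T)"
      then obtain \<delta> where d: "\<delta> \<in> Q \<union> T" "v = ?e \<delta>" by blast
      show "f' (bracket y v) = 0"
      proof (cases "\<delta> \<in> T")
        case True
        then show ?thesis using y root_vec_mem[OF True] d(2) by (simp add: rad_def)
      next
        case False
        then have dQ: "\<delta> \<in> Q" using d(1) by blast
        show ?thesis
        proof (rule vanish, rule bracket_root_sum[OF yT _ Tpos, of v "{\<delta>}"])
          show "v \<in> root_sum {\<delta>}" using root_vec_mem[of \<delta> "{\<delta>}"] d(2) by simp
          show "{\<delta>} \<subseteq> pos_roots" using dQ Qpos by blast
          fix \<gamma> \<epsilon> assume ge: "\<gamma> \<in> T" "\<epsilon> \<in> {\<delta>}" "\<gamma> + \<epsilon> \<in> roots"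
          then show "\<gamma> + \<epsilon> \<in> Q - {\<beta>}"
            using HT[of \<epsilon> \<gamma>] dQ QH by (auto simp: add.commute)
        qed
      qed
    qed
    moreover have "y \<in> N" using yT root_sum_mono[of T "Q \<union> T"] by (auto simp: N_def)
    ultimately show "y \<in> rad f' N" by (simp add: rad_def)
  qed
  have "dim {a + b |a b. a \<in> root_sum E \<and> b \<in> rad f' (root_sum T)}
      + dim (root_sum E \<inter> rad f' (root_sum T)) = dim (root_sum E) + dim (rad f' (root_sum T))"
    by (rule dim_sums_Int) (simp_all add: subspace_root_sum subspace_rad f')
  moreover have "root_sum E \<inter> rad f' (root_sum T) \<subseteq> {0}"
  proof -
    have "E \<inter> T = {}" using EQ QH T(2) by (auto simp: H_def)
    then have "root_sum E \<inter> root_sum T = {0}" by (rule root_sum_inter[OF roots(4,3)])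
    then show ?thesis by (auto simp: rad_def)
  qed
  then have "dim (root_sum E \<inter> rad f' (root_sum T)) = 0" by simp
  moreover have "dim {a + b |a b. a \<in> root_sum E \<and> b \<in> rad f' (root_sum T)} \<le> dim (rad f' N)"
    by (rule dim_subset) (use E_rad T_rad subspace_add[OF subspace_rad[OF f' sN]] in blast)
  moreover have "dim (root_sum E) = card E" by (rule dim_root_sum[OF roots(4)])
  moreover have "k \<le> dim (rad f' (root_sum T))" by (rule IH[OF f'])
  ultimately have "card E + k \<le> dim (rad f N)" using le by linarith
  then show ?thesis by (simp add: E_def N_def Q_def H_def)
qed

section \<open>Counting over the cascade: the two bounds for the radical\<close>

lemma exists_form_root_vec:
  assumes "S \<subseteq> roots"
  obtains f where "linear_form f" "\<And>\<gamma>. \<gamma> \<in> roots \<Longrightarrow> f (root_vec \<gamma>) = (if \<gamma> \<in> S then 1 else 0)"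
proof -
  have fin: "finite S" using assms finite_roots by (rule finite_subset)
  obtain B where B: "root_vec ` roots \<subseteq> B" "independent B" "UNIV \<subseteq> span B"
    using maximal_independent_subset_extend[OF subset_UNIV independent_root_vec[OF order_refl]] by metis
  define f where "f x = (\<Sum>\<beta>\<in>S. representation B x (root_vec \<beta>))" for x
  have "linear_form (\<lambda>x. representation B x b)" for b
    using B by (intro linear_form_representation) auto
  then have "linear_form f"
    by (auto simp: linear_form_def f_def sum.distrib sum_distrib_left)
  moreover have "f (root_vec \<gamma>) = (if \<gamma> \<in> S then 1 else 0)" if g: "\<gamma> \<in> roots" for \<gamma>
  proof -
    have "representation B (root_vec \<gamma>) (root_vec \<beta>) = (if \<beta> = \<gamma> then 1 else 0)" if "\<beta> \<in> S" for \<beta>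
    proof -
      have "root_vec \<gamma> \<in> B" using B(1) g by blast
      moreover have "root_vec \<beta> = root_vec \<gamma> \<longleftrightarrow> \<beta> = \<gamma>"
        using g that assms by (intro inj_on_eq_iff[OF inj_on_root_vec[OF order_refl]]) auto
      ultimately show ?thesis using representation_basis[OF B(2)] by simp
    qed
    then show ?thesis using fin by (simp add: f_def)
  qed
  ultimately show ?thesis using that by blast
qed

text \<open>Subtraction from \<beta> maps the roots of the Heisenberg set outside \<open>D\<close>
  bijectively to the unpaired roots other than \<beta>: as \<beta> is in \<open>D\<close>, one of
  two positive roots with sum \<beta> is in \<open>D\<close>. The successor accounts for \<beta>
  itself.\<close>

lemma card_heisenberg_self_paired:
  assumes b: "\<beta> \<in> cascade" and D: "\<beta> \<in> D"
    and prime: "\<And>\<gamma> \<delta>. \<gamma> \<in> pos_roots \<Longrightarrow> \<delta> \<in> pos_roots \<Longrightarrow> \<gamma> + \<delta> \<in> D \<Longrightarrow> \<gamma> \<in> D \<or> \<delta> \<in> D"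
  shows "card {\<gamma> \<in> heisenberg_roots \<beta> \<inter> D. \<gamma> = \<beta> \<or> \<beta> - \<gamma> \<notin> D} = Suc (card (heisenberg_roots \<beta> - D))"
proof -
  let ?H = "heisenberg_roots \<beta>"
  let ?F = "{\<gamma> \<in> ?H \<inter> D. \<gamma> \<noteq> \<beta> \<and> \<beta> - \<gamma> \<notin> D}"
  have Hr: "\<gamma> \<in> roots" "\<gamma> \<in> pos_roots" if "\<gamma> \<in> ?H" for \<gamma> using heisenberg_rootD[OF b that] by auto
  have fin: "finite ?F" by (rule finite_subset[OF _ finite_roots]) (use Hr in blast)
  have "(\<lambda>\<gamma>. \<beta> - \<gamma>) ` (?H - D) = ?F"
  proof
    show "(\<lambda>\<gamma>. \<beta> - \<gamma>) ` (?H - D) \<subseteq> ?F"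
    proof
      fix \<delta> assume "\<delta> \<in> (\<lambda>\<gamma>. \<beta> - \<gamma>) ` (?H - D)"
      then obtain \<gamma> where g: "\<gamma> \<in> ?H" "\<gamma> \<notin> D" "\<delta> = \<beta> - \<gamma>" by blast
      have d: "\<delta> \<in> ?H" using heisenberg_complement[OF b g(1)] g D by auto
      have "\<delta> + \<gamma> \<in> D" using g(3) D by simp
      then have "\<delta> \<in> D" using prime[of \<delta> \<gamma>] Hr d g by blast
      moreover have "\<delta> \<noteq> \<beta>" using g root_ne_0[OF Hr(1)[OF g(1)]] by auto
      moreover have "\<beta> - \<delta> = \<gamma>" using g(3) by simp
      ultimately show "\<delta> \<in> ?F" using d g by simp
    qed
    show "?F \<subseteq> (\<lambda>\<gamma>. \<beta> - \<gamma>) ` (?H - D)"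
    proof
      fix \<delta> assume d: "\<delta> \<in> ?F"
      then have "\<beta> - \<delta> \<in> ?H - D" using heisenberg_complement[OF b, of \<delta>] by simp
      then have "\<beta> - (\<beta> - \<delta>) \<in> (\<lambda>\<gamma>. \<beta> - \<gamma>) ` (?H - D)" by (rule imageI)
      then show "\<delta> \<in> (\<lambda>\<gamma>. \<beta> - \<gamma>) ` (?H - D)" by simp
    qed
  qed
  moreover have "inj_on (\<lambda>\<gamma>. \<beta> - \<gamma>) (?H - D)" by (rule inj_onI) simp
  ultimately have "card ?F = card (?H - D)" using card_image by metis
  moreover have "{\<gamma> \<in> ?H \<inter> D. \<gamma> = \<beta> \<or> \<beta> - \<gamma> \<notin> D} = insert \<beta> ?F"
    using cascade_mem_heisenberg[OF b] D by auto
  ultimately show ?thesis using fin by simp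
qed

text \<open>Subsets \<open>S\<close> of the cascade are allowed so that removing one element leaves
  a claim of the same form. The element with the largest system is removed, because sums of its
  Heisenberg roots with the remaining roots then stay in its Heisenberg set.\<close>

lemma dim_rad_lower_bound:
  assumes D: "D \<subseteq> pos_roots"
    and up: "\<And>\<gamma> \<delta>. \<gamma> \<in> D \<Longrightarrow> \<delta> \<in> pos_roots \<Longrightarrow> \<gamma> + \<delta> \<in> roots \<Longrightarrow> \<gamma> + \<delta> \<in> D"
    and prime: "\<And>\<gamma> \<delta>. \<gamma> \<in> pos_roots \<Longrightarrow> \<delta> \<in> pos_roots \<Longrightarrow> \<gamma> + \<delta> \<in> D \<Longrightarrow> \<gamma> \<in> D \<or> \<delta> \<in> D"
    and S: "S \<subseteq> cascade \<inter> D" and f: "linear_form f"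
  shows "(\<Sum>\<beta>\<in>S. Suc (card (heisenberg_roots \<beta> - D)))
    \<le> dim (rad f (root_sum (\<Union>\<beta>\<in>S. heisenberg_roots \<beta> \<inter> D)))"
  using S f
proof (induction "card S" arbitrary: S f rule: less_induct)
  case less
  have finS: "finite S"
    using less.prems(1) cascade_pos pos_root finite_roots by (meson IntD1 finite_subset subset_iff)
  show ?case
  proof (cases "S = {}")
    case True
    then show ?thesis by simp
  next
    case False
    obtain \<beta> where bS: "\<beta> \<in> S" and bmax: "\<And>\<beta>'. \<beta>' \<in> S \<Longrightarrow> card (supp_system \<beta>') \<le> card (supp_system \<beta>)"
    proof -
      have "Max ((\<lambda>\<beta>. card (supp_system \<beta>)) ` S) \<in> (\<lambda>\<beta>. card (supp_system \<beta>)) ` S"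
        using finS False by (intro Max_in) auto
      then obtain \<beta> where "\<beta> \<in> S" "card (supp_system \<beta>) = Max ((\<lambda>\<beta>. card (supp_system \<beta>)) ` S)" by auto
      then show ?thesis using that[of \<beta>] finS by simp
    qed
    have b: "\<beta> \<in> cascade" "\<beta> \<in> D" using bS less.prems(1) by auto
    define T where "T = (\<Union>\<beta>'\<in>S - {\<beta>}. heisenberg_roots \<beta>' \<inter> D)"
    define k where "k = (\<Sum>\<beta>'\<in>S - {\<beta>}. Suc (card (heisenberg_roots \<beta>' - D)))"
    have T: "T \<subseteq> D" by (auto simp: T_def)
    have disj: "heisenberg_roots \<beta> \<inter> T = {}"
      using heisenberg_disjoint[OF b(1)] less.prems(1) unfolding T_def by blast
    have other: "\<gamma> + \<delta> \<in> heisenberg_roots \<beta> - {\<beta>}"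
      if gdT: "\<gamma> \<in> heisenberg_roots \<beta>" "\<delta> \<in> T" "\<gamma> + \<delta> \<in> roots" for \<gamma> \<delta>
    proof -
      obtain \<beta>' where b': "\<beta>' \<in> S" "\<beta> \<noteq> \<beta>'" "\<delta> \<in> heisenberg_roots \<beta>'"
        using gdT(2) unfolding T_def by blast
      have c': "\<beta>' \<in> cascade" using b'(1) less.prems(1) by blast
      show ?thesis
        using heisenberg_add_other[OF b(1) c' b'(2) bmax[OF b'(1)] gdT(1) b'(3) gdT(3)] by blast
    qed
    have IH: "k \<le> dim (rad g (root_sum T))" if "linear_form g" for g
      unfolding k_def T_def
      by (rule less.hyps[OF card_Diff1_less[OF finS bS] _ that]) (use less.prems(1) in blast)
    have Un: "(\<Union>\<beta>\<in>S. heisenberg_roots \<beta> \<inter> D) = heisenberg_roots \<beta> \<inter> D \<union> T"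
      using bS by (auto simp: T_def)
    have sum: "(\<Sum>\<beta>\<in>S. Suc (card (heisenberg_roots \<beta> - D))) = Suc (card (heisenberg_roots \<beta> - D)) + k"
      unfolding k_def using finS bS by (rule sum.remove)
    have cardE: "card {\<gamma> \<in> heisenberg_roots \<beta> \<inter> D. \<gamma> = \<beta> \<or> \<beta> - \<gamma> \<notin> D}
        = Suc (card (heisenberg_roots \<beta> - D))"
      by (rule card_heisenberg_self_paired[OF b]) (rule prime)
    have main: "Suc (card (heisenberg_roots \<beta> - D)) + k \<le> dim (rad g (root_sum (heisenberg_roots \<beta> \<inter> D \<union> T)))"
      if g: "linear_form g" "g (root_vec \<beta>) \<noteq> 0" for g
      using rad_dim_step[OF b(1) D b(2) up T disj other g IH] unfolding cardE .
    have br: "\<beta> \<in> roots" using b(1) cascade_pos pos_root by blast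
    \<comment> \<open>A form with value 1 at \<open>root_vec \<beta>\<close>; adding a nonzero
      multiple of it makes the splitting available when \<open>f\<close> vanishes there.\<close>
    obtain g where g: "linear_form g" "\<And>\<gamma>. \<gamma> \<in> roots \<Longrightarrow> g (root_vec \<gamma>) = (if \<gamma> \<in> {\<beta>} then 1 else 0)"
      using exists_form_root_vec[of "{\<beta>}"] br by blast
    show ?thesis
    proof (cases "f (root_vec \<beta>) = 0")
      case False
      then show ?thesis unfolding Un sum by (rule main[OF less.prems(2)])
    next
      case True
      show ?thesis
        unfolding Un sum
      proof (rule rad_semicontinuous[OF less.prems(2) g(1) subspace_root_sum])
        fix s :: complex assume "s \<noteq> 0"
        then show "Suc (card (heisenberg_roots \<beta> - D)) + k
            \<le> dim (rad (\<lambda>x. f x + s * g x) (root_sum (heisenberg_roots \<beta> \<inter> D \<union> T)))"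
          using True g(2)[OF br] less.prems(2) g(1)
          by (intro main) (auto simp: linear_form_def algebra_simps)
      qed
    qed
  qed
qed

text \<open>The form dual to the cascade elements pairs \<open>\<gamma>\<close> in a Heisenberg set only with \<open>\<beta> - \<gamma>\<close>.\<close>

lemma dim_rad_upper_bound:
  assumes K: "K \<subseteq> cascade"
  obtains g where "linear_form g" "dim (rad g (root_sum (\<Union>\<beta>\<in>K. heisenberg_roots \<beta>))) \<le> card K"
proof -
  define H where "H = (\<Union>\<beta>\<in>K. heisenberg_roots \<beta>)"
  have Kr: "K \<subseteq> roots" using K cascade_pos pos_root by blast
  have Hpos: "\<gamma> \<in> pos_roots" if "\<gamma> \<in> H" for \<gamma> using that heisenberg_rootD(2) K by (auto simp: H_def)
  then have Hr: "H \<subseteq> roots" using pos_root by blast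
  have finH: "finite H" using Hr finite_roots by (rule finite_subset)
  obtain g where g: "linear_form g" "\<And>\<gamma>. \<gamma> \<in> roots \<Longrightarrow> g (root_vec \<gamma>) = (if \<gamma> \<in> K then 1 else 0)"
    using exists_form_root_vec[OF Kr] by blast
  have "rad g (root_sum H) \<subseteq> root_sum K"
  proof
    fix y assume y: "y \<in> rad g (root_sum H)"
    then have "y \<in> span (root_vec ` H)" by (simp add: rad_def root_sum_def)
    then obtain c' where "y = (\<Sum>v\<in>root_vec ` H. c' v *s v)" using finH by (auto simp: span_finite)
    then have "y = (\<Sum>\<gamma>\<in>H. c' (root_vec \<gamma>) *s root_vec \<gamma>)"
      using inj_on_root_vec[OF Hr] by (simp add: sum.reindex)
    then obtain c where c: "y = (\<Sum>\<gamma>\<in>H. c \<gamma> *s root_vec \<gamma>)" by (rule that[of "\<lambda>\<gamma>. c' (root_vec \<gamma>)"])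
    \<comment> \<open>Pairing \<open>y\<close> with the root vector of
      \<open>\<beta> - \<gamma>\<close> isolates the coefficient of \<gamma>.\<close>
    have "c \<gamma> = 0" if gH: "\<gamma> \<in> H" and gK: "\<gamma> \<notin> K" for \<gamma>
    proof -
      obtain \<beta> where b: "\<beta> \<in> K" "\<gamma> \<in> heisenberg_roots \<beta>" using gH by (auto simp: H_def)
      have bc: "\<beta> \<in> cascade" using b(1) K by blast
      have "\<gamma> \<noteq> \<beta>" using b(1) gK by blast
      then have comp: "\<beta> - \<gamma> \<in> heisenberg_roots \<beta>" by (rule heisenberg_complement[OF bc b(2)])
      then have cH: "\<beta> - \<gamma> \<in> H" using b(1) by (auto simp: H_def)
      have zero: "g (bracket (root_vec \<delta>) (root_vec (\<beta> - \<gamma>))) = 0" if d: "\<delta> \<in> H" "\<delta> \<noteq> \<gamma>" for \<delta>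
      proof (cases "\<delta> + (\<beta> - \<gamma>) \<in> roots")
        case False
        then have "\<delta> + (\<beta> - \<gamma>) \<notin> weights" using pos_sum_weight[OF Hpos[OF d(1)] Hpos[OF cH]] by blast
        then have "bracket (root_vec \<delta>) (root_vec (\<beta> - \<gamma>)) = 0"
          using bracket_root_spaces_eq_0 d(1) cH Hr root_vec(1) by blast
        then show ?thesis using linear_form_zero[OF g(1)] by simp
      next
        case True
        have "\<delta> \<in> roots" "\<beta> - \<gamma> \<in> roots" using d(1) cH Hr by auto
        then obtain k where k: "bracket (root_vec \<delta>) (root_vec (\<beta> - \<gamma>)) = k *s root_vec (\<delta> + (\<beta> - \<gamma>))"
          using bracket_root_vec True by metis
        \<comment> \<open>A cascade element that is a sum of two Heisenberg roots, one of them from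
          the set of \<beta>, equals \<beta>; this would force
          \<open>\<delta> = \<gamma>\<close>.\<close>
        have "\<delta> + (\<beta> - \<gamma>) \<notin> K"
        proof
          assume kK: "\<delta> + (\<beta> - \<gamma>) \<in> K"
          obtain \<beta>' where b': "\<beta>' \<in> K" "\<delta> \<in> heisenberg_roots \<beta>'" using d(1) by (auto simp: H_def)
          have c': "\<beta>' \<in> cascade" using b'(1) K by blast
          have "(\<beta> - \<gamma>) + \<delta> \<in> cascade" using kK K by (auto simp: add.commute)
          then have "(\<beta> - \<gamma>) + \<delta> = \<beta>" by (rule heisenberg_add_cascade[OF bc c' comp b'(2)])
          then show False using d(2) by (simp add: algebra_simps)
        qed
        then show ?thesis using g(2)[OF True] g(1) by (simp add: k linear_form_scale)
      qed
      have "\<gamma> + (\<beta> - \<gamma>) \<in> roots" using b(1) Kr by auto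
      then obtain k where k: "k \<noteq> 0" "bracket (root_vec \<gamma>) (root_vec (\<beta> - \<gamma>)) = k *s root_vec (\<gamma> + (\<beta> - \<gamma>))"
        using bracket_root_vec[of \<gamma> "\<beta> - \<gamma>"] gH cH Hr by blast
      then have gk: "g (bracket (root_vec \<gamma>) (root_vec (\<beta> - \<gamma>))) = k"
        using g b(1) Kr by (auto simp: linear_form_scale)
      have "0 = g (bracket y (root_vec (\<beta> - \<gamma>)))" using y root_vec_mem[OF cH] by (simp add: rad_def)
      also have "\<dots> = (\<Sum>\<delta>\<in>H. c \<delta> * g (bracket (root_vec \<delta>) (root_vec (\<beta> - \<gamma>))))"
        unfolding c bracket_sum_left bracket_scale_left
        by (simp add: linear_form_sum[OF g(1)] linear_form_scale[OF g(1)])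
      also have "\<dots> = (\<Sum>\<delta>\<in>H. if \<delta> = \<gamma> then c \<gamma> * k else 0)"
        by (rule sum.cong) (use zero gk in auto)
      finally show "c \<gamma> = 0" using gH finH k(1) by simp
    qed
    then have "c \<gamma> *s root_vec \<gamma> \<in> root_sum K" if "\<gamma> \<in> H" for \<gamma>
      using that root_vec_mem[of \<gamma> K] subspace_scale[OF subspace_root_sum] subspace_0[OF subspace_root_sum]
      by (cases "\<gamma> \<in> K") auto
    then show "y \<in> root_sum K" unfolding c by (intro subspace_sum subspace_root_sum)
  qed
  then have "dim (rad g (root_sum H)) \<le> dim (root_sum K)" by (rule dim_subset)
  also have "\<dots> = card K" by (rule dim_root_sum[OF Kr])
  finally show ?thesis using that[OF g(1)] by (simp add: H_def)
qed


subsection \<open>Comparison of nilradicals with the same optimisation\<close>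

lemma optimisation_root_sum:
  assumes "standard_nilradical n"
  shows "optimisation n = root_sum (\<Union>\<beta>\<in>cascade \<inter> roots_in n. heisenberg_roots \<beta>)"
proof -
  let ?K = "cascade \<inter> roots_in n"
  have Hr: "heisenberg_roots \<beta> \<subseteq> roots" for \<beta> by (auto simp: heisenberg_roots_def pos_root)
  have "heisenberg \<beta> = root_sum (heisenberg_roots \<beta>)" for \<beta>
    unfolding heisenberg_def by (rule root_sum_eq[OF Hr])
  then have eq: "optimisation n = span (\<Union>\<beta>\<in>?K. root_sum (heisenberg_roots \<beta>))"
    by (simp add: optimisation_def)
  also have "\<dots> = root_sum (\<Union>\<beta>\<in>?K. heisenberg_roots \<beta>)"
  proof
    show "span (\<Union>\<beta>\<in>?K. root_sum (heisenberg_roots \<beta>)) \<subseteq> root_sum (\<Union>\<beta>\<in>?K. heisenberg_roots \<beta>)"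
      by (rule span_minimal[OF _ subspace_root_sum]) (intro UN_least root_sum_mono, blast)
    show "root_sum (\<Union>\<beta>\<in>?K. heisenberg_roots \<beta>) \<subseteq> span (\<Union>\<beta>\<in>?K. root_sum (heisenberg_roots \<beta>))"
      unfolding root_sum_def[of "\<Union>\<beta>\<in>?K. heisenberg_roots \<beta>"]
      by (rule span_minimal) (auto intro!: span_base root_vec_mem)
  qed
  finally show ?thesis .
qed

text \<open>The roots of the optimisation form a union of Heisenberg sets, and a cascade element
  lies only in its own one. So the optimisation remembers which cascade elements belong to the
  nilradical.\<close>

lemma cascade_optimisation_subset:
  assumes n: "standard_nilradical n" and n': "standard_nilradical n'" and eq: "optimisation n = optimisation n'"
  shows "cascade \<inter> roots_in n \<subseteq> cascade \<inter> roots_in n'"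
proof
  fix \<beta> assume b: "\<beta> \<in> cascade \<inter> roots_in n"
  let ?H = "\<lambda>n. \<Union>\<beta>\<in>cascade \<inter> roots_in n. heisenberg_roots \<beta>"
  have "root_vec \<beta> \<in> root_sum (?H n)" using b cascade_mem_heisenberg by (intro root_vec_mem) blast
  then have "root_vec \<beta> \<in> root_sum (?H n')" using eq optimisation_root_sum[OF n] optimisation_root_sum[OF n'] by simp
  moreover have "?H n' \<subseteq> roots" by (auto simp: heisenberg_roots_def pos_root)
  moreover have "\<beta> \<in> roots" using b by (simp add: roots_in_def)
  ultimately have "\<beta> \<in> ?H n'" using root_vec_mem_iff by blast
  then obtain \<beta>' where "\<beta>' \<in> cascade \<inter> roots_in n'" "\<beta> \<in> heisenberg_roots \<beta>'" by blast
  then show "\<beta> \<in> cascade \<inter> roots_in n'"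
    using heisenberg_disjoint[of \<beta> \<beta>'] cascade_mem_heisenberg[of \<beta>] b by blast
qed

text \<open>If \<gamma> belongs to the nilradical and to the Heisenberg set of \<beta>, adding the
  positive root \<open>\<beta> - \<gamma>\<close> leads to \<beta> inside the ideal.\<close>

lemma nilradical_roots_partition:
  assumes "standard_nilradical n"
  shows "roots_in n = (\<Union>\<beta>\<in>cascade \<inter> roots_in n. heisenberg_roots \<beta> \<inter> roots_in n)"
proof -
  have "\<exists>\<beta>\<in>cascade \<inter> roots_in n. \<gamma> \<in> heisenberg_roots \<beta>" if g: "\<gamma> \<in> roots_in n" for \<gamma>
  proof -
    obtain \<beta> where b: "\<beta> \<in> cascade" "\<gamma> \<in> heisenberg_roots \<beta>"
      using heisenberg_exhausts standard_nilradical_roots(1)[OF assms] g by blast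
    have "\<beta> \<in> roots_in n"
    proof (cases "\<gamma> = \<beta>")
      case False
      then have "\<beta> - \<gamma> \<in> pos_roots"
        using heisenberg_rootD(2)[OF b(1) heisenberg_complement[OF b]] by blast
      moreover have "\<gamma> + (\<beta> - \<gamma>) \<in> roots" using b(1) cascade_pos pos_root by simp
      ultimately have "\<gamma> + (\<beta> - \<gamma>) \<in> roots_in n" by (rule standard_nilradical_roots(4)[OF assms g])
      then show ?thesis by simp
    qed (use g in simp)
    then show ?thesis using b by blast
  qed
  then show ?thesis by blast
qed

text \<open>The subspace \<open>?W\<close> is the common optimisation, and \<open>m\<close> equals
  \<open>dim ?W + card K\<close>. The form dual to \<open>K\<close> is estimated on
  \<open>?W\<close>, and restriction to \<open>n'\<close> preserves the bound; on \<open>n\<close>,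
  the lower bound counts the missing roots \<open>?H \<beta> - D\<close>.\<close>

lemma frobenius_semiradical_nilradical_mono:
  assumes n: "standard_nilradical n" and n': "standard_nilradical n'" and sub: "n \<subseteq> n'"
    and eq: "optimisation n = optimisation n'"
  shows "frobenius_semiradical n' \<subseteq> frobenius_semiradical n"
proof -
  define D where "D = roots_in n"
  define K where "K = cascade \<inter> D"
  let ?H = heisenberg_roots
  define m where "m = (\<Sum>\<beta>\<in>K. Suc (card (?H \<beta>)))"
  have K': "cascade \<inter> roots_in n' = K"
    using cascade_optimisation_subset[OF n n' eq] cascade_optimisation_subset[OF n' n eq[symmetric]]
    by (auto simp: K_def D_def)
  have finH: "finite (?H \<beta>)" for \<beta>
    using finite_roots by (rule rev_finite_subset) (auto simp: heisenberg_roots_def pos_root)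
  have Kr: "K \<subseteq> roots" by (auto simp: K_def D_def roots_in_def)
  have finK: "finite K" using Kr finite_roots by (rule finite_subset)
  have disj: "\<And>\<beta> \<beta>'. \<beta> \<in> K \<Longrightarrow> \<beta>' \<in> K \<Longrightarrow> \<beta> \<noteq> \<beta>' \<Longrightarrow> ?H \<beta> \<inter> ?H \<beta>' = {}"
    using heisenberg_disjoint by (auto simp: K_def)
  have Dr: "D \<subseteq> roots" by (auto simp: D_def roots_in_def)
  have D: "D = (\<Union>\<beta>\<in>K. ?H \<beta> \<inter> D)" using nilradical_roots_partition[OF n] by (simp add: D_def K_def)
  have nD: "n = root_sum D" using standard_nilradical_roots(2)[OF n] by (simp add: D_def)
  have "card D = card (\<Union>\<beta>\<in>K. ?H \<beta> \<inter> D)" using D by (rule arg_cong)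
  also have "\<dots> = (\<Sum>\<beta>\<in>K. card (?H \<beta> \<inter> D))"
    by (rule card_UN_disjoint) (use finK finH disj in blast)+
  finally have cardD: "card D = (\<Sum>\<beta>\<in>K. card (?H \<beta> \<inter> D))" .
  have lower: "m \<le> dim (rad f n) + dim n" if f: "linear_form f" for f
  proof -
    have "(\<Sum>\<beta>\<in>K. Suc (card (?H \<beta> - D))) \<le> dim (rad f (root_sum (\<Union>\<beta>\<in>K. ?H \<beta> \<inter> D)))"
      by (rule dim_rad_lower_bound[OF _ _ _ _ f])
        (use standard_nilradical_roots(1,4,5)[OF n] in \<open>auto simp: K_def D_def\<close>)
    then have "(\<Sum>\<beta>\<in>K. Suc (card (?H \<beta> - D))) \<le> dim (rad f n)" using D nD by simp
    moreover have "m = (\<Sum>\<beta>\<in>K. Suc (card (?H \<beta> - D))) + (\<Sum>\<beta>\<in>K. card (?H \<beta> \<inter> D))"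
      unfolding m_def sum.distrib[symmetric]
      by (rule sum.cong) (simp_all add: card_Diff_subset_Int finH card_mono)
    moreover have "dim n = card D" unfolding nD by (rule dim_root_sum[OF Dr])
    ultimately show ?thesis using cardD by simp
  qed
  let ?W = "root_sum (\<Union>\<beta>\<in>K. ?H \<beta>)"
  obtain g where g: "linear_form g" "dim (rad g ?W) \<le> card K"
    using dim_rad_upper_bound[of K] by (auto simp: K_def)
  have "n' \<subseteq> ?W"
  proof -
    have "roots_in n' \<subseteq> (\<Union>\<beta>\<in>K. ?H \<beta>)" using nilradical_roots_partition[OF n'] K' by auto
    then show ?thesis using standard_nilradical_roots(2)[OF n'] root_sum_mono by metis
  qed
  then have "dim (rad g n') + dim n' \<le> dim ?W + dim (rad g ?W \<inter> n')"
    using standard_nilradical_roots(3)[OF n']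
    by (intro dim_rad_subspace g(1) subspace_root_sum) (simp_all add: subalgebra_def)
  moreover have "dim (rad g ?W \<inter> n') \<le> dim (rad g ?W)" by (rule dim_subset) blast
  moreover have "dim ?W = (\<Sum>\<beta>\<in>K. card (?H \<beta>))"
  proof -
    have "(\<Union>\<beta>\<in>K. ?H \<beta>) \<subseteq> roots" by (auto simp: heisenberg_roots_def pos_root)
    then have "dim ?W = card (\<Union>\<beta>\<in>K. ?H \<beta>)" by (rule dim_root_sum)
    also have "\<dots> = (\<Sum>\<beta>\<in>K. card (?H \<beta>))"
      by (rule card_UN_disjoint) (use finK finH disj in blast)+
    finally show ?thesis .
  qed
  moreover have "m = (\<Sum>\<beta>\<in>K. card (?H \<beta>)) + card K"
    by (simp add: m_def sum.distrib flip: sum_Suc)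
  ultimately have upper: "dim (rad g n') + dim n' \<le> m" using g(2) by simp
  show ?thesis
    by (rule frobenius_semiradical_mono[OF standard_nilradical_roots(3)[OF n]
          standard_nilradical_roots(3)[OF n'] sub lower g(1) upper])
qed

end


theorem proposition4p10:
  fixes scale :: "complex \<Rightarrow> 'a::ab_group_add \<Rightarrow> 'a"
    and Basis :: "'a set"
    and bracket :: "'a \<Rightarrow> 'a \<Rightarrow> 'a"
    and u t um n n' :: "'a set"
  assumes "simple_lie_algebra scale Basis bracket u t um"
    and "lie_algebra_triple.standard_nilradical scale bracket u t n"
    and "lie_algebra_triple.standard_nilradical scale bracket u t n'"
    and "n \<subseteq> n'"
    and "lie_algebra_triple.optimisation scale Basis bracket u t n
       = lie_algebra_triple.optimisation scale Basis bracket u t n'"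
  shows "complex_lie_algebra.frobenius_semiradical scale bracket n'
           \<subseteq> complex_lie_algebra.frobenius_semiradical scale bracket n
       \<and> complex_lie_algebra.frobenius_semiradical scale bracket n \<subseteq> n"
proof -
  interpret simple_lie_algebra scale Basis bracket u t um by (rule assms(1))
  have "subspace n"
    using standard_nilradical_roots(3)[OF assms(2)] by (simp add: subalgebra_def)
  then show ?thesis
    using frobenius_semiradical_nilradical_mono[OF assms(2-5)] frobenius_semiradical_subset by blast
qed

end
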